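(* Let $R$ be a commutative ring, $P$ a balanced polytope admitting a column vector, $\mathfrak P$ a doubling spectrum starting with $P$, and let $V\subset\mathrm{Col}(\mathfrak P)$ be a rigid system with supporting graph $\mathbf F$, where $t$ is the maximal degree of an edge of $\mathbf F$. (a) For each $r\in\{1,\dots,t\}$ the mapping $\tau_r:R^{N_r}\to G_r(R,V)$ is an injective group homomorphism (defined on the additive group $(R^{N_r},+)$). (b) For each $r\in\{1,\dots,t\}$, every element $\epsilon\in G_r(R,V)$ admits a unique representation $$\epsilon=\epsilon_r\circ\epsilon_{r+1}\circ\cdots\circ\epsilon_t,\qquad \epsilon_s\in A_s(R,V),\quad s\in\{r,\dots,t\}.$$
   Context: **Polytopes and column vectors.** All polytopes are convex lattice polytopes $P\subset\mathbb{R}^n$ (vertices in $\mathbb{Z}^n$), with $\dim P=n$ and $\mathbb{Z}^n$ the smallest affine lattice containing $L_P:=P\cap\mathbb{Z}^n$. For a facet $F$ of $P$ let $\langle F,-\rangle:\mathbb{Z}^n\to\mathbb{Z}$ (extended linearly to $\mathbb{R}^n$) be the unique surjective homomorphism that is constant on $F$ and whose minimum $b_F$ over $P$ is attained exactly on $F$. A nonzero $v\in\mathbb{Z}^n$ is a column vector of $P$ if there is a facet $F$ with $x+v\in P$ for all $x\in L_P\setminus F$; then $F$ is unique, called the base facet of $v$ and denoted $P_v$. $\mathrm{Col}(P)$ is the set of column vectors. For $u,v\in\mathrm{Col}(P)$ the product $uv$ exists if $u+v\ne0$ and $x+u\notin P_v$ for every $x\in L_P\setminus P_u$; then $uv:=u+v\in\mathrm{Col}(P)$.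 $P$ is balanced if $\langle P_u,v\rangle\le1$ for all $u,v\in\mathrm{Col}(P)$. **Doubling and stable groups.** For a facet $F$ put $\mathrm{ht}_F(x)=\langle F,x\rangle-b_F$. The doubling of $P$ along $F$ is (up to integral-affine equivalence) $P^{\square_F}=\{(x,s):x\in P,\ 0\le s\le \mathrm{ht}_F(x)\}\subset\mathbb{R}^{n+1}$; identify $P$ with $P\times\{0\}$; then $\mathrm{Col}(P)\subset\mathrm{Col}(P^{\square_F})$. For $v\in\mathrm{Col}(P)$ put $P^{\square_v}:=P^{\square_{P_v}}$. A doubling spectrum $\mathfrak P=(P=P_0\subset P_1\subset\cdots)$ is a chain such that for each $i$ there is $v\in\mathrm{Col}(P_i)$ with $P_{i+1}=P_i^{\square_v}$, and for each $i$ and each $v\in\mathrm{Col}(P_i)$ there is $j\ge i$ with $P_{j+1}=P_j^{\square_v}$. $\mathrm{Col}(\mathfrak P)=\bigcup_i\mathrm{Col}(P_i)$, with the induced partial product. $R[P]=R[S_P]$ is the semigroup ring of the subsemigroup $S_P\subset\mathbb{Z}^{n+1}$ generated by $(z,1)$, $z\in L_P$. For $v\in\mathrm{Col}(P)$ and $\lambda\in R$, $e_v^\lambda$ is the graded $R$-algebra automorphism of $R[P]$ given by $x\mapsto(1+\lambda v)^{\mathrm{ht}_v(x)}x$, $x\in S_P$, computed in $R[\mathbb{Z}^{n+1}]$, where $v$ is identified with the monomial $(v,0)$ and $\mathrm{ht}_v(x',x'')=\langle P_v,x'\rangle-x''b_{P_v}$. For $v\in\mathrm{Col}(\mathfrak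 P)$ these are compatible and define $e_v^\lambda$ on $R[\mathfrak P]=\bigcup_iR[P_i]$. $\mathbb{E}(R,P)$ is the group generated by all $e_v^\lambda$, $v\in\mathrm{Col}(\mathfrak P)$, $\lambda\in R$; it is independent of $\mathfrak P$ up to natural isomorphism. **Rigid systems.** A product $v_1\cdots v_m$ exists (strongly) if $v_iv_{i+1}$ exists for all $i<m$ and $\sum_{i=r}^sv_i\ne0$ for all $1\le r<s\le m$; it exists weakly if for some bracketing all recursively formed products of pairs exist. For a set $V$ of column vectors, $[V]$ (resp. $\langle V\rangle$) is the set of all strongly (resp. weakly) existing products of elements of $V$ (including the elements of $V$). A graph is a finite directed graph without isolated vertices, multiple edges or loops such that if $a,b$ are joined by an edge there is no other directed path connecting them. $\mathrm{path}(\mathbf F)$ is the set of nonempty directed paths with concatenation as partial product; $\overline{\mathrm{path}}(\mathbf F)$ is its quotient identifying paths with the same initial and the same end point. $V\subset\mathrm{Col}(P)$ is rigid if (1) $[V]$ contains no pair $\{v,-v\}$; (2) $[V]=\langle V\rangle$; (3) there are a graph $\mathbf F$ and an isomorphism of partial product structures $[V]\approx\overline{\mathrm{path}}(\mathbf F)$; then $\mathbf F$ (with a fixed isomorphism) is said to support $V$. $V\subset\mathrm{Col}(\mathfrak P)$ is rigid if it is a rigid system in some $\mathrm{Col}(P_j)$. **Triangular groups.** Order the edges of $\mathbf F$ by $f\le g$ if some path has first edge $f$ and last edge $g$. An edge $f$ has degree $r$ if there is a chain $f_1<\cdots<f_r=f$ but no chain with $r+1$ elements ending in $f$; $t$ is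 the maximal degree. $[V]^r=\{v_{r1},\dots,v_{rN_r}\}$ is the set of elements of $[V]$ corresponding to paths whose initial edge has degree $r$ ($N_r$ its cardinality); $[V]_r$ is the set of those whose initial edge has degree $\ge r$. $G_r(R,V)\subset\mathbb{E}(R,P)$ is the subgroup generated by the $e_v^\lambda$ with $\lambda\in R$, $v\in[V]_r$. The map $\tau_r:R^{N_r}\to G_r(R,V)$ is $(\lambda_1,\dots,\lambda_{N_r})\mapsto e_{v_{r1}}^{\lambda_1}\circ\cdots\circ e_{v_{rN_r}}^{\lambda_{N_r}}$, and $A_r(R,V)=\mathrm{Im}(\tau_r)$. *)

theory Defs
  imports
    "HOL-Analysis.Polytope"
    "HOL-Analysis.Finite_Function_Topology"
    "HOL-Analysis.Product_Vector"
    "HOL-Library.Poly_Mapping"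
    "HOL-Algebra.Bij"
    "HOL-Algebra.Elementary_Groups"
    "HOL-Algebra.Product_Groups"
    "Graph_Theory.Arc_Walk"
begin

section \<open>Lattice polytopes\<close>

text \<open>
  The dimension grows along a doubling spectrum, so all polytopes live in the space of finitely
  supported sequences: \<open>\<real>\<^sup>n\<close> and \<open>\<int>\<^sup>n\<close> are the sequences supported on \<open>{..<n}\<close>.
  The identification of \<open>P\<close> with \<open>P \<times> {0}\<close> is then an equality of sets.
\<close>

type_synonym lvec = "nat \<Rightarrow>\<^sub>0 int"
type_synonym rvec = "nat \<Rightarrow>\<^sub>0 real"

definition Zn :: "nat \<Rightarrow> lvec set" where
  "Zn n = {x. Poly_Mapping.keys x \<subseteq> {..<n}}"

definition rv :: "lvec \<Rightarrow> rvec" where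
  "rv x = Poly_Mapping.map real_of_int x"

definition lat_pts :: "rvec set \<Rightarrow> lvec set" where
  "lat_pts P = {x. rv x \<in> P}"

definition affine_lattice :: "lvec set \<Rightarrow> bool" where
  "affine_lattice M \<longleftrightarrow>
     (\<exists>x H. 0 \<in> H \<and> (\<forall>a\<in>H. \<forall>b\<in>H. a - b \<in> H) \<and> M = (+) x ` H)"

text \<open>
  The library's \<^const>\<open>aff_dim\<close> and \<open>facet_of\<close> are restricted to Euclidean spaces, which
  finitely supported sequences are not. Since \<open>affdim {} = 0\<close>, nonemptiness is required separately.
\<close>

definition affdim :: "'a::real_vector set \<Rightarrow> nat" where
  "affdim S = dim {x - y | x y. x \<in> S \<and> y \<in> S}"

definition is_facet :: "rvec set \<Rightarrow> rvec set \<Rightarrow> bool" where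
  "is_facet P F \<longleftrightarrow> F face_of P \<and> F \<noteq> {} \<and> affdim F + 1 = affdim P"

text \<open>The last conjunct says that \<open>\<int>\<^sup>n\<close> is the smallest affine lattice containing \<open>L\<^sub>P\<close>.\<close>

definition lattice_polytope :: "nat \<Rightarrow> rvec set \<Rightarrow> bool" where
  "lattice_polytope n P \<longleftrightarrow>
     (\<exists>S. finite S \<and> S \<subseteq> Zn n \<and> P = convex hull (rv ` S)) \<and>
     P \<noteq> {} \<and> affdim P = n \<and>
     affine_lattice hull (lat_pts P) = Zn n"

text \<open>Linear extension to real vectors of a homomorphism into \<open>\<int>\<close>.\<close>

definition lin_ext :: "(lvec \<Rightarrow> int) \<Rightarrow> rvec \<Rightarrow> real" where
  "lin_ext h x = (\<Sum>i\<in>Poly_Mapping.keys x. Poly_Mapping.lookup x i * real_of_int (h (Poly_Mapping.single i 1)))"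

definition min_exactly_on :: "rvec set \<Rightarrow> rvec set \<Rightarrow> (lvec \<Rightarrow> int) \<Rightarrow> int \<Rightarrow> bool" where
  "min_exactly_on P F h b \<longleftrightarrow>
     (\<forall>x\<in>P. real_of_int b \<le> lin_ext h x) \<and> F = {x\<in>P. lin_ext h x = real_of_int b}"

text \<open>
  A homomorphism \<open>\<int>\<^sup>n \<rightarrow> \<int>\<close> is represented by its extension by zero on the coordinates \<open>\<ge> n\<close>;
  this makes \<open>\<langle>F,-\<rangle>\<close> unique as a total function.
\<close>

definition facet_form :: "nat \<Rightarrow> rvec set \<Rightarrow> rvec set \<Rightarrow> lvec \<Rightarrow> int" where
  "facet_form n P F = (THE h. additive h \<and> (\<forall>i\<ge>n. h (Poly_Mapping.single i 1) = 0) \<and>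
     h ` Zn n = UNIV \<and> (\<exists>b. min_exactly_on P F h b))"

definition facet_min :: "nat \<Rightarrow> rvec set \<Rightarrow> rvec set \<Rightarrow> int" where
  "facet_min n P F = (THE b. min_exactly_on P F (facet_form n P F) b)"

section \<open>Column vectors\<close>

definition base_of :: "rvec set \<Rightarrow> lvec \<Rightarrow> rvec set \<Rightarrow> bool" where
  "base_of P v F \<longleftrightarrow> is_facet P F \<and> (\<forall>x\<in>lat_pts P. rv x \<notin> F \<longrightarrow> rv (x + v) \<in> P)"

definition Col :: "nat \<Rightarrow> rvec set \<Rightarrow> lvec set" where
  "Col n P = {v \<in> Zn n. v \<noteq> 0 \<and> (\<exists>F. base_of P v F)}"

definition base_facet :: "rvec set \<Rightarrow> lvec \<Rightarrow> rvec set" where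
  "base_facet P v = (THE F. base_of P v F)"

definition prod_exists :: "nat \<Rightarrow> rvec set \<Rightarrow> lvec \<Rightarrow> lvec \<Rightarrow> bool" where
  "prod_exists n P u v \<longleftrightarrow> u \<in> Col n P \<and> v \<in> Col n P \<and> u + v \<noteq> 0 \<and>
     (\<forall>x\<in>lat_pts P. rv x \<notin> base_facet P u \<longrightarrow> rv (x + u) \<notin> base_facet P v)"

definition balanced :: "nat \<Rightarrow> rvec set \<Rightarrow> bool" where
  "balanced n P \<longleftrightarrow> (\<forall>u\<in>Col n P. \<forall>v\<in>Col n P. facet_form n P (base_facet P u) v \<le> 1)"

section \<open>Doubling\<close>

text \<open>The new coordinate of \<open>\<real>\<^sup>n\<^sup>+\<^sup>1\<close> has index \<open>n\<close>.\<close>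

definition doubling :: "nat \<Rightarrow> rvec set \<Rightarrow> rvec set \<Rightarrow> rvec set" where
  "doubling n P F = {x + Poly_Mapping.single n s | x s. x \<in> P \<and> 0 \<le> s \<and>
     s \<le> lin_ext (facet_form n P F) x - real_of_int (facet_min n P F)}"

text \<open>For a spectrum starting in dimension \<open>n\<close>, the \<open>i\<close>-th polytope \<open>\<PP> i\<close> lies in \<open>\<real>\<^sup>n\<^sup>+\<^sup>i\<close>.\<close>

definition doubling_spectrum :: "nat \<Rightarrow> (nat \<Rightarrow> rvec set) \<Rightarrow> bool" where
  "doubling_spectrum n \<PP> \<longleftrightarrow>
     (\<forall>i. \<exists>v\<in>Col (n + i) (\<PP> i). \<PP> (Suc i) = doubling (n + i) (\<PP> i) (base_facet (\<PP> i) v)) \<and>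
     (\<forall>i. \<forall>v\<in>Col (n + i) (\<PP> i). \<exists>j\<ge>i.
        \<PP> (Suc j) = doubling (n + j) (\<PP> j) (base_facet (\<PP> j) v))"

definition Col_spec :: "nat \<Rightarrow> (nat \<Rightarrow> rvec set) \<Rightarrow> lvec set" where
  "Col_spec n \<PP> = (\<Union>i. Col (n + i) (\<PP> i))"

section \<open>Polytopal algebras and elementary automorphisms\<close>

text \<open>
  \<open>'r garing\<close> is the group ring over \<open>'r\<close> of the lattice \<open>\<int>\<^sup>\<infinity> \<times> \<int>\<close>, the second factor being
  the degree; it contains every \<open>R[\<int>\<^sup>n\<^sup>+\<^sup>1]\<close>. Following the usual convention for affine
  semigroups, \<open>S\<^sub>P\<close> contains 0, so that \<open>R[P]\<close> is unital.
\<close>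

type_synonym 'r garing = "(lvec \<times> int) \<Rightarrow>\<^sub>0 'r"

inductive_set S_poly :: "rvec set \<Rightarrow> (lvec \<times> int) set" for P :: "rvec set" where
  zero: "0 \<in> S_poly P"
| add: "z \<in> lat_pts P \<Longrightarrow> s \<in> S_poly P \<Longrightarrow> (z, 1) + s \<in> S_poly P"

definition R_poly :: "rvec set \<Rightarrow> 'r::comm_ring_1 garing set" where
  "R_poly P = {f. Poly_Mapping.keys f \<subseteq> S_poly P}"

definition R_spec :: "(nat \<Rightarrow> rvec set) \<Rightarrow> 'r::comm_ring_1 garing set" where
  "R_spec \<PP> = (\<Union>i. R_poly (\<PP> i))"

definition ht :: "nat \<Rightarrow> rvec set \<Rightarrow> lvec \<Rightarrow> lvec \<times> int \<Rightarrow> int" where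
  "ht n P v x = facet_form n P (base_facet P v) (fst x) - snd x * facet_min n P (base_facet P v)"

text \<open>
  The \<open>R\<close>-linear map with \<open>x \<mapsto> (1 + cv)\<^bsup>ht x\<^esup> x\<close> on monomials. Heights are nonnegative on
  \<open>S\<^sub>P\<close>, so \<^const>\<open>nat\<close> does not truncate for arguments in \<open>R[P]\<close>.
\<close>

definition elem_poly :: "nat \<Rightarrow> rvec set \<Rightarrow> lvec \<Rightarrow> 'r::comm_ring_1 \<Rightarrow> 'r garing \<Rightarrow> 'r garing" where
  "elem_poly n P v c f = (\<Sum>x\<in>Poly_Mapping.keys f.
     (1 + Poly_Mapping.single (v, 0) c) ^ nat (ht n P v x) * Poly_Mapping.single x (Poly_Mapping.lookup f x))"

text \<open>
  On \<open>R[\<PP>]\<close>, evaluate at a stage \<open>i\<close> with \<open>v \<in> Col P\<^sub>i\<close> and \<open>f \<in> R[P\<^sub>i]\<close>; the result does not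
  depend on \<open>i\<close>. As an element of \<^const>\<open>BijGroup\<close> the map is undefined off \<open>R[\<PP>]\<close>.
\<close>

definition elem_spec ::
  "nat \<Rightarrow> (nat \<Rightarrow> rvec set) \<Rightarrow> lvec \<Rightarrow> 'r::comm_ring_1 \<Rightarrow> 'r garing \<Rightarrow> 'r garing" where
  "elem_spec n \<PP> v c = (\<lambda>f\<in>R_spec \<PP>.
     let i = (LEAST i. v \<in> Col (n + i) (\<PP> i) \<and> f \<in> R_poly (\<PP> i))
     in elem_poly (n + i) (\<PP> i) v c f)"

definition E_group ::
  "nat \<Rightarrow> (nat \<Rightarrow> rvec set) \<Rightarrow> ('r::comm_ring_1 garing \<Rightarrow> 'r garing) monoid" where
  "E_group n \<PP> = subgroup_generated (BijGroup (R_spec \<PP>))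
     {elem_spec n \<PP> v c | v c. v \<in> Col_spec n \<PP>}"

section \<open>Rigid systems\<close>

definition strongly_exists :: "nat \<Rightarrow> rvec set \<Rightarrow> lvec list \<Rightarrow> bool" where
  "strongly_exists n P vs \<longleftrightarrow> successively (prod_exists n P) vs \<and>
     (\<forall>r s. r < s \<and> s < length vs \<longrightarrow> (\<Sum>i=r..s. vs ! i) \<noteq> 0)"

definition strong_products :: "nat \<Rightarrow> rvec set \<Rightarrow> lvec set \<Rightarrow> lvec set" where
  "strong_products n P V = {sum_list vs | vs. vs \<noteq> [] \<and> set vs \<subseteq> V \<and> strongly_exists n P vs}"

text \<open>Derivations of membership correspond to bracketings with existing pairwise products.\<close>

inductive_set weak_products :: "nat \<Rightarrow> rvec set \<Rightarrow> lvec set \<Rightarrow> lvec set"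
  for n :: nat and P :: "rvec set" and V :: "lvec set" where
  base: "v \<in> V \<Longrightarrow> v \<in> weak_products n P V"
| mult: "a \<in> weak_products n P V \<Longrightarrow> b \<in> weak_products n P V \<Longrightarrow> prod_exists n P a b \<Longrightarrow>
    a + b \<in> weak_products n P V"

definition dipaths :: "('a, 'b) pre_digraph \<Rightarrow> 'b list set" where
  "dipaths G = {p. p \<noteq> [] \<and> (\<exists>u w. pre_digraph.awalk G u p w)}"

text \<open>\<^const>\<open>digraph\<close> already excludes infinite graphs, loops and multiple arcs.\<close>

definition rigid_graph :: "('a, 'b) pre_digraph \<Rightarrow> bool" where
  "rigid_graph G \<longleftrightarrow> digraph G \<and>
     (\<forall>x\<in>verts G. \<exists>e\<in>arcs G. tail G e = x \<or> head G e = x) \<and>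
     (\<forall>e\<in>arcs G. \<forall>p. p \<noteq> [] \<and> pre_digraph.awalk G (tail G e) p (head G e) \<longrightarrow> p = [e])"

definition same_ends :: "('a, 'b) pre_digraph \<Rightarrow> ('b list \<times> 'b list) set" where
  "same_ends G = {(p, q). p \<in> dipaths G \<and> q \<in> dipaths G \<and>
     tail G (hd p) = tail G (hd q) \<and> head G (last p) = head G (last q)}"

definition path_bar :: "('a, 'b) pre_digraph \<Rightarrow> 'b list set set" where
  "path_bar G = dipaths G // same_ends G"

text \<open>Graph of the partial product on \<^const>\<open>path_bar\<close> induced by concatenation.\<close>

definition bar_prod ::
  "('a, 'b) pre_digraph \<Rightarrow> 'b list set \<Rightarrow> 'b list set \<Rightarrow> 'b list set \<Rightarrow> bool" where
  "bar_prod G C D E \<longleftrightarrow> (\<exists>p\<in>C. \<exists>q\<in>D. p @ q \<in> dipaths G \<and> E = same_ends G `` {p @ q})"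

definition supports ::
  "nat \<Rightarrow> rvec set \<Rightarrow> lvec set \<Rightarrow> ('a, 'b) pre_digraph \<Rightarrow> (lvec \<Rightarrow> 'b list set) \<Rightarrow> bool" where
  "supports n P V G \<phi> \<longleftrightarrow> rigid_graph G \<and>
     bij_betw \<phi> (strong_products n P V) (path_bar G) \<and>
     (\<forall>u\<in>strong_products n P V. \<forall>v\<in>strong_products n P V. \<forall>w\<in>strong_products n P V.
        (prod_exists n P u v \<and> w = u + v) \<longleftrightarrow> bar_prod G (\<phi> u) (\<phi> v) (\<phi> w))"

text \<open>Finite graphs have isomorphic copies with vertices and arcs in \<^typ>\<open>nat\<close>.\<close>

definition rigid :: "nat \<Rightarrow> rvec set \<Rightarrow> lvec set \<Rightarrow> bool" where
  "rigid n P V \<longleftrightarrow> V \<subseteq> Col n P \<and>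
     \<not> (\<exists>v. v \<in> strong_products n P V \<and> - v \<in> strong_products n P V) \<and>
     strong_products n P V = weak_products n P V \<and>
     (\<exists>(G :: (nat, nat) pre_digraph) \<phi>. supports n P V G \<phi>)"

section \<open>Triangular groups\<close>

definition arc_le :: "('a, 'b) pre_digraph \<Rightarrow> 'b \<Rightarrow> 'b \<Rightarrow> bool" where
  "arc_le G f g \<longleftrightarrow> (\<exists>p\<in>dipaths G. hd p = f \<and> last p = g)"

definition arc_chain_to :: "('a, 'b) pre_digraph \<Rightarrow> 'b \<Rightarrow> nat \<Rightarrow> bool" where
  "arc_chain_to G f r \<longleftrightarrow> (\<exists>fs. length fs = r \<and> fs \<noteq> [] \<and> last fs = f \<and> set fs \<subseteq> arcs G \<and>
     sorted_wrt (\<lambda>g h. arc_le G g h \<and> g \<noteq> h) fs)"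

definition has_degree :: "('a, 'b) pre_digraph \<Rightarrow> 'b \<Rightarrow> nat \<Rightarrow> bool" where
  "has_degree G f r \<longleftrightarrow> arc_chain_to G f r \<and> \<not> arc_chain_to G f (r + 1)"

definition max_degree :: "('a, 'b) pre_digraph \<Rightarrow> nat \<Rightarrow> bool" where
  "max_degree G t \<longleftrightarrow> (\<exists>f\<in>arcs G. has_degree G f t) \<and>
     (\<forall>f\<in>arcs G. \<forall>r. has_degree G f r \<longrightarrow> r \<le> t)"

text \<open>
  The sets \<open>[V]\<^sup>r\<close> and \<open>[V]\<^sub>r\<close>. All paths in one class start at the same vertex, and the degree of
  an arc depends only on its tail, so the choice of the representing path \<open>p\<close> is irrelevant.
\<close>

definition deg_eq_part :: "nat \<Rightarrow> rvec set \<Rightarrow> lvec set \<Rightarrow> ('a, 'b) pre_digraph \<Rightarrow>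
    (lvec \<Rightarrow> 'b list set) \<Rightarrow> nat \<Rightarrow> lvec set" where
  "deg_eq_part n P V G \<phi> r =
     {v \<in> strong_products n P V. \<exists>p\<in>\<phi> v. has_degree G (hd p) r}"

definition deg_ge_part :: "nat \<Rightarrow> rvec set \<Rightarrow> lvec set \<Rightarrow> ('a, 'b) pre_digraph \<Rightarrow>
    (lvec \<Rightarrow> 'b list set) \<Rightarrow> nat \<Rightarrow> lvec set" where
  "deg_ge_part n P V G \<phi> r =
     {v \<in> strong_products n P V. \<exists>p\<in>\<phi> v. \<exists>d\<ge>r. has_degree G (hd p) d}"

definition ordered_prod :: "('g, 'm) monoid_scheme \<Rightarrow> (nat \<Rightarrow> 'g) \<Rightarrow> nat \<Rightarrow> nat \<Rightarrow> 'g" where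
  "ordered_prod H f a b = foldr (\<lambda>i g. f i \<otimes>\<^bsub>H\<^esub> g) [a..<Suc b] \<one>\<^bsub>H\<^esub>"

text \<open>The subgroup of \<open>E(R,P)\<close> generated by the \<open>e\<^sub>v\<^sup>c\<close> with \<open>v \<in> W\<close>; \<open>G\<^sub>r(R,V)\<close> is the case
  \<open>W = [V]\<^sub>r\<close>.\<close>

definition elem_subgroup :: "nat \<Rightarrow> (nat \<Rightarrow> rvec set) \<Rightarrow> lvec set \<Rightarrow>
    ('r::comm_ring_1 garing \<Rightarrow> 'r garing) monoid" where
  "elem_subgroup n \<PP> W = subgroup_generated (E_group n \<PP>) {elem_spec n \<PP> v c | v c. v \<in> W}"

definition additive_power :: "nat \<Rightarrow> (nat \<Rightarrow> 'r::ab_group_add) monoid" where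
  "additive_power N = product_group {1..N} (\<lambda>_. \<lparr>carrier = UNIV, monoid.mult = (+), one = 0\<rparr>)"

text \<open>The map \<open>\<tau>\<close> for an enumeration \<open>v 1, \<dots>, v N\<close>.\<close>

definition tau :: "nat \<Rightarrow> (nat \<Rightarrow> rvec set) \<Rightarrow> nat \<Rightarrow> (nat \<Rightarrow> lvec) \<Rightarrow>
    (nat \<Rightarrow> 'r::comm_ring_1) \<Rightarrow> 'r garing \<Rightarrow> 'r garing" where
  "tau n \<PP> N v c = ordered_prod (E_group n \<PP>) (\<lambda>i. elem_spec n \<PP> (v i) (c i)) 1 N"

end

theory Submission
  imports Defs
begin

text \<open>
  A column vector \<open>v\<close> is determined by lattice data alone: there is one integral form \<open>h\<close> with
  \<open>h v = -1\<close> and a bound \<open>b\<close> such that \<open>L\<^sub>P \<subseteq> {h \<ge> b}\<close> is closed under adding \<open>v\<close> above level \<open>b\<close>;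
  projecting along \<open>v\<close> onto \<open>{h = b}\<close> gives existence and uniqueness, and shows that \<open>h u < 0\<close> forces
  \<open>u\<close> and \<open>v\<close> to have the same base facet. With this description the column vectors of a doubling
  can be listed, so balancedness survives along the spectrum. In a balanced polytope two columns \<open>u, v\<close>
  with \<open>u + v \<noteq> 0\<close> either commute or satisfy
  \<open>e\<^sub>v\<^sup>\<mu> e\<^sub>u\<^sup>\<lambda> = e\<^sub>u\<^sup>\<lambda> e\<^bsub>uv\<^esub>\<^sup>\<lambda>\<^sup>\<mu> e\<^sub>v\<^sup>\<mu>\<close> (or the same with \<open>u, v\<close> exchanged), and \<open>uv\<close> inherits the degree of \<open>u\<close>,
  which is smaller than that of \<open>v\<close>. Hence \<open>A\<^sub>r\<close> is abelian, is normalised by \<open>G\<^sub>r\<^sub>+\<^sub>1\<close>, and \<open>G\<^sub>r = A\<^sub>r G\<^sub>r\<^sub>+\<^sub>1\<close>.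
  For injectivity and \<open>A\<^sub>r \<inter> G\<^sub>r\<^sub>+\<^sub>1 = 1\<close>, apply \<open>\<tau>\<^sub>r(\<lambda>)\<close> to a monomial \<open>x\<close> of height 1 over the base facet
  of \<open>v\<^sub>k\<close>: the coefficient at \<open>x v\<^sub>k\<close> is \<open>\<lambda>\<^sub>k\<close>, while elements of \<open>G\<^sub>r\<^sub>+\<^sub>1\<close> never lower that height.
\<close>

text \<open>Balancedness keeps the relations short. Heights of two columns over each other's base
  facets are at most 1; a negative height means equal base facets; and if \<open>u + v\<close> is
  nonzero, the pair (1,1) cannot occur, because \<open>u + v\<close> would have height 0 over a base
  facet and could be added forever inside a bounded set. What remains is equal facets, (0,0), and
  (0,1) up to order, so a commutator is one elementary map. Three obstacles shape the setup. The
  exponent is a truncated height, so \<open>elem_map\<close> is defined on the whole group ring but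
  most identities are restricted to supports of nonnegative height. A column has a different facet
  form at every stage, and early forms vanish on later coordinates; \<open>HT\<close> merges them
  into one additive height on the infinite lattice. Finally, the degree comes from the graph while
  heights come from facets: if a column of degree above \<open>r\<close> shared its base facet with
  some column of degree \<open>r\<close>, it would lower that height and the intersection argument
  would fail. Hence degrees must be shown to depend on base facets only
  (\<open>d_same_facet\<close>).\<close>

section \<open>Elementary maps on group rings\<close>

lemma pm_expand: "(f :: 'm \<Rightarrow>\<^sub>0 'r::comm_monoid_add) = (\<Sum>x\<in>Poly_Mapping.keys f. Poly_Mapping.single x (Poly_Mapping.lookup f x))"
  by (rule poly_mapping_eqI) (auto simp: lookup_sum lookup_single when_def sum.delta' in_keys_iff)

lemma keys_add_subset:
  "Poly_Mapping.keys f \<subseteq> S \<Longrightarrow> Poly_Mapping.keys g \<subseteq> S \<Longrightarrow> Poly_Mapping.keys (f + g) \<subseteq> S"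
  by (rule order.trans[OF keys_add]) simp

text \<open>Formulas for additive maps are checked on monomials. The support bound \<open>S\<close>
  is carried through sums because most identities below hold only on monomials of nonnegative
  height.\<close>

lemma pm_induct [consumes 1, case_names single zero add]:
  fixes f :: "'m \<Rightarrow>\<^sub>0 'r::comm_monoid_add"
  assumes "Poly_Mapping.keys f \<subseteq> S"
    and s: "\<And>x a. x \<in> S \<Longrightarrow> Q (Poly_Mapping.single x a)"
    and z: "Q 0"
    and a: "\<And>f g. Poly_Mapping.keys f \<subseteq> S \<Longrightarrow> Poly_Mapping.keys g \<subseteq> S \<Longrightarrow> Q f \<Longrightarrow> Q g \<Longrightarrow> Q (f + g)"
  shows "Q f"
proof -
  have "Q (\<Sum>x\<in>A. Poly_Mapping.single x (g x)) \<and> Poly_Mapping.keys (\<Sum>x\<in>A. Poly_Mapping.single x (g x)) \<subseteq> S"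
    if "finite A" "A \<subseteq> S" for A g
    using that
  proof (induction A rule: finite_induct)
    case (insert x A)
    have 1: "Poly_Mapping.keys (Poly_Mapping.single x (g x)) \<subseteq> S" using insert.prems by auto
    from insert have 2: "Q (\<Sum>x\<in>A. Poly_Mapping.single x (g x))"
       "Poly_Mapping.keys (\<Sum>x\<in>A. Poly_Mapping.single x (g x)) \<subseteq> S" by auto
    have "Poly_Mapping.keys (Poly_Mapping.single x (g x) + (\<Sum>x\<in>A. Poly_Mapping.single x (g x))) \<subseteq> S"
      by (rule keys_add_subset[OF 1 2(2)])
    moreover have "Q (Poly_Mapping.single x (g x) + (\<Sum>x\<in>A. Poly_Mapping.single x (g x)))"
      using insert.prems by (intro a 1 2 s) auto
    ultimately show ?case using insert by simp
  qed (auto simp: z)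
  from this[of "Poly_Mapping.keys f" "Poly_Mapping.lookup f"] assms(1)
  show ?thesis by (simp flip: pm_expand)
qed

text \<open>\<open>elem_poly\<close> with an arbitrary integer height \<open>H\<close> on any
  abelian group, so that several heights can be compared without polytopes. Negative heights are
  truncated to exponent 0, which is the source of the sign hypotheses below.\<close>

definition elem_map :: "('m::ab_group_add \<Rightarrow> int) \<Rightarrow> 'm \<Rightarrow> 'r::comm_ring_1 \<Rightarrow> ('m \<Rightarrow>\<^sub>0 'r) \<Rightarrow> ('m \<Rightarrow>\<^sub>0 'r)" where
  "elem_map H v c f = (\<Sum>x\<in>Poly_Mapping.keys f.
     (1 + Poly_Mapping.single v c) ^ nat (H x) * Poly_Mapping.single x (Poly_Mapping.lookup f x))"

lemma elem_map_superset:
  assumes "finite A" "Poly_Mapping.keys f \<subseteq> A"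
  shows "elem_map H v c f = (\<Sum>x\<in>A.
     (1 + Poly_Mapping.single v c) ^ nat (H x) * Poly_Mapping.single x (Poly_Mapping.lookup f x))"
  unfolding elem_map_def using assms by (intro sum.mono_neutral_left) (auto simp: in_keys_iff)

lemma elem_map_single [simp]:
  "elem_map H v c (Poly_Mapping.single x a) = (1 + Poly_Mapping.single v c) ^ nat (H x) * Poly_Mapping.single x a"
  by (subst elem_map_superset[of "{x}"]) auto

lemma elem_map_0 [simp]: "elem_map H v c 0 = 0"
  by (simp add: elem_map_def)

lemma elem_map_add: "elem_map H v c (f + g) = elem_map H v c f + elem_map H v c g"
proof -
  let ?A = "Poly_Mapping.keys f \<union> Poly_Mapping.keys g"
  show ?thesis
    by (subst (1 2 3) elem_map_superset[of ?A])
       (auto simp: keys_add lookup_add single_add algebra_simps sum.distrib intro: subsetD[OF keys_add])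
qed

lemma elem_map_cong:
  assumes "\<And>x. x \<in> Poly_Mapping.keys f \<Longrightarrow> H x = H' x"
  shows "elem_map H v c f = elem_map H' v c f"
  unfolding elem_map_def using assms by (intro sum.cong) auto

lemma elem_map_zero_coeff [simp]: "elem_map H v 0 f = f"
  by (simp add: elem_map_def flip: pm_expand)

text \<open>Translation by \<open>w\<close> changes no height, hence no truncation either, so the
  identity holds on the whole group ring.\<close>

lemma elem_mult_height_0:
  assumes "additive H" "H w = 0"
  shows "elem_map H v c (Poly_Mapping.single w a * f) = Poly_Mapping.single w a * elem_map H v c f"
proof -
  have "Poly_Mapping.keys f \<subseteq> UNIV" by simp
  then show ?thesis
  proof (induction f rule: pm_induct)
    case (single x b)
    have "H (w + x) = H x" using assms by (simp add: additive.add)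
    then show ?case
      by (simp add: mult_single) (metis mult.left_commute mult_single)
  qed (auto simp: elem_map_add algebra_simps)
qed

lemma elem_mult_power_height_0:
  assumes "additive H" "H w = 0"
  shows "elem_map H v c ((1 + Poly_Mapping.single w a) ^ m * f) = (1 + Poly_Mapping.single w a) ^ m * elem_map H v c f"
proof (induction m arbitrary: f)
  case (Suc m)
  have "elem_map H v c ((1 + Poly_Mapping.single w a) ^ Suc m * f)
     = elem_map H v c ((1 + Poly_Mapping.single w a) ^ m * (f + Poly_Mapping.single w a * f))"
    by (simp add: algebra_simps)
  also have "\<dots> = (1 + Poly_Mapping.single w a) ^ m * (elem_map H v c f + Poly_Mapping.single w a * elem_map H v c f)"
    by (simp only: Suc elem_map_add elem_mult_height_0[OF assms])
  also have "\<dots> = (1 + Poly_Mapping.single w a) ^ Suc m * elem_map H v c f"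
    by (simp add: algebra_simps)
  finally show ?case .
qed simp

lemma keys_single_mult:
  "Poly_Mapping.keys (Poly_Mapping.single (w::'m::comm_monoid_add) (a::'r::comm_ring_1) * f) \<subseteq> (+) w ` Poly_Mapping.keys f"
proof
  fix x assume "x \<in> Poly_Mapping.keys (Poly_Mapping.single w a * f)"
  then have "x \<in> {p + q |p q. p \<in> Poly_Mapping.keys (Poly_Mapping.single w a) \<and> q \<in> Poly_Mapping.keys f}"
    using keys_mult by blast
  then show "x \<in> (+) w ` Poly_Mapping.keys f" by (auto split: if_splits)
qed

lemma keys_mult_one_plus_single:
  fixes f :: "'m::comm_monoid_add \<Rightarrow>\<^sub>0 'r::comm_ring_1"
  assumes "Poly_Mapping.keys f \<subseteq> T" "\<And>x. x \<in> T \<Longrightarrow> v + x \<in> T"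
  shows "Poly_Mapping.keys ((1 + Poly_Mapping.single v c) * f) \<subseteq> T"
proof -
  have "Poly_Mapping.keys (f + Poly_Mapping.single v c * f) \<subseteq> T"
    using assms keys_single_mult[of v c f] by (intro keys_add_subset) blast+
  then show ?thesis by (simp add: algebra_simps)
qed

text \<open>The elementary map turns a monomial \<open>w\<close> of height 1 into
  \<open>w (1 + cv)\<close>. Nonnegative heights make the truncated exponent grow by exactly one
  with each factor \<open>w\<close>.\<close>

lemma elem_mult_power_height_1:
  assumes H: "additive H" "H w = 1"
    and f: "Poly_Mapping.keys f \<subseteq> {x. 0 \<le> H x}"
  shows "elem_map H v c ((1 + Poly_Mapping.single w a) ^ m * f)
     = (1 + Poly_Mapping.single w a * (1 + Poly_Mapping.single v c)) ^ m * elem_map H v c f"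
  using f
proof (induction m arbitrary: f)
  case (Suc m)
  let ?w = "Poly_Mapping.single w a" and ?v = "Poly_Mapping.single v c"
  have shift: "elem_map H v c (?w * f) = ?w * (1 + ?v) * elem_map H v c f"
    using Suc.prems
  proof (induction f rule: pm_induct)
    case (single x b)
    then have "nat (H (w + x)) = Suc (nat (H x))" using H by (simp add: additive.add)
    then show ?case
      unfolding mult_single by (simp, unfold mult_single[symmetric]) (simp add: algebra_simps)
  qed (auto simp: elem_map_add algebra_simps)
  have "Poly_Mapping.keys ((1 + ?w) * f) \<subseteq> {x. 0 \<le> H x}"
    using Suc.prems H by (intro keys_mult_one_plus_single) (auto simp: additive.add)
  then have "elem_map H v c ((1 + ?w) ^ m * ((1 + ?w) * f)) = (1 + ?w * (1 + ?v)) ^ m * elem_map H v c ((1 + ?w) * f)"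
    by (rule Suc.IH)
  also have "elem_map H v c ((1 + ?w) * f) = elem_map H v c (f + ?w * f)"
    by (simp add: algebra_simps)
  also have "\<dots> = (1 + ?w * (1 + ?v)) * elem_map H v c f"
    by (simp only: elem_map_add shift) (simp add: algebra_simps)
  finally show ?case by (simp add: mult.assoc mult.commute mult.left_commute)
qed simp

text \<open>Since \<open>u\<close> has height -1, the map formally sends it to
  \<open>u / (1 + cv)\<close>. The bound \<open>a \<le> H x\<close> leaves enough factors
  \<open>1 + cv\<close> to clear all denominators, which avoids localizing the group ring.\<close>

lemma elem_mult_power_height_minus_1:
  assumes H: "additive H" "H u = -1" and "int a \<le> H x"
  shows "elem_map H v c ((1 + Poly_Mapping.single u l) ^ a * Poly_Mapping.single x r)
     = (1 + Poly_Mapping.single u l + Poly_Mapping.single v c) ^ a *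
       ((1 + Poly_Mapping.single v c) ^ (nat (H x) - a) * Poly_Mapping.single x r)"
  using assms(3)
proof (induction a arbitrary: x r)
  case (Suc a)
  let ?u = "Poly_Mapping.single u l" and ?v = "Poly_Mapping.single v c"
    and ?x = "Poly_Mapping.single x r"
  have Hx: "H (u + x) = H x - 1" using H by (simp add: additive.add)
  have e: "nat (H x) - a = Suc (nat (H x) - Suc a)" "nat (H x - 1) - a = nat (H x) - Suc a"
    using Suc.prems by auto
  have "elem_map H v c ((1 + ?u) ^ Suc a * ?x) = elem_map H v c ((1 + ?u) ^ a * ?x + (1 + ?u) ^ a * (?u * ?x))"
    by (simp add: algebra_simps)
  also have "\<dots> = elem_map H v c ((1 + ?u) ^ a * ?x) + elem_map H v c ((1 + ?u) ^ a * Poly_Mapping.single (u + x) (l * r))"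
    by (simp add: elem_map_add mult_single)
  also have "\<dots> = (1 + ?u + ?v) ^ a * ((1 + ?v) ^ (nat (H x) - a) * ?x)
      + (1 + ?u + ?v) ^ a * ((1 + ?v) ^ (nat (H x) - Suc a) * (?u * ?x))"
    using Suc.prems Hx e(2) by (subst (1 2) Suc.IH) (auto simp: mult_single)
  also have "\<dots> = (1 + ?u + ?v) ^ Suc a * ((1 + ?v) ^ (nat (H x) - Suc a) * ?x)"
    unfolding e(1) by (simp add: algebra_simps)
  finally show ?case .
qed simp

text \<open>The right side is symmetric in the two columns and, for \<open>u = v\<close>, depends
  only on \<open>l + c\<close>. This yields both commutativity and additivity in the
  coefficient.\<close>

lemma elem_elem_same_height:
  assumes "additive H" "H u = -1" "0 \<le> H x"
  shows "elem_map H v c (elem_map H u l (Poly_Mapping.single x r))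
     = (1 + Poly_Mapping.single u l + Poly_Mapping.single v c) ^ nat (H x) * Poly_Mapping.single x r"
  using elem_mult_power_height_minus_1[OF assms(1,2), of "nat (H x)" x v c l r] assms(3) by simp

lemma elem_commute_same_height:
  assumes H: "additive H" "H u = -1" "H v = -1" and f: "Poly_Mapping.keys f \<subseteq> {x. 0 \<le> H x}"
  shows "elem_map H v c (elem_map H u l f) = elem_map H u l (elem_map H v c f)"
  using f by (induction f rule: pm_induct)
    (simp_all add: elem_elem_same_height[OF H(1,2)] elem_elem_same_height[OF H(1,3)] elem_map_add add_ac
       del: elem_map_single)

lemma elem_elem_add:
  assumes H: "additive H" "H v = -1" and f: "Poly_Mapping.keys f \<subseteq> {x. 0 \<le> H x}"
  shows "elem_map H v c (elem_map H v d f) = elem_map H v (c + d) f"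
  using f
proof (induction f rule: pm_induct)
  case (single x a)
  then show ?case
    by (simp only: mem_Collect_eq elem_elem_same_height[OF H]) (simp add: single_add add_ac)
qed (auto simp: elem_map_add)

lemma elem_commute_height_0:
  assumes "additive H" "additive K" "H v = 0" "K u = 0"
  shows "elem_map H u l (elem_map K v c f) = elem_map K v c (elem_map H u l f)"
proof -
  have "Poly_Mapping.keys f \<subseteq> UNIV" by simp
  then show ?thesis
  proof (induction f rule: pm_induct)
    case (single x a)
    show ?case
      by (simp add: elem_mult_power_height_0 assms mult.left_commute)
  qed (auto simp: elem_map_add)
qed

text \<open>On a monomial both sides become \<open>(1 + lu + lc(u+v))^H (1 + cv)^K x\<close>. On the
  left, \<open>lu\<close> turns into \<open>lu (1 + cv)\<close>; on the right, powers of
  \<open>1 + cv\<close> have \<open>H\<close>-height 0 and pass through, and the two maps over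
  \<open>H\<close> merge.\<close>

lemma elem_commutator:
  assumes H: "additive H" "additive K" "H u = -1" "H v = 0" "K v = -1" "K u = 1"
    and f: "Poly_Mapping.keys f \<subseteq> {x. 0 \<le> H x \<and> 0 \<le> K x}"
  shows "elem_map K v c (elem_map H u l f) = elem_map H u l (elem_map H (u + v) (l * c) (elem_map K v c f))"
  using f
proof (induction f rule: pm_induct)
  case (single x a)
  then have x: "0 \<le> H x" "0 \<le> K x" by auto
  let ?u = "Poly_Mapping.single u l" and ?v = "Poly_Mapping.single v c"
    and ?x = "Poly_Mapping.single x a"
  have uv: "H (u + v) = -1" using H by (simp add: additive.add)
  have "elem_map H u l (elem_map H (u + v) (l * c) (elem_map K v c ?x))
    = elem_map H u l (elem_map H (u + v) (l * c) ((1 + ?v) ^ nat (K x) * ?x))"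
    by simp
  also have "\<dots> = (1 + ?v) ^ nat (K x) * elem_map H u l (elem_map H (u + v) (l * c) ?x)"
    using H by (simp only: elem_mult_power_height_0)
  also have "\<dots> = (1 + ?v) ^ nat (K x) * ((1 + ?u * ?v + ?u) ^ nat (H x) * ?x)"
    using H uv x by (subst elem_elem_same_height) (auto simp: mult_single)
  also have "\<dots> = elem_map K v c (elem_map H u l ?x)"
    using x H by (simp add: elem_mult_power_height_1) (simp add: algebra_simps)
  finally show ?case by simp
qed (auto simp: elem_map_add)

text \<open>The exponent equals the height, so \<open>v\<close> is never added more often than the
  height allows.\<close>

lemma keys_elem_subset:
  assumes "additive H" "H v = -1" "Poly_Mapping.keys f \<subseteq> S"
    and S: "\<And>x. x \<in> S \<Longrightarrow> 0 < H x \<Longrightarrow> v + x \<in> S"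
  shows "Poly_Mapping.keys (elem_map H v c f) \<subseteq> S"
  using assms(3)
proof (induction f rule: pm_induct)
  case (single x a)
  \<comment> \<open>The induction needs smaller exponents as well; the alternative
    \<open>m = 0\<close> admits monomials of negative height, where \<open>nat\<close>
    truncates.\<close>
  have "Poly_Mapping.keys ((1 + Poly_Mapping.single v c) ^ m * Poly_Mapping.single x a) \<subseteq> S"
    if "x \<in> S" "m = 0 \<or> int m \<le> H x" for m x a using that
  proof (induction m arbitrary: x a)
    case (Suc m)
    have "v + x \<in> S" "H (v + x) = H x - 1" using Suc.prems S assms(1,2) by (auto simp: additive.add)
    then have "Poly_Mapping.keys ((1 + Poly_Mapping.single v c) ^ m * Poly_Mapping.single (v + x) (c * a)) \<subseteq> S"
      using Suc by auto
    moreover have "Poly_Mapping.keys ((1 + Poly_Mapping.single v c) ^ m * Poly_Mapping.single x a) \<subseteq> S"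
      using Suc by auto
    moreover have "(1 + Poly_Mapping.single v c) ^ Suc m * Poly_Mapping.single x a
      = (1 + Poly_Mapping.single v c) ^ m * Poly_Mapping.single x a + (1 + Poly_Mapping.single v c) ^ m * Poly_Mapping.single (v + x) (c * a)"
      unfolding mult_single[symmetric] by (simp add: algebra_simps)
    ultimately show ?case by (simp only: keys_add_subset)
  qed auto
  from this[of x "nat (H x)" a] single show ?case by auto
next
  case (add f g)
  then show ?case unfolding elem_map_add by (intro keys_add_subset)
qed auto

text \<open>Used later for half-spaces whose bounding form vanishes on \<open>v\<close>; any number
  of translations stays inside, whatever the exponent.\<close>

lemma keys_elem_closed:
  assumes "Poly_Mapping.keys f \<subseteq> T" "\<And>x. x \<in> T \<Longrightarrow> v + x \<in> T"
  shows "Poly_Mapping.keys (elem_map H v c f) \<subseteq> T"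
  using assms(1)
proof (induction f rule: pm_induct)
  case (single x a)
  have "Poly_Mapping.keys ((1 + Poly_Mapping.single v c) ^ m * Poly_Mapping.single x a) \<subseteq> T" for m
  proof (induction m)
    case (Suc m)
    then show ?case using keys_mult_one_plus_single[OF Suc.IH assms(2)] by (simp add: mult.assoc)
  qed (use single in auto)
  then show ?case by simp
next
  case (add f g)
  then show ?case unfolding elem_map_add by (intro keys_add_subset)
qed auto

text \<open>First-order binomial expansion: each factor \<open>v\<close> lowers \<open>D\<close> by
  one, so everything from the quadratic terms on lies at least two degrees below
  \<open>x\<close>.\<close>

lemma power_mult_single_degree:
  assumes D: "additive D" "D v = (-1::int)"
  shows "\<exists>r. (1 + Poly_Mapping.single v (c::'r::comm_ring_1)) ^ m * Poly_Mapping.single x a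
     = Poly_Mapping.single x a + Poly_Mapping.single (v + x) (of_nat m * c * a) + r
     \<and> Poly_Mapping.keys r \<subseteq> {y. D y \<le> D x - 2}"
proof (induction m)
  case 0
  then show ?case by (intro exI[of _ 0]) auto
next
  case (Suc m)
  let ?v = "Poly_Mapping.single v c"
  from Suc obtain r where r: "(1 + ?v) ^ m * Poly_Mapping.single x a
     = Poly_Mapping.single x a + Poly_Mapping.single (v + x) (of_nat m * c * a) + r"
     "Poly_Mapping.keys r \<subseteq> {y. D y \<le> D x - 2}" by blast
  let ?s = "?v * Poly_Mapping.single (v + x) (of_nat m * c * a)"
  have "(1 + ?v) ^ Suc m * Poly_Mapping.single x a = (1 + ?v) * ((1 + ?v) ^ m * Poly_Mapping.single x a)"
    by (simp add: mult.assoc)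
  also have "\<dots> = Poly_Mapping.single x a + (Poly_Mapping.single (v + x) (of_nat m * c * a) + ?v * Poly_Mapping.single x a)
      + (?s + (1 + ?v) * r)"
    unfolding r(1) by (simp add: algebra_simps)
  also have "Poly_Mapping.single (v + x) (of_nat m * c * a) + ?v * Poly_Mapping.single x a
      = Poly_Mapping.single (v + x) (of_nat (Suc m) * c * a)"
    by (simp add: mult_single algebra_simps flip: single_add)
  finally have "(1 + ?v) ^ Suc m * Poly_Mapping.single x a = Poly_Mapping.single x a
      + Poly_Mapping.single (v + x) (of_nat (Suc m) * c * a) + (?s + (1 + ?v) * r)" .
  moreover have "Poly_Mapping.keys (?s + (1 + ?v) * r) \<subseteq> {y. D y \<le> D x - 2}"
  proof (rule keys_add_subset)
    show "Poly_Mapping.keys ?s \<subseteq> {y. D y \<le> D x - 2}"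
      using D by (auto simp: mult_single additive.add)
    show "Poly_Mapping.keys ((1 + ?v) * r) \<subseteq> {y. D y \<le> D x - 2}"
      using r(2) D by (intro keys_mult_one_plus_single) (auto simp: additive.add)
  qed
  ultimately show ?case by blast
qed

text \<open>The maps are unipotent for the filtration by \<open>D\<close>, whatever the height
  \<open>H\<close>.\<close>

lemma elem_minus_id_degree:
  assumes D: "additive D" "D v = (-1::int)" and f: "Poly_Mapping.keys f \<subseteq> {y. D y \<le> d}"
  shows "Poly_Mapping.keys (elem_map H v c f - f) \<subseteq> {y. D y \<le> d - 1}"
  using f
proof (induction f rule: pm_induct)
  case (single x a)
  obtain r where r: "(1 + Poly_Mapping.single v c) ^ nat (H x) * Poly_Mapping.single x a
     = Poly_Mapping.single x a + Poly_Mapping.single (v + x) (of_nat (nat (H x)) * c * a) + r"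
     "Poly_Mapping.keys r \<subseteq> {y. D y \<le> D x - 2}"
    using power_mult_single_degree[OF D] by blast
  have "Poly_Mapping.keys (Poly_Mapping.single (v + x) (of_nat (nat (H x)) * c * a) + r) \<subseteq> {y. D y \<le> d - 1}"
  proof (rule keys_add_subset)
    show "Poly_Mapping.keys (Poly_Mapping.single (v + x) (of_nat (nat (H x)) * c * a)) \<subseteq> {y. D y \<le> d - 1}"
      using single D by (auto simp: additive.add)
    show "Poly_Mapping.keys r \<subseteq> {y. D y \<le> d - 1}"
      using single by (intro order.trans[OF r(2)]) auto
  qed
  then show ?case
    unfolding elem_map_single r(1) by simp
next
  case (add f g)
  have "elem_map H v c (f + g) - (f + g) = (elem_map H v c f - f) + (elem_map H v c g - g)"
    by (simp add: elem_map_add)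
  then show ?case using add by (simp only: keys_add_subset)
qed auto

text \<open>Graded by \<open>D\<close>, every factor is the identity up to terms of lower degree, so the part of
  degree one below \<open>x\<close> of a product is additive in the factors.\<close>

lemma lookup_foldr_elem:
  assumes D: "additive D" "\<And>i. i \<in> set ks \<Longrightarrow> D (v i) = (-1::int)"
    and "distinct ks" "inj_on v (set ks)" "k \<in> set ks"
  shows "Poly_Mapping.lookup (foldr (\<lambda>i. elem_map (H i) (v i) (c i)) ks (Poly_Mapping.single x 1)) (v k + x)
    = of_nat (nat (H k x)) * c k"
proof -
  let ?x = "Poly_Mapping.single x 1"
  let ?s = "\<lambda>i. Poly_Mapping.single (v i + x) (of_nat (nat (H i x)) * c i)"
  let ?T = "\<lambda>ks. foldr (\<lambda>i. elem_map (H i) (v i) (c i)) ks ?x"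
  have keys_s: "Poly_Mapping.keys (\<Sum>i\<in>I. ?s i) \<subseteq> {y. D y \<le> D x - 1}" if "I \<subseteq> set ks" for I
    using that
  proof (induction I rule: infinite_finite_induct)
    case (insert i I)
    have *: "Poly_Mapping.keys (?s i) \<subseteq> {y. D y \<le> D x - 1}"
      using insert.prems D by (auto simp: additive.add)
    show ?case unfolding sum.insert[OF insert.hyps(1,2)]
      by (rule keys_add_subset[OF *], rule insert.IH) (use insert.prems in simp)
  qed auto
  have "\<exists>r. ?T js = ?x + (\<Sum>i\<in>set js. ?s i) + r \<and> Poly_Mapping.keys r \<subseteq> {y. D y \<le> D x - 2}"
    if "set js \<subseteq> set ks" "distinct js" for js using that
  proof (induction js)
    case Nil
    then show ?case by (intro exI[of _ 0]) auto
  next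
    case (Cons j js)
    then obtain r where r: "?T js = ?x + (\<Sum>i\<in>set js. ?s i) + r"
        "Poly_Mapping.keys r \<subseteq> {y. D y \<le> D x - 2}" by auto
    have j: "D (v j) = -1" using D Cons.prems by auto
    let ?E = "elem_map (H j) (v j) (c j)" and ?S = "\<Sum>i\<in>set js. ?s i"
    obtain r' where r': "?E ?x = ?x + ?s j + r'" "Poly_Mapping.keys r' \<subseteq> {y. D y \<le> D x - 2}"
      using power_mult_single_degree[OF D(1) j, of "c j" "nat (H j x)" x 1] by auto
    have "?T (j # js) = ?E ?x + ?E ?S + ?E r"
      by (simp only: foldr.simps o_apply r(1) elem_map_add)
    \<comment> \<open>The next map alters the linear part and the error only by terms of degree at
      most \<open>D x - 2\<close>; only the leading monomial contributes a new linear term.\<close>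
    also have "\<dots> = ?x + (\<Sum>i\<in>set (j # js). ?s i) + (r' + (?E ?S - ?S) + (?E r - r) + r)"
      using Cons.prems by (simp only: r'(1)) simp
    finally have *: "?T (j # js) = ?x + (\<Sum>i\<in>set (j # js). ?s i) + (r' + (?E ?S - ?S) + (?E r - r) + r)" .
    have "Poly_Mapping.keys (?E ?S - ?S) \<subseteq> {y. D y \<le> D x - 2}"
      using elem_minus_id_degree[OF D(1) j keys_s[of "set js"], of "H j" "c j"] Cons.prems by simp
    moreover have "Poly_Mapping.keys (?E r - r) \<subseteq> {y. D y \<le> D x - 2}"
      using elem_minus_id_degree[OF D(1) j r(2), of "H j" "c j"] by auto
    ultimately have "Poly_Mapping.keys (r' + (?E ?S - ?S) + (?E r - r) + r) \<subseteq> {y. D y \<le> D x - 2}"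
      using r(2) r'(2) by (intro keys_add_subset)
    with * show ?case by blast
  qed
  then obtain r where r: "?T ks = ?x + (\<Sum>i\<in>set ks. ?s i) + r"
      "Poly_Mapping.keys r \<subseteq> {y. D y \<le> D x - 2}" using assms by blast
  have k: "D (v k + x) = D x - 1" using D assms by (auto simp: additive.add)
  have "v k + x \<notin> Poly_Mapping.keys r" using r(2) k by auto
  moreover have "v k + x \<noteq> x" using k by auto
  moreover have "Poly_Mapping.lookup (\<Sum>i\<in>set ks. ?s i) (v k + x)
    = (\<Sum>i\<in>set ks. if i = k then of_nat (nat (H k x)) * c k else 0)"
    unfolding lookup_sum using assms by (intro sum.cong) (auto simp: lookup_single when_def inj_on_def)
  ultimately show ?thesis using assms(5)
    by (simp add: r(1) lookup_add lookup_single in_keys_iff)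
qed

section \<open>Lattice polytopes and their column vectors\<close>

lemma lookup_scaleR [simp]: "Poly_Mapping.lookup (r *\<^sub>R x) i = r *\<^sub>R Poly_Mapping.lookup x i"
proof -
  have "finite {i. r *\<^sub>R Poly_Mapping.lookup x i \<noteq> 0}"
    by (rule finite_subset[OF _ finite_lookup[of x]]) auto
  then show ?thesis unfolding scaleR_poly_mapping_def by simp
qed

lemma lookup_rv [simp]: "Poly_Mapping.lookup (rv x) i = real_of_int (Poly_Mapping.lookup x i)"
  unfolding rv_def by (simp add: Poly_Mapping.map.rep_eq when_def)

lemma rv_add: "rv (x + y) = rv x + rv y"
  by (rule poly_mapping_eqI) (simp add: lookup_add)

lemma rv_diff: "rv (x - y) = rv x - rv y"
  by (rule poly_mapping_eqI) (simp add: lookup_minus)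

lemma rv_0 [simp]: "rv 0 = 0"
  by (rule poly_mapping_eqI) simp

lemma rv_single: "rv (Poly_Mapping.single i a) = Poly_Mapping.single i (real_of_int a)"
  by (rule poly_mapping_eqI) (simp add: lookup_single when_def)

lemma keys_rv [simp]: "Poly_Mapping.keys (rv x) = Poly_Mapping.keys x"
  by (auto simp: in_keys_iff)

lemma additive_0: "additive h \<Longrightarrow> h 0 = 0"
  by (rule additive.zero)

lemma additive_mult_nat: "additive (h :: 'm::ab_group_add \<Rightarrow> int) \<Longrightarrow> h (((+) v ^^ k) x) = int k * h v + h x"
  by (induction k) (auto simp: additive.add algebra_simps)

lemma additive_scale_single:
  "additive (h :: lvec \<Rightarrow> int) \<Longrightarrow> h (Poly_Mapping.single i a) = a * h (Poly_Mapping.single i 1)"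
proof -
  assume h: "additive h"
  have *: "h (Poly_Mapping.single i (int k)) = int k * h (Poly_Mapping.single i 1)" for k
    by (induction k) (auto simp: single_add additive.add[OF h] additive_0[OF h] algebra_simps)
  show ?thesis
  proof (cases "a \<ge> 0")
    case True
    then show ?thesis using *[of "nat a"] by simp
  next
    case False
    have "Poly_Mapping.single i a = - Poly_Mapping.single i (int (nat (-a)))"
      unfolding single_uminus[symmetric] using False by simp
    then show ?thesis using *[of "nat (-a)"] False by (simp add: additive.minus[OF h])
  qed
qed

lemma additive_expand:
  assumes "additive (h :: lvec \<Rightarrow> int)" "finite A" "Poly_Mapping.keys x \<subseteq> A"
  shows "h x = (\<Sum>i\<in>A. Poly_Mapping.lookup x i * h (Poly_Mapping.single i 1))"
proof -
  have "x = (\<Sum>i\<in>A. Poly_Mapping.single i (Poly_Mapping.lookup x i))"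
    using assms by (intro poly_mapping_eqI) (auto simp: lookup_sum lookup_single when_def sum.delta' in_keys_iff)
  then have "h x = (\<Sum>i\<in>A. h (Poly_Mapping.single i (Poly_Mapping.lookup x i)))"
    by (simp only: additive.sum[OF assms(1), symmetric])
  also have "\<dots> = (\<Sum>i\<in>A. Poly_Mapping.lookup x i * h (Poly_Mapping.single i 1))"
    by (intro sum.cong refl additive_scale_single[OF assms(1)])
  finally show ?thesis .
qed

lemma lin_ext_superset:
  assumes "finite A" "Poly_Mapping.keys x \<subseteq> A"
  shows "lin_ext h x = (\<Sum>i\<in>A. Poly_Mapping.lookup x i * real_of_int (h (Poly_Mapping.single i 1)))"
  unfolding lin_ext_def using assms by (intro sum.mono_neutral_left) (auto simp: in_keys_iff)

lemma linear_lin_ext: "linear (lin_ext h)"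
proof (rule linearI)
  show "lin_ext h (x + y) = lin_ext h x + lin_ext h y" for x y
    by (subst (1 2 3) lin_ext_superset[of "Poly_Mapping.keys x \<union> Poly_Mapping.keys y"])
      (auto simp: lookup_add algebra_simps sum.distrib dest: subsetD[OF keys_add])
  show "lin_ext h (r *\<^sub>R x) = r *\<^sub>R lin_ext h x" for r x
    by (subst (1 2) lin_ext_superset[of "Poly_Mapping.keys x"])
      (auto simp: in_keys_iff sum_distrib_left algebra_simps)
qed

lemmas lin_ext_add = linear_add[OF linear_lin_ext]
lemmas lin_ext_scaleR = linear_scale[OF linear_lin_ext]
lemmas lin_ext_diff = linear_diff[OF linear_lin_ext]

lemma lin_ext_rv: "additive h \<Longrightarrow> lin_ext h (rv x) = real_of_int (h x)"
  by (simp add: lin_ext_def additive_expand[of h "Poly_Mapping.keys x" x])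

lemma lin_ext_eq_on:
  assumes "linear f" "\<And>i. i < n \<Longrightarrow> f (Poly_Mapping.single i 1) = real_of_int (h (Poly_Mapping.single i 1))"
    "Poly_Mapping.keys x \<subseteq> {..<n}"
  shows "f x = lin_ext h x"
proof -
  have "x = (\<Sum>i<n. Poly_Mapping.lookup x i *\<^sub>R Poly_Mapping.single i 1)"
    using assms by (intro poly_mapping_eqI)
      (auto simp: lookup_sum lookup_single when_def if_distrib[of "(*) _"] sum.delta' in_keys_iff cong: if_cong)
  then have "f x = f (\<Sum>i<n. Poly_Mapping.lookup x i *\<^sub>R Poly_Mapping.single i 1)"
    by (rule arg_cong)
  also have "\<dots> = (\<Sum>i<n. Poly_Mapping.lookup x i *\<^sub>R f (Poly_Mapping.single i 1))"
    by (simp add: linear_sum[OF assms(1)] linear_scale[OF assms(1)])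
  finally have "f x = (\<Sum>i<n. Poly_Mapping.lookup x i *\<^sub>R f (Poly_Mapping.single i 1))" .
  then show ?thesis using assms(2,3) by (simp add: lin_ext_superset[of "{..<n}"])
qed

section \<open>Affine lattices and induction from the lattice points of a polytope\<close>

lemma Zn_add: "x \<in> Zn n \<Longrightarrow> y \<in> Zn n \<Longrightarrow> x + y \<in> Zn n"
  unfolding Zn_def using keys_add[of x y] by auto

lemma Zn_diff: "x \<in> Zn n \<Longrightarrow> y \<in> Zn n \<Longrightarrow> x - y \<in> Zn n"
  unfolding Zn_def using keys_diff[of x y] by auto

lemma Zn_0 [simp]: "0 \<in> Zn n"
  by (simp add: Zn_def)

lemma Zn_single [simp]: "i < n \<Longrightarrow> Poly_Mapping.single i a \<in> Zn n"
  by (simp add: Zn_def)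

lemma Zn_mono: "m \<le> n \<Longrightarrow> Zn m \<subseteq> Zn n"
  by (auto simp: Zn_def)

text \<open>Closure under \<open>a - b + c\<close> is the base-point-free form of an affine lattice
  and suits induction.\<close>

lemma affine_latticeI:
  assumes "x \<in> M" "\<And>a b c. a \<in> M \<Longrightarrow> b \<in> M \<Longrightarrow> c \<in> M \<Longrightarrow> a - b + c \<in> M"
  shows "affine_lattice M"
  unfolding affine_lattice_def
proof (intro exI conjI)
  show "0 \<in> (\<lambda>y. y - x) ` M" using assms(1) by force
  show "\<forall>a\<in>(\<lambda>y. y - x) ` M. \<forall>b\<in>(\<lambda>y. y - x) ` M. a - b \<in> (\<lambda>y. y - x) ` M"
  proof (intro ballI, elim imageE)
    fix a b a' b' assume "a = a' - x" "a' \<in> M" "b = b' - x" "b' \<in> M"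
    then show "a - b \<in> (\<lambda>y. y - x) ` M" using assms by (intro image_eqI[of _ _ "a' - b' + x"]) auto
  qed
  show "M = (+) x ` (\<lambda>y. y - x) ` M" by (auto simp: image_image)
qed

lemma affine_latticeD:
  assumes "affine_lattice M" "a \<in> M" "b \<in> M" "c \<in> M"
  shows "a - b + c \<in> M"
proof -
  obtain x H where H: "0 \<in> H" "\<forall>a\<in>H. \<forall>b\<in>H. a - b \<in> H" "M = (+) x ` H"
    using assms(1) unfolding affine_lattice_def by blast
  obtain a' b' c' where 1: "a = x + a'" "b = x + b'" "c = x + c'" "a' \<in> H" "b' \<in> H" "c' \<in> H"
    using assms H by auto
  have "a' - (0 - (c' - b')) \<in> H"
    using H 1 by (metis diff_0_eq_0 diff_0 minus_diff_eq)
  then have "a - b + c = x + (a' - b' + c')" "a' - b' + c' \<in> H" using 1 by (auto simp: algebra_simps)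
  then show ?thesis using H by auto
qed

lemma affine_lattice_induct:
  assumes "affine_lattice hull L = Zn n" "L \<noteq> {}"
    and "\<And>x. x \<in> L \<Longrightarrow> Q x"
    and "\<And>a b c. a \<in> Zn n \<Longrightarrow> b \<in> Zn n \<Longrightarrow> c \<in> Zn n \<Longrightarrow> Q a \<Longrightarrow> Q b \<Longrightarrow> Q c \<Longrightarrow> Q (a - b + c)"
    and "x \<in> Zn n"
  shows "Q x"
proof -
  have sub: "L \<subseteq> Zn n" using hull_subset[of L affine_lattice] assms(1) by simp
  obtain l where "l \<in> L" using assms(2) by blast
  have "affine_lattice {x \<in> Zn n. Q x}"
  proof (rule affine_latticeI)
    show "l \<in> {x \<in> Zn n. Q x}" using \<open>l \<in> L\<close> sub assms(3) by auto
  qed (use assms(4) in \<open>auto intro: Zn_add Zn_diff\<close>)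
  then have "Zn n \<subseteq> {x \<in> Zn n. Q x}"
    using hull_minimal[of L "{x \<in> Zn n. Q x}" affine_lattice] sub assms(1,3) by auto
  then show ?thesis using assms(5) by auto
qed

lemma affine_lattice_hull_eqI:
  assumes "L \<subseteq> Zn n" and "\<And>M. affine_lattice M \<Longrightarrow> L \<subseteq> M \<Longrightarrow> Zn n \<subseteq> M"
  shows "affine_lattice hull L = Zn n"
proof (rule hull_unique)
  show "affine_lattice (Zn n)" by (rule affine_latticeI[of 0]) (auto intro: Zn_add Zn_diff)
qed (use assms in auto)

lemma lattice_polytopeE:
  assumes "lattice_polytope n P"
  obtains S where "finite S" "S \<noteq> {}" "S \<subseteq> Zn n" "P = convex hull (rv ` S)" "S \<subseteq> lat_pts P"
    "affdim P = n" "affine_lattice hull (lat_pts P) = Zn n"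
proof -
  obtain S where S: "finite S" "S \<subseteq> Zn n" "P = convex hull (rv ` S)" and "P \<noteq> {}"
      "affdim P = n" "affine_lattice hull (lat_pts P) = Zn n"
    using assms unfolding lattice_polytope_def by blast
  moreover have "S \<noteq> {}" using S \<open>P \<noteq> {}\<close> by auto
  moreover have "S \<subseteq> lat_pts P" using S by (auto simp: lat_pts_def hull_inc)
  ultimately show ?thesis by (intro that)
qed

text \<open>The vertices are lattice points, so containment in a convex set is decided on
  \<open>lat_pts P\<close>.\<close>

lemma lattice_polytope_subset:
  assumes "lattice_polytope n P" "convex C" "\<And>x. x \<in> lat_pts P \<Longrightarrow> rv x \<in> C"
  shows "P \<subseteq> C"
proof -
  obtain S where S: "P = convex hull (rv ` S)" "S \<subseteq> lat_pts P"
    using assms(1) by (rule lattice_polytopeE)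
  show ?thesis unfolding S(1) by (rule hull_minimal) (use assms S in auto)
qed

lemma lattice_polytope_convex: "lattice_polytope n P \<Longrightarrow> convex P"
  by (auto simp: lattice_polytope_def)

lemma lat_pts_nonempty: "lattice_polytope n P \<Longrightarrow> lat_pts P \<noteq> {}"
  by (elim lattice_polytopeE) auto

lemma lattice_polytope_keys:
  assumes "lattice_polytope n P" "x \<in> P"
  shows "Poly_Mapping.keys x \<subseteq> {..<n}"
proof -
  obtain S where S: "P = convex hull (rv ` S)" "S \<subseteq> Zn n"
    using assms(1) by (rule lattice_polytopeE)
  have "P \<subseteq> {x. \<forall>i\<ge>n. Poly_Mapping.lookup x i = 0}" unfolding S(1)
  proof (rule hull_minimal)
    show "rv ` S \<subseteq> {x. \<forall>i\<ge>n. Poly_Mapping.lookup x i = 0}"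
      using S(2) unfolding Zn_def by (force simp: subset_iff in_keys_iff)
  qed (auto simp: convex_def lookup_add)
  then have "\<forall>i\<ge>n. Poly_Mapping.lookup x i = 0" using assms(2) by auto
  then show ?thesis by (meson in_keys_iff lessThan_iff not_le subsetI)
qed

lemma lat_pts_subset_Zn: "lattice_polytope n P \<Longrightarrow> lat_pts P \<subseteq> Zn n"
  using lattice_polytope_keys[of n P "rv _"] by (auto simp: lat_pts_def Zn_def)

text \<open>The condition that the lattice points affinely generate \<open>Zn n\<close> enters
  through this rule: integral affine identities spread from \<open>P\<close> to the whole
  lattice.\<close>

lemma lattice_polytope_induct:
  assumes "lattice_polytope n P" "\<And>x. x \<in> lat_pts P \<Longrightarrow> Q x"
    and "\<And>a b c. a \<in> Zn n \<Longrightarrow> b \<in> Zn n \<Longrightarrow> c \<in> Zn n \<Longrightarrow> Q a \<Longrightarrow> Q b \<Longrightarrow> Q c \<Longrightarrow> Q (a - b + c)"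
    and "x \<in> Zn n"
  shows "Q x"
proof (rule affine_lattice_induct[of "lat_pts P" n Q])
  show "affine_lattice hull lat_pts P = Zn n" using assms(1) by (auto simp: lattice_polytope_def)
qed (use assms lat_pts_nonempty in auto)

section \<open>Rays in a polytope and the integral forms of column vectors\<close>

lemma lookup_iterate_add:
  "Poly_Mapping.lookup (((+) v ^^ k) x) i = int k * Poly_Mapping.lookup (v :: lvec) i + Poly_Mapping.lookup x i"
  by (induction k) (auto simp: lookup_add algebra_simps)

text \<open>A coordinate in which \<open>v\<close> is nonzero is bounded on \<open>P\<close>, being
  bounded on finitely many generators, but unbounded along the ray.\<close>

lemma ray_leaves:
  assumes "lattice_polytope n P" "v \<noteq> 0"
  shows "\<exists>k. ((+) v ^^ k) x \<notin> lat_pts P"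
proof -
  obtain S where S: "P = convex hull (rv ` S)" "finite S" "S \<noteq> {}"
    using assms(1) by (rule lattice_polytopeE)
  obtain i where i: "Poly_Mapping.lookup v i \<noteq> 0"
    using assms(2) by (metis poly_mapping_eqI lookup_zero)
  define M where "M = Max ((\<lambda>s. \<bar>Poly_Mapping.lookup s i\<bar>) ` S)"
  have "P \<subseteq> {x. Poly_Mapping.lookup x i \<in> {- real_of_int M .. real_of_int M}}" unfolding S(1)
  proof (rule hull_minimal)
    have "\<bar>Poly_Mapping.lookup s i\<bar> \<le> M" if "s \<in> S" for s
      using that S(2) unfolding M_def by auto
    then have "\<bar>real_of_int (Poly_Mapping.lookup s i)\<bar> \<le> real_of_int M" if "s \<in> S" for s
      using that of_int_le_iff[of "\<bar>Poly_Mapping.lookup s i\<bar>" M] by simp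
    then show "rv ` S \<subseteq> {x. Poly_Mapping.lookup x i \<in> {- real_of_int M .. real_of_int M}}"
      by (auto simp: abs_le_iff) (force simp: abs_le_iff)
    have "linear (\<lambda>x :: rvec. Poly_Mapping.lookup x i)"
      by (rule linearI) (auto simp: lookup_add)
    from convex_linear_vimage[OF this convex_real_interval(5)]
    show "convex {x :: rvec. Poly_Mapping.lookup x i \<in> {- real_of_int M .. real_of_int M}}"
      by (simp add: vimage_def)
  qed
  then have *: "\<bar>Poly_Mapping.lookup y i\<bar> \<le> M" if "y \<in> lat_pts P" for y
    using that unfolding lat_pts_def by fastforce
  \<comment> \<open>The coordinate of \<open>v\<close> is a nonzero integer, so this many steps
    carry coordinate \<open>i\<close> past \<open>M\<close> even after losing the starting
    value.\<close>
  define k where "k = nat (M + \<bar>Poly_Mapping.lookup x i\<bar> + 1)"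
  have "int k * 1 \<le> int k * \<bar>Poly_Mapping.lookup v i\<bar>" using i by (intro mult_left_mono) auto
  then have "int k \<le> \<bar>int k * Poly_Mapping.lookup v i\<bar>" by (simp add: abs_mult)
  then have "M < \<bar>Poly_Mapping.lookup (((+) v ^^ k) x) i\<bar>"
    unfolding lookup_iterate_add k_def by linarith
  then show ?thesis using *[of "((+) v ^^ k) x"] by (intro exI[of _ k]) auto
qed

text \<open>From the last lattice point before the ray leaves \<open>P\<close> the next step fails,
  so that point must lie on \<open>F\<close>.\<close>

lemma descent_to_facet:
  assumes "lattice_polytope n P" "v \<noteq> 0" "x \<in> lat_pts P"
    and "\<And>x. x \<in> lat_pts P \<Longrightarrow> rv x \<notin> F \<Longrightarrow> rv (x + v) \<in> P"
  shows "\<exists>k. ((+) v ^^ k) x \<in> lat_pts P \<and> rv (((+) v ^^ k) x) \<in> F"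
proof -
  define k where "k = (LEAST k. ((+) v ^^ k) x \<notin> lat_pts P)"
  have k: "((+) v ^^ k) x \<notin> lat_pts P"
    unfolding k_def using ray_leaves[OF assms(1,2), of x] by (rule LeastI_ex)
  then obtain l where l: "k = Suc l" using assms(3) by (cases k) auto
  have "((+) v ^^ l) x \<in> lat_pts P"
    using not_less_Least[of l "\<lambda>k. ((+) v ^^ k) x \<notin> lat_pts P"] l unfolding k_def by auto
  moreover have "rv (((+) v ^^ l) x) \<in> F"
    using assms(4)[of "((+) v ^^ l) x"] calculation k l by (auto simp: lat_pts_def add.commute)
  ultimately show ?thesis by blast
qed

text \<open>For \<open>v \<in> Col(P)\<close> the conditions determine \<open>h = \<langle>P\<^sub>v,-\<rangle>\<close> and \<open>b = b\<^bsub>P_v\<^esub>\<close>. They mention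
  lattice points only, which replaces facets by integer arithmetic.\<close>

definition col_form :: "nat \<Rightarrow> rvec set \<Rightarrow> lvec \<Rightarrow> (lvec \<Rightarrow> int) \<Rightarrow> int \<Rightarrow> bool" where
  "col_form n P v h b \<longleftrightarrow> additive h \<and> (\<forall>i\<ge>n. h (Poly_Mapping.single i 1) = 0) \<and> v \<in> Zn n \<and> h v = -1 \<and>
     (\<forall>x\<in>lat_pts P. b \<le> h x) \<and> (\<forall>x\<in>lat_pts P. b < h x \<longrightarrow> v + x \<in> lat_pts P)"

lemma col_formD:
  assumes "col_form n P v h b"
  shows "additive h" "\<And>i. n \<le> i \<Longrightarrow> h (Poly_Mapping.single i 1) = 0" "v \<in> Zn n" "h v = -1" "v \<noteq> 0"
    "\<And>x. x \<in> lat_pts P \<Longrightarrow> b \<le> h x" "\<And>x. x \<in> lat_pts P \<Longrightarrow> b < h x \<Longrightarrow> v + x \<in> lat_pts P"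
proof -
  show "additive h" "h v = -1" using assms by (auto simp: col_form_def)
  then show "v \<noteq> 0" using additive.zero by force
qed (use assms in \<open>auto simp: col_form_def\<close>)

lemma col_form_iterate:
  assumes "col_form n P v h b" "x \<in> lat_pts P" "int k \<le> h x - b"
  shows "((+) v ^^ k) x \<in> lat_pts P"
  using assms(3)
proof (induction k)
  case (Suc k)
  then show ?case
    using col_formD(7)[OF assms(1), of "((+) v ^^ k) x"]
      additive_mult_nat[OF col_formD(1)[OF assms(1)], of k v x] col_formD(4)[OF assms(1)] by simp
qed (use assms in auto)

lemma col_form_project:
  assumes "col_form n P v h b" "x \<in> lat_pts P"
  shows "((+) v ^^ nat (h x - b)) x \<in> lat_pts P" "h (((+) v ^^ nat (h x - b)) x) = b"
  using col_form_iterate[OF assms] col_formD(6)[OF assms]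
      additive_mult_nat[OF col_formD(1)[OF assms(1)], of _ v x] col_formD(4)[OF assms(1)] by auto

text \<open>Otherwise \<open>h\<close> would be constant on the affine lattice generated by
  \<open>lat_pts P\<close>, which contains both \<open>0\<close> and \<open>v\<close>.\<close>

lemma col_form_ex_gt:
  assumes "lattice_polytope n P" "col_form n P v h b"
  shows "\<exists>x\<in>lat_pts P. b < h x"
proof (rule ccontr)
  note h = col_formD[OF assms(2)]
  assume "\<not> ?thesis"
  then have *: "h x = b" if "x \<in> lat_pts P" for x using h(6)[OF that] that by force
  have "h x = b" if "x \<in> Zn n" for x
    by (rule lattice_polytope_induct[OF assms(1), of "\<lambda>x. h x = b"])
      (use * that h(1) in \<open>auto simp: additive.add additive.diff\<close>)
  from this[of v] this[of 0] show False using h by (auto simp: additive.zero)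
qed

text \<open>Descend along \<open>v\<close> from a higher point and stop one level above the
  facet.\<close>

lemma col_form_ex_height_1:
  assumes "lattice_polytope n P" "col_form n P v h b"
  shows "\<exists>x\<in>lat_pts P. h x = b + 1"
proof -
  note h = col_formD[OF assms(2)]
  obtain x where x: "x \<in> lat_pts P" "b < h x" using col_form_ex_gt[OF assms] by blast
  show ?thesis
    using col_form_iterate[OF assms(2) x(1), of "nat (h x - b - 1)"] x(2)
     additive_mult_nat[OF h(1), of "nat (h x - b - 1)" v x] h(4) by (intro bexI) auto
qed

text \<open>Projecting along \<open>v\<close> onto the facet \<open>h = b\<close> shows that a form constant on that facet is
  proportional to \<open>h\<close>.\<close>

lemma col_form_proportional:
  assumes P: "lattice_polytope n P" and v: "col_form n P v h b"
    and g: "additive (g :: lvec \<Rightarrow> int)" "\<And>x. x \<in> lat_pts P \<Longrightarrow> h x = b \<Longrightarrow> g x = c"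
      "\<And>x. x \<in> lat_pts P \<Longrightarrow> c \<le> g x"
  shows "\<exists>m\<ge>0. c = m * b \<and> (\<forall>x\<in>Zn n. g x = m * h x)"
proof -
  note h = col_formD[OF v]
  \<comment> \<open>The projection takes \<open>h x - b\<close> steps, each changing
    \<open>g\<close> by \<open>g v\<close>; the factor sought is \<open>- g v\<close>.\<close>
  have *: "g x - c = - g v * (h x - b)" if "x \<in> lat_pts P" for x
    using g(2)[OF col_form_project[OF v that]] additive_mult_nat[OF g(1), of "nat (h x - b)" v x]
      h(6)[OF that] by (simp add: algebra_simps)
  have **: "g x - c = - g v * (h x - b)" if "x \<in> Zn n" for x
    using that
  proof (rule lattice_polytope_induct[OF P, rotated 2])
    fix x y z assume "g x - c = - g v * (h x - b)" "g y - c = - g v * (h y - b)" "g z - c = - g v * (h z - b)"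
    then show "g (x - y + z) - c = - g v * (h (x - y + z) - b)"
      using g(1) h(1) by (auto simp: additive.add additive.diff algebra_simps)
  qed (rule *)
  have c: "c = - g v * b" using **[of 0] g(1) h(1) by (simp add: additive.zero)
  obtain x where "x \<in> lat_pts P" "b < h x" using col_form_ex_gt[OF P v] by blast
  then have "0 \<le> - g v * (h x - b)" "0 < h x - b" using *[of x] g(3)[of x] by auto
  then have "0 \<le> - g v" by (simp only: zero_le_mult_iff) linarith
  then show ?thesis using c ** by (intro exI[of _ "- g v"]) (auto simp: algebra_simps eq_neg_iff_add_eq_0)
qed

lemma additive_eqI:
  assumes "additive (g :: lvec \<Rightarrow> int)" "additive h" "\<And>x. x \<in> Zn n \<Longrightarrow> g x = h x"
    "\<And>i. n \<le> i \<Longrightarrow> g (Poly_Mapping.single i 1) = 0" "\<And>i. n \<le> i \<Longrightarrow> h (Poly_Mapping.single i 1) = 0"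
  shows "g = h"
proof
  fix x
  have "g (Poly_Mapping.single i 1) = h (Poly_Mapping.single i 1)" for i
    using assms(3)[of "Poly_Mapping.single i 1"] assms(4,5)[of i] by (cases "i < n") auto
  then show "g x = h x"
    using additive_expand[OF assms(1), of "Poly_Mapping.keys x" x]
      additive_expand[OF assms(2), of "Poly_Mapping.keys x" x] by simp
qed

text \<open>Adding \<open>u\<close> to a point of the facet \<open>h = b\<close> would leave
  \<open>P\<close>, so this facet lies in the base facet of \<open>u\<close> and the forms are
  proportional. Integrality together with \<open>g u = -1\<close> makes the factor 1.\<close>

lemma col_form_eq:
  assumes P: "lattice_polytope n P" and v: "col_form n P v h b" and u: "col_form n P u g c"
    and "h u < 0"
  shows "g = h" "c = b"
proof -
  note h = col_formD[OF v] and g = col_formD[OF u]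
  have "g x = c" if x: "x \<in> lat_pts P" "h x = b" for x
  proof (rule ccontr)
    assume "g x \<noteq> c"
    then have "u + x \<in> lat_pts P" using g(6,7)[OF x(1)] by auto
    then show False using h(6)[of "u + x"] x assms(4) by (simp add: additive.add[OF h(1)])
  qed
  then obtain m where m: "m \<ge> 0" "c = m * b" "\<And>x. x \<in> Zn n \<Longrightarrow> g x = m * h x"
    using col_form_proportional[OF P v g(1) _ g(6)] by blast
  have "m * (- h u) = 1" using m(3)[OF g(3)] g(4) by simp
  then have "m = 1" using m(1) by (simp add: zmult_eq_1_iff del: mult_minus_right)
  then show "c = b" using m by simp
  show "g = h" by (rule additive_eqI[of _ _ n]) (use g h m \<open>m = 1\<close> in auto)
qed

lemma col_form_unique:
  assumes "lattice_polytope n P" "col_form n P v h b" "col_form n P v g c"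
  shows "g = h" "c = b"
  using col_form_eq[OF assms] col_formD(4)[OF assms(2)] by auto

section \<open>Facets of a polytope against integral forms\<close>

lemma rv_iterate: "rv (((+) v ^^ k) x) = rv x + real k *\<^sub>R rv v"
  by (rule poly_mapping_eqI) (simp add: lookup_iterate_add lookup_add algebra_simps)

lemma convex_span_translate: "convex {y. y - a \<in> span D}"
proof (rule convexI)
  fix x y :: 'a and s t :: real
  assume "x \<in> {y. y - a \<in> span D}" "y \<in> {y. y - a \<in> span D}" "s + t = 1"
  moreover have "s *\<^sub>R x + t *\<^sub>R y - (s + t) *\<^sub>R a = s *\<^sub>R (x - a) + t *\<^sub>R (y - a)"
    by (simp add: algebra_simps)
  ultimately show "s *\<^sub>R x + t *\<^sub>R y \<in> {y. y - a \<in> span D}"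
    by (auto intro!: span_add span_scale)
qed

abbreviation diffs :: "'a::real_vector set \<Rightarrow> 'a set" where
  "diffs S \<equiv> {x - y | x y. x \<in> S \<and> y \<in> S}"

text \<open>Every lattice point reaches \<open>F\<close> by multiples of \<open>v\<close>, so
  \<open>v\<close> and the directions of \<open>F\<close> span all directions of
  \<open>P\<close>.\<close>

lemma diffs_subset_span:
  assumes P: "lattice_polytope n P" and "F \<noteq> {}" "F \<subseteq> P"
    and "\<And>x. x \<in> lat_pts P \<Longrightarrow> \<exists>k. rv (((+) v ^^ k) x) \<in> F"
  shows "diffs P \<subseteq> span (insert (rv v) (diffs F))"
proof -
  obtain f where f: "f \<in> F" using assms(2) by blast
  have "P \<subseteq> {y. y - f \<in> span (insert (rv v) (diffs F))}"
  proof (rule lattice_polytope_subset[OF P convex_span_translate])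
    fix x assume "x \<in> lat_pts P"
    then obtain k where "rv (((+) v ^^ k) x) \<in> F" using assms(4) by blast
    then have "rv (((+) v ^^ k) x) - f \<in> span (insert (rv v) (diffs F))"
      using f by (intro span_base) auto
    moreover have "real k *\<^sub>R rv v \<in> span (insert (rv v) (diffs F))"
      by (intro span_scale span_base) auto
    ultimately have "rv (((+) v ^^ k) x) - f - real k *\<^sub>R rv v \<in> span (insert (rv v) (diffs F))"
      by (rule span_diff)
    then show "rv x \<in> {y. y - f \<in> span (insert (rv v) (diffs F))}"
      by (simp add: rv_iterate algebra_simps)
  qed
  then have *: "y - f \<in> span (insert (rv v) (diffs F))" if "y \<in> P" for y using that by blast
  show ?thesis
  proof clarify
    fix x y assume "x \<in> P" "y \<in> P"
    from span_diff[OF *[OF this(1)] *[OF this(2)]] show "x - y \<in> span (insert (rv v) (diffs F))" by simp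
  qed
qed

text \<open>The facet form is recovered as the linear functional that vanishes on the directions of
  \<open>F\<close> and is -1 at \<open>v\<close>. The height of a lattice point is then the number
  of \<open>v\<close>-steps to \<open>F\<close>, hence integral.\<close>

lemma base_of_imp_col_form:
  assumes P: "lattice_polytope n P" and v: "v \<in> Zn n" "v \<noteq> 0" "base_of P v F"
  shows "\<exists>h b. col_form n P v h b \<and> F = {x \<in> P. lin_ext h x = real_of_int b}"
proof -
  have F: "F face_of P" "F \<noteq> {}" "affdim F + 1 = affdim P"
    and step: "\<And>x. x \<in> lat_pts P \<Longrightarrow> rv x \<notin> F \<Longrightarrow> rv (x + v) \<in> P"
    using v unfolding base_of_def is_facet_def by auto
  have FP: "F \<subseteq> P" and conv: "convex F" using F(1) face_of_imp_subset face_of_imp_convex by auto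
  have desc: "\<exists>k. ((+) v ^^ k) x \<in> lat_pts P \<and> rv (((+) v ^^ k) x) \<in> F" if "x \<in> lat_pts P" for x
    using descent_to_facet[OF P v(2) that step] by blast
  have dP: "diffs P \<subseteq> span (insert (rv v) (diffs F))"
    using desc by (intro diffs_subset_span[OF P F(2) FP]) blast
  \<comment> \<open>If \<open>v\<close> were parallel to \<open>F\<close>, the directions of
    \<open>F\<close> would already span those of \<open>P\<close>, against codimension one.\<close>
  have nspan: "rv v \<notin> span (diffs F)"
  proof
    assume "rv v \<in> span (diffs F)"
    then have "diffs P \<subseteq> span (diffs F)" using dP by (simp add: span_redundant)
    moreover have "diffs F \<subseteq> diffs P" using FP by blast
    ultimately have "span (diffs P) = span (diffs F)"
      by (intro subset_antisym span_minimal span_mono subspace_span)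
    then have "dim (diffs P) = dim (diffs F)" by (rule span_eq_dim)
    then show False using F(3) by (simp add: affdim_def)
  qed
  obtain B where B: "B \<subseteq> diffs F" "independent B" "diffs F \<subseteq> span B"
    by (rule maximal_independent_subset[of "diffs F"])
  have "span B = span (diffs F)" by (intro subset_antisym span_mono[OF B(1)] span_minimal[OF B(3)] subspace_span)
  then have "independent (insert (rv v) B)" using nspan B by (simp add: independent_insert)
  from linear_independent_extend[OF this, of "\<lambda>x. if x = rv v then - 1 else 0"]
  obtain \<psi> :: "rvec \<Rightarrow> real" where \<psi>: "linear \<psi>" "\<forall>x\<in>insert (rv v) B. \<psi> x = (if x = rv v then - 1 else 0)"
    by (elim exE conjE)
  have vB: "rv v \<notin> B" using nspan \<open>span B = span (diffs F)\<close> span_base by blast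
  have \<psi>D: "\<psi> x = 0" if "x \<in> span (diffs F)" for x
  proof -
    have "x \<in> span B" using that \<open>span B = span (diffs F)\<close> by simp
    moreover have "\<psi> y = 0" if "y \<in> B" for y using \<psi>(2) vB that by (auto split: if_splits)
    ultimately show ?thesis using linear_eq_0_on_span[OF \<psi>(1)] by blast
  qed
  have \<psi>v: "\<psi> (rv v) = -1" using \<psi>(2) by simp
  obtain x0 where x0: "x0 \<in> lat_pts P" "rv x0 \<in> F" using desc lat_pts_nonempty[OF P] by blast
  have \<psi>F: "\<psi> y = \<psi> (rv x0)" if "y \<in> F" for y
  proof -
    have "y - rv x0 \<in> span (diffs F)" using that x0 by (intro span_base) auto
    from \<psi>D[OF this] show ?thesis by (simp add: linear_diff[OF \<psi>(1)])
  qed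
  have height: "\<exists>k. \<psi> (rv x) = \<psi> (rv x0) + real k \<and> rv (((+) v ^^ k) x) \<in> F" if x: "x \<in> lat_pts P" for x
  proof -
    obtain k where k: "rv (((+) v ^^ k) x) \<in> F" using desc[OF x] by blast
    have "\<psi> (rv x + real k *\<^sub>R rv v) = \<psi> (rv x0)" using \<psi>F[OF k] by (simp add: rv_iterate)
    then have "\<psi> (rv x) = \<psi> (rv x0) + real k"
      by (simp add: linear_add[OF \<psi>(1)] linear_scale[OF \<psi>(1)] \<psi>v)
    then show ?thesis using k by blast
  qed
  \<comment> \<open>At first only differences to the value at \<open>x0\<close> are known to be
    integral; \<open>x = 0\<close> then gives integrality at \<open>x0\<close> itself.\<close>
  have int: "\<psi> (rv x) - \<psi> (rv x0) \<in> \<int>" if "x \<in> Zn n" for x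
    using that
  proof (rule lattice_polytope_induct[OF P, rotated 2])
    fix x assume "x \<in> lat_pts P"
    then show "\<psi> (rv x) - \<psi> (rv x0) \<in> \<int>" using height by force
  next
    fix x y z assume *: "\<psi> (rv x) - \<psi> (rv x0) \<in> \<int>" "\<psi> (rv y) - \<psi> (rv x0) \<in> \<int>" "\<psi> (rv z) - \<psi> (rv x0) \<in> \<int>"
    have "\<psi> (rv (x - y + z)) - \<psi> (rv x0) = (\<psi> (rv x) - \<psi> (rv x0)) - (\<psi> (rv y) - \<psi> (rv x0)) + (\<psi> (rv z) - \<psi> (rv x0))"
      by (simp add: rv_add rv_diff linear_add[OF \<psi>(1)] linear_diff[OF \<psi>(1)])
    then show "\<psi> (rv (x - y + z)) - \<psi> (rv x0) \<in> \<int>" using * by (metis Ints_add Ints_diff)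
  qed
  have int0: "\<psi> (rv x0) \<in> \<int>" using int[of 0] linear_0[OF \<psi>(1)] by simp
  have intZ: "\<psi> (rv x) \<in> \<int>" if "x \<in> Zn n" for x using Ints_add[OF int[OF that] int0] by simp
  \<comment> \<open>By \<open>intZ\<close> the floors only turn integral reals into integers.
    Summing over \<open>i < n\<close> extends the form by zero.\<close>
  define h where "h x = (\<Sum>i<n. Poly_Mapping.lookup x i * \<lfloor>\<psi> (rv (Poly_Mapping.single i 1))\<rfloor>)" for x :: lvec
  define b where "b = \<lfloor>\<psi> (rv x0)\<rfloor>"
  have b: "real_of_int b = \<psi> (rv x0)" unfolding b_def using int0 by simp
  have add: "additive h" by (rule additive.intro) (simp add: h_def lookup_add algebra_simps sum.distrib)
  have h_single: "h (Poly_Mapping.single i 1) = (if i < n then \<lfloor>\<psi> (rv (Poly_Mapping.single i 1))\<rfloor> else 0)" for i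
    unfolding h_def by (auto simp: lookup_single when_def if_distrib[of "\<lambda>x. x * _"] cong: if_cong)
  have ext: "\<psi> x = lin_ext h x" if "Poly_Mapping.keys x \<subseteq> {..<n}" for x
    using \<psi>(1) _ that
  proof (rule lin_ext_eq_on)
    fix i assume "i < n"
    then show "\<psi> (Poly_Mapping.single i 1) = real_of_int (h (Poly_Mapping.single i 1))"
      using intZ[of "Poly_Mapping.single i 1"] by (auto simp: h_single rv_single elim: Ints_cases)
  qed
  have hZ: "real_of_int (h x) = \<psi> (rv x)" if "x \<in> Zn n" for x
    using that by (simp add: ext Zn_def lin_ext_rv[OF add])
  have hk: "\<exists>k. h x = b + int k \<and> rv (((+) v ^^ k) x) \<in> F" if x: "x \<in> lat_pts P" for x
  proof -
    obtain k where k: "\<psi> (rv x) = \<psi> (rv x0) + real k" "rv (((+) v ^^ k) x) \<in> F" using height[OF x] by blast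
    then have "real_of_int (h x) = real_of_int (b + int k)"
      using hZ[of x] x lat_pts_subset_Zn[OF P] b by auto
    then show ?thesis using k(2) of_int_eq_iff by blast
  qed
  have "real_of_int (h v) = real_of_int (-1)" using hZ[OF v(1)] \<psi>v by simp
  then have hv: "h v = -1" using of_int_eq_iff by blast
  have col: "col_form n P v h b" unfolding col_form_def
  proof (intro conjI ballI allI impI)
    fix x assume x: "x \<in> lat_pts P" "b < h x"
    have "rv x \<notin> F"
    proof
      assume "rv x \<in> F"
      then have "real_of_int (h x) = real_of_int b"
        using \<psi>F[of "rv x"] hZ[of x] lat_pts_subset_Zn[OF P] x b by auto
      then show False using x(2) by simp
    qed
    then show "v + x \<in> lat_pts P" using step[OF x(1)] by (simp add: lat_pts_def add.commute)
  next
    fix x assume "x \<in> lat_pts P"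
    then show "b \<le> h x" using hk[of x] by auto
  qed (use add h_single v hv in auto)
  have "{x \<in> P. lin_ext h x = b} \<subseteq> F"
  proof -
    \<comment> \<open>An open half-space together with a convex subset of its bounding hyperplane is
      convex, and this union contains all lattice points of \<open>P\<close>.\<close>
    have "P \<subseteq> {x. real_of_int b < lin_ext h x} \<union> F"
    proof (rule lattice_polytope_subset[OF P])
      show "rv x \<in> {x. real_of_int b < lin_ext h x} \<union> F" if x: "x \<in> lat_pts P" for x
      proof -
        obtain k where k: "h x = b + int k" "rv (((+) v ^^ k) x) \<in> F" using hk[OF x] by blast
        then show ?thesis by (cases k) (auto simp: lin_ext_rv[OF add])
      qed
      have F_b: "lin_ext h x = b" if "x \<in> F" for x
        using \<psi>F[OF that] b ext[of x] lattice_polytope_keys[OF P, of x] FP that by auto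
      show "convex ({x. real_of_int b < lin_ext h x} \<union> F)"
      proof (rule convexI)
        fix x y s t assume xy: "x \<in> {x. real_of_int b < lin_ext h x} \<union> F" "y \<in> {x. real_of_int b < lin_ext h x} \<union> F"
          and st: "0 \<le> (s::real)" "0 \<le> t" "s + t = 1"
        show "s *\<^sub>R x + t *\<^sub>R y \<in> {x. real_of_int b < lin_ext h x} \<union> F"
        proof (cases "s = 0 \<or> t = 0 \<or> x \<in> F \<and> y \<in> F")
          case True
          then show ?thesis using xy st conv by (auto simp: convexD)
        next
          case False
          let ?d = "\<lambda>z. lin_ext h z - real_of_int b"
          have "0 \<le> ?d x" "0 \<le> ?d y" "0 < ?d x \<or> 0 < ?d y" using xy F_b False by (auto dest!: F_b)
          then have "0 < s * ?d x + t * ?d y"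
            using False st by (smt (verit) mult_nonneg_nonneg mult_pos_pos)
          moreover have "lin_ext h (s *\<^sub>R x + t *\<^sub>R y) - (s + t) * real_of_int b = s * ?d x + t * ?d y"
            by (simp add: lin_ext_add lin_ext_scaleR algebra_simps)
          ultimately show ?thesis using st by simp
        qed
      qed
    qed
    then show ?thesis by auto
  qed
  moreover have "F \<subseteq> {x \<in> P. lin_ext h x = b}"
  proof
    fix y assume "y \<in> F"
    then show "y \<in> {x \<in> P. lin_ext h x = b}"
      using \<psi>F[of y] b ext[of y] lattice_polytope_keys[OF P, of y] FP by auto
  qed
  ultimately have "F = {x \<in> P. lin_ext h x = b}" by (rule subset_antisym[rotated])
  with col show ?thesis by blast
qed

lemma keys_subset_imp_span:
  assumes "Poly_Mapping.keys (x :: rvec) \<subseteq> {..<n}"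
  shows "x \<in> span ((\<lambda>i. Poly_Mapping.single i 1) ` {..<n})"
proof -
  have "x = (\<Sum>i<n. Poly_Mapping.lookup x i *\<^sub>R Poly_Mapping.single i 1)"
    using assms by (intro poly_mapping_eqI)
      (auto simp: lookup_sum lookup_single when_def if_distrib[of "(*) _"] sum.delta' in_keys_iff cong: if_cong)
  also have "\<dots> \<in> span ((\<lambda>i. Poly_Mapping.single i 1) ` {..<n})"
    by (intro span_sum span_scale span_base) auto
  finally show ?thesis .
qed

text \<open>The ambient space is infinite-dimensional. The finite set \<open>T\<close> guarantees
  finite bases; \<open>dim\<close> counts by \<open>card\<close>, which is 0 on infinite
  sets.\<close>

lemma dim_insert_nspan:
  fixes S :: "'a::real_vector set"
  assumes "v \<notin> span S" "finite T" "S \<subseteq> span T"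
  shows "dim (insert v S) = Suc (dim S)"
proof -
  obtain B where B: "B \<subseteq> S" "independent B" "S \<subseteq> span B"
    by (rule maximal_independent_subset[of S])
  have fin: "finite B" using independent_span_bound[OF assms(2) B(2)] B(1) assms(3) by blast
  have sp: "span B = span S" by (intro subset_antisym span_mono[OF B(1)] span_minimal[OF B(3)] subspace_span)
  have "independent (insert v B)" using assms(1) B sp by (simp add: independent_insert)
  moreover have "span (insert v B) = span (insert v S)"
    by (rule span_eq[THEN iffD2])
      (use B in \<open>auto intro: span_base subsetD[OF span_mono[of B "insert v B"]]\<close>)
  ultimately have "dim (insert v S) = card (insert v B)" by (metis dim_eq_card)
  moreover have "dim S = card B" using sp B by (metis dim_eq_card)
  moreover have "v \<notin> B" using assms(1) B span_base by blast
  ultimately show ?thesis using fin by simp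
qed

lemma lin_ext_ge:
  assumes P: "lattice_polytope n P" and h: "additive h" "\<And>x. x \<in> lat_pts P \<Longrightarrow> b \<le> h x" and "x \<in> P"
  shows "real_of_int b \<le> lin_ext h x"
proof -
  have "convex {x. lin_ext h x \<in> {real_of_int b..}}"
    using convex_linear_vimage[OF linear_lin_ext convex_real_interval(1), of h] by (simp add: vimage_def)
  then have "P \<subseteq> {x. lin_ext h x \<in> {real_of_int b..}}"
    by (rule lattice_polytope_subset[OF P]) (simp add: lin_ext_rv h)
  then show ?thesis using assms(4) by auto
qed

text \<open>The level set is a face because \<open>h\<close> attains its minimum there, and it has
  codimension one because \<open>v\<close> is transversal to it.\<close>

lemma col_form_imp_base_of:
  assumes P: "lattice_polytope n P" and v: "col_form n P v h b"
  shows "base_of P v {x \<in> P. lin_ext h x = real_of_int b}"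
proof -
  note h = col_formD[OF v]
  define F where "F = {x \<in> P. lin_ext h x = real_of_int b}"
  note ge = lin_ext_ge[OF P h(1) h(6)]
  have desc: "\<exists>k. rv (((+) v ^^ k) x) \<in> F" if "x \<in> lat_pts P" for x
    using col_form_project[OF v that] by (auto simp: F_def lat_pts_def lin_ext_rv[OF h(1)])
  have "F face_of P" unfolding face_of_def
  proof (intro conjI ballI impI)
    have "convex {x. lin_ext h x \<in> {real_of_int b..real_of_int b}}"
      using convex_linear_vimage[OF linear_lin_ext convex_real_interval(5), of h b b] by (simp add: vimage_def)
    then have "convex (P \<inter> {x. lin_ext h x \<in> {real_of_int b..real_of_int b}})"
      using lattice_polytope_convex[OF P] by (rule convex_Int[rotated])
    moreover have "F = P \<inter> {x. lin_ext h x \<in> {real_of_int b..real_of_int b}}"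
      unfolding F_def by auto
    ultimately show "convex F" by simp
    fix x y z assume xyz: "x \<in> P" "y \<in> P" "z \<in> F" "z \<in> open_segment x y"
    then obtain u where u: "z = (1 - u) *\<^sub>R x + u *\<^sub>R y" "0 < u" "u < 1"
      by (auto simp: in_segment)
    \<comment> \<open>A combination with positive weights of two nonnegative excesses vanishes only
      if both do.\<close>
    have "(1 - u) * (lin_ext h x - b) + u * (lin_ext h y - b) = 0"
    proof -
      have "lin_ext h z = (1 - u) * lin_ext h x + u * lin_ext h y"
        by (simp only: u(1) lin_ext_add lin_ext_scaleR real_scaleR_def)
      then show ?thesis using xyz(3) by (simp add: F_def algebra_simps)
    qed
    moreover have "0 \<le> (1 - u) * (lin_ext h x - b)" "0 \<le> u * (lin_ext h y - b)"
      using ge xyz u by auto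
    ultimately have "(1 - u) * (lin_ext h x - b) = 0" "u * (lin_ext h y - b) = 0" by linarith+
    then show "x \<in> F" "y \<in> F" using xyz u by (auto simp: F_def)
  qed (auto simp: F_def)
  moreover have "F \<noteq> {}" using desc lat_pts_nonempty[OF P] by blast
  moreover have "affdim F + 1 = affdim P"
  proof -
    have nspan: "rv v \<notin> span (diffs F)"
    proof
      assume "rv v \<in> span (diffs F)"
      moreover have "lin_ext h x = 0" if "x \<in> diffs F" for x using that by (auto simp: F_def lin_ext_diff)
      ultimately have "lin_ext h (rv v) = 0" using linear_eq_0_on_span[OF linear_lin_ext] by blast
      then show False using h by (simp add: lin_ext_rv)
    qed
    obtain x where x: "x \<in> lat_pts P" "b < h x" using col_form_ex_gt[OF P v] by blast
    \<comment> \<open>Starting above the facet, \<open>v\<close> joins two lattice points of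
      \<open>P\<close>, so it is one of the directions of \<open>P\<close>.\<close>
    have "rv v = rv (v + x) - rv x" by (simp add: rv_add)
    then have "rv v \<in> diffs P" using h(7)[OF x] x by (auto simp: lat_pts_def)
    then have "insert (rv v) (diffs F) \<subseteq> diffs P" by (auto simp: F_def)
    moreover have "diffs P \<subseteq> span (insert (rv v) (diffs F))"
      using desc \<open>F \<noteq> {}\<close> by (intro diffs_subset_span[OF P]) (auto simp: F_def)
    ultimately have "span (diffs P) = span (insert (rv v) (diffs F))"
      by (intro subset_antisym span_minimal span_mono subspace_span)
    then have "dim (diffs P) = dim (insert (rv v) (diffs F))" by (rule span_eq_dim)
    also have "\<dots> = Suc (dim (diffs F))"
    proof (rule dim_insert_nspan[OF nspan])
      let ?T = "(\<lambda>i. Poly_Mapping.single i (1::real)) ` {..<n}"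
      have "x \<in> span ?T" if "x \<in> P" for x
        using keys_subset_imp_span lattice_polytope_keys[OF P that] by blast
      then show "diffs F \<subseteq> span ?T" by (auto simp: F_def intro: span_diff)
    qed auto
    finally show ?thesis by (simp add: affdim_def)
  qed
  moreover have "rv (x + v) \<in> P" if "x \<in> lat_pts P" "rv x \<notin> F" for x
    using h(6,7)[OF that(1)] that by (force simp: F_def lat_pts_def lin_ext_rv[OF h(1)] add.commute)
  ultimately show ?thesis unfolding base_of_def is_facet_def F_def by blast
qed

text \<open>This lemma and the next three translate columns, base facets, facet forms and minima
  into \<open>col_form\<close> data, so the definite descriptions need not be unfolded
  again.\<close>

lemma Col_iff:
  assumes P: "lattice_polytope n P"
  shows "v \<in> Col n P \<longleftrightarrow> (\<exists>h b. col_form n P v h b)"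
  using base_of_imp_col_form[OF P, of v] col_form_imp_base_of[OF P, of v] col_formD(3,5)[of n P v]
  unfolding Col_def by blast

lemma col_form_base_facet:
  assumes P: "lattice_polytope n P" and v: "col_form n P v h b"
  shows "base_facet P v = {x \<in> P. lin_ext h x = real_of_int b}"
  unfolding base_facet_def
proof (rule the_equality)
  show "base_of P v {x \<in> P. lin_ext h x = real_of_int b}" by (rule col_form_imp_base_of[OF P v])
  fix F assume "base_of P v F"
  then obtain g c where g: "col_form n P v g c" "F = {x \<in> P. lin_ext g x = real_of_int c}"
    using base_of_imp_col_form[OF P, of v F] col_formD[OF v] by blast
  then show "F = {x \<in> P. lin_ext h x = real_of_int b}" using col_form_unique[OF P v g(1)] by simp
qed

text \<open>Any competing form is constant on the base facet, hence a multiple of \<open>h\<close>,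
  and surjectivity forces the factor 1. That \<open>h\<close> itself is surjective follows from
  \<open>h (- v) = 1\<close>.\<close>

lemma col_form_facet_form:
  assumes P: "lattice_polytope n P" and v: "col_form n P v h b"
  shows "facet_form n P (base_facet P v) = h"
  unfolding facet_form_def
proof (rule the_equality)
  note h = col_formD[OF v]
  have iter: "h (((+) u ^^ k) 0) = int k * h u" for k u
    using additive_mult_nat[OF h(1), of k u 0] additive_0[OF h(1)] by simp
  have iterZ: "((+) u ^^ k) 0 \<in> Zn n" if "u \<in> Zn n" for k u
    using that by (induction k) (auto intro: Zn_add)
  have "h ` Zn n = UNIV"
  proof (intro equalityI subsetI UNIV_I)
    fix a :: int
    have "- v \<in> Zn n" "h (- v) = 1" using Zn_diff[of 0 n v] h by (auto simp: additive.minus)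
    then have "h (((+) (if a \<ge> 0 then - v else v) ^^ nat \<bar>a\<bar>) 0) = a"
      using h by (auto simp: iter)
    then show "a \<in> h ` Zn n" using iterZ[of "if a \<ge> 0 then - v else v" "nat \<bar>a\<bar>"] h \<open>- v \<in> Zn n\<close>
      by (metis image_eqI)
  qed
  moreover have "min_exactly_on P (base_facet P v) h b"
    unfolding min_exactly_on_def col_form_base_facet[OF P v]
    using lin_ext_ge[OF P h(1) h(6)] by auto
  ultimately show "additive h \<and> (\<forall>i\<ge>n. h (Poly_Mapping.single i 1) = 0) \<and> h ` Zn n = UNIV \<and>
      (\<exists>b. min_exactly_on P (base_facet P v) h b)" using h by blast
  fix g assume "additive g \<and> (\<forall>i\<ge>n. g (Poly_Mapping.single i 1) = 0) \<and> g ` Zn n = UNIV \<and>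
      (\<exists>b. min_exactly_on P (base_facet P v) g b)"
  then obtain c where g: "additive g" "\<And>i. i \<ge> n \<Longrightarrow> g (Poly_Mapping.single i 1) = 0" "g ` Zn n = UNIV"
     "\<And>x. x \<in> P \<Longrightarrow> real_of_int c \<le> lin_ext g x" "base_facet P v = {x \<in> P. lin_ext g x = real_of_int c}"
    unfolding min_exactly_on_def by blast
  have "\<exists>m\<ge>0. c = m * b \<and> (\<forall>x\<in>Zn n. g x = m * h x)"
  proof (rule col_form_proportional[OF P v g(1)])
    fix x assume x: "x \<in> lat_pts P"
    show "c \<le> g x" using g(4)[of "rv x"] x by (simp add: lat_pts_def lin_ext_rv[OF g(1)])
    assume "h x = b"
    then have "rv x \<in> base_facet P v"
      using x by (simp add: col_form_base_facet[OF P v] lin_ext_rv[OF h(1)] lat_pts_def)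
    then show "g x = c" using x by (simp add: g(5) lin_ext_rv[OF g(1)] lat_pts_def)
  qed
  then obtain m where m: "m \<ge> 0" "\<And>x. x \<in> Zn n \<Longrightarrow> g x = m * h x" by blast
  obtain y where "y \<in> Zn n" "g y = 1" using g(3) by (metis UNIV_I imageE)
  then have "m = 1" using m by (metis zmult_eq_1_iff one_neq_neg_one abs_of_nonneg abs_neg_one)
  then show "g = h" using m g h by (intro additive_eqI[of _ _ n]) auto
qed

text \<open>Projection along \<open>v\<close> yields a lattice point on the base facet, and its
  value fixes the minimum.\<close>

lemma col_form_facet_min:
  assumes P: "lattice_polytope n P" and v: "col_form n P v h b"
  shows "facet_min n P (base_facet P v) = b"
  unfolding facet_min_def col_form_facet_form[OF P v]
proof (rule the_equality)
  note h = col_formD[OF v]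
  show "min_exactly_on P (base_facet P v) h b"
    unfolding min_exactly_on_def col_form_base_facet[OF P v]
    using lin_ext_ge[OF P h(1) h(6)] by auto
  obtain x where "x \<in> lat_pts P" using lat_pts_nonempty[OF P] by blast
  from col_form_project[OF v this] have "\<exists>y\<in>lat_pts P. h y = b" by blast
  then obtain y where y: "y \<in> lat_pts P" "h y = b" by blast
  fix c assume "min_exactly_on P (base_facet P v) h c"
  moreover have "rv y \<in> base_facet P v"
    using y by (simp add: col_form_base_facet[OF P v] lin_ext_rv[OF h(1)] lat_pts_def)
  ultimately show "c = b"
    using y by (auto simp: min_exactly_on_def lin_ext_rv[OF h(1)])
qed

section \<open>Doublings\<close>

lemma Zn_iff: "x \<in> Zn n \<longleftrightarrow> (\<forall>i\<ge>n. Poly_Mapping.lookup x i = 0)"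
  unfolding Zn_def by (auto simp: in_keys_iff subset_iff simp flip: not_le)

lemma lookup_Zn [simp]: "x \<in> Zn n \<Longrightarrow> n \<le> i \<Longrightarrow> Poly_Mapping.lookup x i = 0"
  by (simp add: Zn_iff)

lemma Zn_Suc_cases:
  assumes "y \<in> Zn (Suc n)"
  obtains x k where "y = x + Poly_Mapping.single n k" "x \<in> Zn n"
proof
  let ?x = "y - Poly_Mapping.single n (Poly_Mapping.lookup y n)"
  show "y = ?x + Poly_Mapping.single n (Poly_Mapping.lookup y n)" by simp
  show "?x \<in> Zn n"
    using assms by (auto simp: Zn_iff lookup_minus lookup_single when_def)
qed

lemma Zn_add_single_eq_iff:
  assumes "x \<in> Zn n" "x' \<in> Zn n"
  shows "x + Poly_Mapping.single n k = x' + Poly_Mapping.single n k' \<longleftrightarrow> x = x' \<and> k = k'"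
proof
  assume *: "x + Poly_Mapping.single n k = x' + Poly_Mapping.single n k'"
  then have "Poly_Mapping.lookup (x + Poly_Mapping.single n k) n = Poly_Mapping.lookup (x' + Poly_Mapping.single n k') n"
    by (rule arg_cong)
  then have "k = k'" using assms by (simp add: lookup_add)
  then show "x = x' \<and> k = k'" using * by simp
qed simp

lemma Zn_Suc_add_single: "x \<in> Zn n \<Longrightarrow> x + Poly_Mapping.single n k \<in> Zn (Suc n)"
  using Zn_mono[of n "Suc n"] by (auto intro: Zn_add)

lemma additive_single_0:
  "additive (h :: lvec \<Rightarrow> int) \<Longrightarrow> h (Poly_Mapping.single n 1) = 0 \<Longrightarrow> h (x + Poly_Mapping.single n k) = h x"
  using additive_scale_single[of h n k] by (simp add: additive.add)

lemma additive_lookup: "additive (\<lambda>y. Poly_Mapping.lookup y n)"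
  by (rule additive.intro) (simp add: lookup_add)

lemma additive_diff_lookup: "additive (h :: lvec \<Rightarrow> int) \<Longrightarrow> additive (\<lambda>y. h y - Poly_Mapping.lookup y n)"
  by (rule additive.intro) (simp add: lookup_add additive.add)

locale doubling_step =
  fixes n :: nat and P :: "rvec set" and v0 :: lvec and h :: "lvec \<Rightarrow> int" and b :: int
  assumes P: "lattice_polytope n P" and v0: "col_form n P v0 h b"
begin

lemmas h = col_formD[OF v0]

abbreviation (input) Q where "Q \<equiv> doubling n P (base_facet P v0)"
abbreviation (input) \<delta> :: lvec where "\<delta> \<equiv> Poly_Mapping.single n 1"

lemma Q_eq: "Q = {x + Poly_Mapping.single n s | x s. x \<in> P \<and> 0 \<le> s \<and> s \<le> lin_ext h x - real_of_int b}"
  unfolding doubling_def col_form_facet_form[OF P v0] col_form_facet_min[OF P v0] ..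

lemma h_add_single [simp]: "h (x + Poly_Mapping.single n k) = h x"
  by (rule additive_single_0) (use h in auto)

lemma lat_pts_Q:
  "y \<in> lat_pts Q \<longleftrightarrow> (\<exists>x k. y = x + Poly_Mapping.single n k \<and> x \<in> lat_pts P \<and> 0 \<le> k \<and> k \<le> h x - b)"
proof
  assume "y \<in> lat_pts Q"
  then obtain x s where x: "rv y = x + Poly_Mapping.single n s" "x \<in> P" "0 \<le> s" "s \<le> lin_ext h x - b"
    unfolding lat_pts_def Q_eq by blast
  have kx: "Poly_Mapping.lookup x n = 0"
    using lattice_polytope_keys[OF P x(2)] by (auto simp: in_keys_iff subset_iff)
  have s: "s = real_of_int (Poly_Mapping.lookup y n)"
    using arg_cong[OF x(1), of "\<lambda>z. Poly_Mapping.lookup z n"] kx by (simp add: lookup_add)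
  let ?x = "y - Poly_Mapping.single n (Poly_Mapping.lookup y n)"
  have rx: "rv ?x = x" using x(1) s by (simp add: rv_diff rv_single)
  have "real_of_int (h ?x) = lin_ext h x" using rx lin_ext_rv[OF h(1), of ?x] by simp
  then have "real_of_int (Poly_Mapping.lookup y n) \<le> real_of_int (h ?x - b)" "0 \<le> real_of_int (Poly_Mapping.lookup y n)"
    using x s by auto
  then have "Poly_Mapping.lookup y n \<le> h ?x - b" "0 \<le> Poly_Mapping.lookup y n"
    by (simp_all only: of_int_le_iff of_int_0_le_iff)
  moreover have "?x \<in> lat_pts P" using rx x(2) by (simp add: lat_pts_def)
  ultimately show "\<exists>x k. y = x + Poly_Mapping.single n k \<and> x \<in> lat_pts P \<and> 0 \<le> k \<and> k \<le> h x - b"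
    by (intro exI[of _ ?x] exI[of _ "Poly_Mapping.lookup y n"]) simp
next
  assume "\<exists>x k. y = x + Poly_Mapping.single n k \<and> x \<in> lat_pts P \<and> 0 \<le> k \<and> k \<le> h x - b"
  then obtain x k where "y = x + Poly_Mapping.single n k" "x \<in> lat_pts P" "0 \<le> k" "k \<le> h x - b" by blast
  then show "y \<in> lat_pts Q"
    unfolding lat_pts_def Q_eq by (auto simp: rv_add rv_single lin_ext_rv[OF h(1)] intro!: exI[of _ "rv x"])
qed

lemma lat_pts_Q_iff:
  assumes "x \<in> Zn n"
  shows "x + Poly_Mapping.single n k \<in> lat_pts Q \<longleftrightarrow> x \<in> lat_pts P \<and> 0 \<le> k \<and> k \<le> h x - b"
  using assms lat_pts_subset_Zn[OF P] unfolding lat_pts_Q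
  by (metis Zn_add_single_eq_iff subsetD)

lemma lat_pts_P_Q: "lat_pts P \<subseteq> lat_pts Q"
  using lat_pts_Q_iff[of _ 0] lat_pts_subset_Zn[OF P] h(6) by auto

lemma P_subset_Q: "P \<subseteq> Q"
  unfolding Q_eq using lin_ext_ge[OF P h(1) h(6)] by (fastforce intro: exI[of _ 0])

lemma convex_Q: "convex Q"
proof (rule convexI)
  fix y z and s t :: real assume yz: "y \<in> Q" "z \<in> Q" and st: "0 \<le> s" "0 \<le> t" "s + t = 1"
  obtain x a where y: "y = x + Poly_Mapping.single n a" "x \<in> P" "0 \<le> a" "a \<le> lin_ext h x - b"
    using yz(1) unfolding Q_eq by blast
  obtain x' a' where z: "z = x' + Poly_Mapping.single n a'" "x' \<in> P" "0 \<le> a'" "a' \<le> lin_ext h x' - b"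
    using yz(2) unfolding Q_eq by blast
  have "s *\<^sub>R y + t *\<^sub>R z = (s *\<^sub>R x + t *\<^sub>R x') + Poly_Mapping.single n (s * a + t * a')"
    by (rule poly_mapping_eqI) (simp add: y z lookup_add lookup_single when_def algebra_simps)
  moreover have "s *\<^sub>R x + t *\<^sub>R x' \<in> P"
    using lattice_polytope_convex[OF P] y z st by (intro convexD)
  moreover have "s * a + t * a' \<le> lin_ext h (s *\<^sub>R x + t *\<^sub>R x') - b"
  proof -
    have "s * a + t * a' \<le> s * (lin_ext h x - b) + t * (lin_ext h x' - b)"
      using y z st by (intro add_mono mult_left_mono)
    also have "\<dots> = s * lin_ext h x + t * lin_ext h x' - (s + t) * b" by (simp add: algebra_simps)
    finally show ?thesis using st by (simp add: lin_ext_add lin_ext_scaleR)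
  qed
  moreover have "0 \<le> s * a + t * a'" using y z st by simp
  ultimately show "s *\<^sub>R y + t *\<^sub>R z \<in> Q" unfolding Q_eq by blast
qed

text \<open>The height is affine, so the lid over \<open>P\<close> is the hull of the lid points
  over the generators; every fibre is a segment from \<open>P\<close> to the lid.\<close>

lemma Q_convex_hull: "\<exists>S. finite S \<and> S \<subseteq> Zn (Suc n) \<and> Q = convex hull (rv ` S)"
proof -
  obtain S where S: "finite S" "S \<subseteq> Zn n" "P = convex hull (rv ` S)" "S \<subseteq> lat_pts P"
    using P by (rule lattice_polytopeE)
  define T where "T = S \<union> (\<lambda>x. x + Poly_Mapping.single n (h x - b)) ` S"
  define C where "C = convex hull (rv ` T)"
  define top where "top x = x + Poly_Mapping.single n (lin_ext h x - b)" for x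
  have "T \<subseteq> Zn (Suc n)" using S(2) Zn_mono[of n "Suc n"] by (auto simp: T_def intro: Zn_Suc_add_single)
  moreover have "finite T" using S by (simp add: T_def)
  moreover have "Q = C"
  proof
    have "x + Poly_Mapping.single n (h x - b) \<in> lat_pts Q" if "x \<in> S" for x
    proof -
      have "x \<in> Zn n" "x \<in> lat_pts P" using that S(2,4) by auto
      then show ?thesis using h(6)[of x] lat_pts_Q_iff[of x "h x - b"] by simp
    qed
    then have "T \<subseteq> lat_pts Q" using S(4) lat_pts_P_Q by (auto simp: T_def)
    then show "C \<subseteq> Q" unfolding C_def using convex_Q by (intro hull_minimal) (auto simp: lat_pts_def)
    have PC: "P \<subseteq> C" unfolding S(3) C_def by (intro hull_mono) (auto simp: T_def)
    have C: "convex C" unfolding C_def by simp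
    have "P \<subseteq> {x. top x \<in> C}" unfolding S(3)
    proof (rule hull_minimal)
      have "top (rv x) \<in> rv ` T" if "x \<in> S" for x
        unfolding top_def lin_ext_rv[OF h(1)]
        using that by (intro image_eqI[of _ _ "x + Poly_Mapping.single n (h x - b)"]) (auto simp: T_def rv_add rv_single)
      then show "rv ` S \<subseteq> {x. top x \<in> C}" by (auto simp: C_def intro: hull_inc)
      show "convex {x. top x \<in> C}"
      proof (rule convexI)
        fix x y and s t :: real assume *: "x \<in> {x. top x \<in> C}" "y \<in> {x. top x \<in> C}" "0 \<le> s" "0 \<le> t" "s + t = 1"
        have "lin_ext h (s *\<^sub>R x + t *\<^sub>R y) - (s + t) * b = s * (lin_ext h x - b) + t * (lin_ext h y - b)"
          by (simp add: lin_ext_add lin_ext_scaleR algebra_simps)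
        then have "top (s *\<^sub>R x + t *\<^sub>R y) = s *\<^sub>R top x + t *\<^sub>R top y"
          unfolding top_def using *(5)
          by (intro poly_mapping_eqI) (simp add: lookup_add lookup_single when_def algebra_simps)
        then show "s *\<^sub>R x + t *\<^sub>R y \<in> {x. top x \<in> C}" using * C by (auto intro: convexD)
      qed
    qed
    then have top: "top x \<in> C" if "x \<in> P" for x using that by blast
    show "Q \<subseteq> C"
    proof
      fix y assume "y \<in> Q"
      then obtain x s where y: "y = x + Poly_Mapping.single n s" "x \<in> P" "0 \<le> s" "s \<le> lin_ext h x - b"
        unfolding Q_eq by blast
      show "y \<in> C"
      \<comment> \<open>Over the facet the fibre is a single point, and the ratio
        \<open>q = s / m\<close> would divide by zero.\<close>
      proof (cases "lin_ext h x - b = 0")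
        case True
        then show ?thesis using y PC by auto
      next
        case False
        define m where "m = lin_ext h x - b"
        define q where "q = s / m"
        have m: "m > 0" using False y unfolding m_def by linarith
        then have q: "s = q * m" "0 \<le> q" "q \<le> 1" using y(3,4) unfolding q_def by (auto simp: m_def)
        have "y = (1 - q) *\<^sub>R x + q *\<^sub>R top x"
          unfolding y(1) top_def m_def[symmetric] q(1)
          by (intro poly_mapping_eqI) (simp add: lookup_add lookup_single when_def algebra_simps)
        then show ?thesis using C PC top[OF y(2)] y q by (auto intro!: convexD)
      qed
    qed
  qed
  ultimately show ?thesis unfolding C_def by blast
qed

lemma lattice_polytope_Q: "lattice_polytope (Suc n) Q"
  unfolding lattice_polytope_def
proof (intro conjI Q_convex_hull)
  \<comment> \<open>Over a point of height 1 the fibre has the two lattice points \<open>z\<close>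
    and \<open>z + \<delta>\<close>, so the new unit vector is a difference of lattice points. This
    gives both the extra dimension and the full lattice.\<close>
  obtain z where z: "z \<in> lat_pts P" "h z = b + 1" using col_form_ex_height_1[OF P v0] by blast
  then have zQ: "z + \<delta> \<in> lat_pts Q" "z \<in> lat_pts Q"
    using lat_pts_subset_Zn[OF P] lat_pts_P_Q by (auto simp: lat_pts_Q_iff)
  show "Q \<noteq> {}" using zQ by (auto simp: lat_pts_def)
  show "affdim Q = Suc n"
  proof -
    let ?d = "Poly_Mapping.single n (1::real)"
    have "?d = rv (z + \<delta>) - rv z" by (simp add: rv_add rv_single)
    then have "?d \<in> diffs Q" using zQ unfolding lat_pts_def by blast
    then have "insert ?d (diffs P) \<subseteq> diffs Q" using P_subset_Q by blast
    moreover have "diffs Q \<subseteq> span (insert ?d (diffs P))"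
    proof clarify
      fix y y' assume "y \<in> Q" "y' \<in> Q"
      then obtain x s x' s' where *: "y = x + Poly_Mapping.single n s" "x \<in> P"
          "y' = x' + Poly_Mapping.single n s'" "x' \<in> P" unfolding Q_eq by blast
      have "y - y' = (x - x') + (s - s') *\<^sub>R ?d"
        by (rule poly_mapping_eqI) (simp add: * lookup_add lookup_minus lookup_single when_def)
      also have "\<dots> \<in> span (insert ?d (diffs P))"
        by (intro span_add span_scale span_base) (use * in auto)
      finally show "y - y' \<in> span (insert ?d (diffs P))" .
    qed
    ultimately have "span (diffs Q) = span (insert ?d (diffs P))"
      by (intro subset_antisym span_minimal span_mono subspace_span)
    then have "dim (diffs Q) = dim (insert ?d (diffs P))" by (rule span_eq_dim)
    also have "\<dots> = Suc (dim (diffs P))"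
    proof (rule dim_insert_nspan)
      let ?T = "(\<lambda>i. Poly_Mapping.single i (1::real)) ` {..<n}"
      have dP: "Poly_Mapping.keys x \<subseteq> {..<n}" if "x \<in> diffs P" for x
        using that keys_diff lattice_polytope_keys[OF P] by fast
      have "Poly_Mapping.lookup x n = 0" if "x \<in> span (diffs P)" for x
        using that
      proof (rule span_induct)
        show "subspace {x :: rvec. Poly_Mapping.lookup x n = 0}"
          by (auto simp: subspace_def lookup_add)
      qed (use dP in \<open>auto simp: in_keys_iff subset_iff\<close>)
      from this[of ?d] show "?d \<notin> span (diffs P)" by auto
      show "diffs P \<subseteq> span ?T" using dP keys_subset_imp_span by blast
    qed auto
    also have "dim (diffs P) = n" using P by (simp add: lattice_polytope_def affdim_def)
    finally show ?thesis by (simp add: affdim_def)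
  qed
  show "affine_lattice hull lat_pts Q = Zn (Suc n)"
  proof (rule affine_lattice_hull_eqI)
    show "lat_pts Q \<subseteq> Zn (Suc n)"
    proof
      fix y assume "y \<in> lat_pts Q"
      then obtain x k where "y = x + Poly_Mapping.single n k" "x \<in> lat_pts P" unfolding lat_pts_Q by blast
      then show "y \<in> Zn (Suc n)" using lat_pts_subset_Zn[OF P] by (auto intro: Zn_Suc_add_single)
    qed
    fix M assume M: "affine_lattice M" "lat_pts Q \<subseteq> M"
    have ZM: "x \<in> M" if "x \<in> Zn n" for x
      by (rule lattice_polytope_induct[OF P _ _ that])
        (use M lat_pts_P_Q in \<open>auto intro: affine_latticeD\<close>)
    have d: "\<delta> \<in> M"
      using affine_latticeD[OF M(1), of "z + \<delta>" z 0] ZM[of 0] zQ M(2) by auto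
    have "x + Poly_Mapping.single n k \<in> M" if x: "x \<in> Zn n" for x k
    proof (induction k rule: int_induct[of _ 0])
      case base
      then show ?case using ZM[OF x] by simp
    next
      case (step1 i)
      have "\<delta> - 0 + (x + Poly_Mapping.single n i) \<in> M"
        using step1 d ZM[of 0] by (intro affine_latticeD[OF M(1)]) auto
      then show ?case by (simp add: single_add add_ac)
    next
      case (step2 i)
      have "(x + Poly_Mapping.single n i) - \<delta> + 0 \<in> M"
        using step2 d ZM[of 0] by (intro affine_latticeD[OF M(1)]) auto
      moreover have "x + Poly_Mapping.single n (i - 1) = (x + Poly_Mapping.single n i) - \<delta> + 0"
        by (simp add: single_diff)
      ultimately show ?case by (simp only:)
    qed
    then show "Zn (Suc n) \<subseteq> M" by (metis Zn_Suc_cases subsetI)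
  qed
qed

text \<open>The base facet is the bottom, the copy of \<open>P\<close> itself.\<close>

lemma col_form_minus_delta: "col_form (Suc n) Q (- \<delta>) (\<lambda>y. Poly_Mapping.lookup y n) 0"
  unfolding col_form_def
proof (intro conjI ballI impI allI)
  show "- \<delta> \<in> Zn (Suc n)" using Zn_diff[of 0 "Suc n" \<delta>] by simp
  fix y assume y: "y \<in> lat_pts Q"
  then obtain x k where x: "y = x + Poly_Mapping.single n k" "x \<in> lat_pts P" "0 \<le> k" "k \<le> h x - b"
    unfolding lat_pts_Q by blast
  then have xZ: "x \<in> Zn n" using lat_pts_subset_Zn[OF P] by blast
  then show "0 \<le> Poly_Mapping.lookup y n" using x by (simp add: lookup_add)
  assume "0 < Poly_Mapping.lookup y n"
  then have "0 < k" using x xZ by (simp add: lookup_add)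
  then have "x + Poly_Mapping.single n (k - 1) \<in> lat_pts Q" using x lat_pts_Q_iff[OF xZ] by simp
  moreover have "- \<delta> + y = x + Poly_Mapping.single n (k - 1)" by (simp add: x single_diff)
  ultimately show "- \<delta> + y \<in> lat_pts Q" by (simp only:)
qed (auto simp: additive_lookup lookup_single)

text \<open>The base facet is the lid, which meets \<open>P\<close> in the facet doubled along.
  Columns over that facet pass to the lid, and \<open>\<delta>\<close> joins them.\<close>

lemma col_form_slant:
  assumes "v = \<delta> \<or> col_form n P v h b"
  shows "col_form (Suc n) Q v (\<lambda>y. h y - Poly_Mapping.lookup y n) b"
  unfolding col_form_def
proof (intro conjI ballI impI allI)
  show "additive (\<lambda>y. h y - Poly_Mapping.lookup y n)" by (rule additive_diff_lookup[OF h(1)])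
  show "v \<in> Zn (Suc n)" using assms col_formD(3)[of n P v h b] Zn_mono[of n "Suc n"] by auto
  show "h v - Poly_Mapping.lookup v n = - 1"
    using assms h(2)[of n] col_formD(3,4)[of n P v h b] by auto
  fix y assume y: "y \<in> lat_pts Q"
  then obtain x k where x: "y = x + Poly_Mapping.single n k" "x \<in> lat_pts P" "0 \<le> k" "k \<le> h x - b"
    unfolding lat_pts_Q by blast
  then have xZ: "x \<in> Zn n" using lat_pts_subset_Zn[OF P] by blast
  then show "b \<le> h y - Poly_Mapping.lookup y n" using x by (simp add: lookup_add)
  assume "b < h y - Poly_Mapping.lookup y n"
  then have k: "k < h x - b" using x xZ by (simp add: lookup_add)
  from assms show "v + y \<in> lat_pts Q"
  proof
    assume v: "v = \<delta>"
    then have "v + y = x + Poly_Mapping.single n (k + 1)" by (simp add: x single_add)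
    moreover have "x + Poly_Mapping.single n (k + 1) \<in> lat_pts Q" using x k lat_pts_Q_iff[OF xZ] by simp
    ultimately show ?thesis by (simp only:)
  next
    assume v: "col_form n P v h b"
    have "v + x \<in> lat_pts P" using col_formD(7)[OF v x(2)] k x(3) by simp
    moreover have "h (v + x) = h x - 1" using additive.add[OF h(1)] col_formD(4)[OF v] by simp
    moreover have "v + x \<in> Zn n" using Zn_add[OF col_formD(3)[OF v] xZ] .
    ultimately have "(v + x) + Poly_Mapping.single n k \<in> lat_pts Q"
      using x k lat_pts_Q_iff[of "v + x"] by simp
    moreover have "v + y = (v + x) + Poly_Mapping.single n k" by (simp add: x add.assoc)
    ultimately show ?thesis by (simp only:)
  qed
qed (use h(2) in \<open>auto simp: lookup_single\<close>)

text \<open>If \<open>h v < 0\<close>, the base facet of \<open>v\<close> is the one doubled along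
  and its form is replaced by the slanted one. Otherwise \<open>v\<close> does not shorten the
  fibres and the form stays. In either case nothing changes on \<open>Zn n\<close>.\<close>

lemma col_form_lift:
  assumes "col_form n P v g c"
  shows "\<exists>g'. col_form (Suc n) Q v g' c \<and> (\<forall>x\<in>Zn n. g' x = g x)"
proof (cases "h v < 0")
  case True
  with col_form_eq[OF P v0 assms] have "g = h" "c = b" by auto
  with assms show ?thesis using col_form_slant[of v] by (intro exI conjI) auto
next
  case False
  note g = col_formD[OF assms]
  have gs: "g (x + Poly_Mapping.single n k) = g x" for x k
    by (rule additive_single_0) (use g in auto)
  have "col_form (Suc n) Q v g c" unfolding col_form_def
  proof (intro conjI ballI impI allI)
    show "v \<in> Zn (Suc n)" using g(3) Zn_mono[of n "Suc n"] by auto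
    fix y assume y: "y \<in> lat_pts Q"
    then obtain x k where x: "y = x + Poly_Mapping.single n k" "x \<in> lat_pts P" "0 \<le> k" "k \<le> h x - b"
      unfolding lat_pts_Q by blast
    then show "c \<le> g y" using g(6) by (simp add: gs)
    assume "c < g y"
    then have "v + x \<in> lat_pts P" using g(7) x by (simp add: gs)
    moreover have "h (v + x) \<ge> h x" using False by (simp add: additive.add[OF h(1)])
    moreover have "v + x \<in> Zn n" using calculation(1) lat_pts_subset_Zn[OF P] by blast
    ultimately have "(v + x) + Poly_Mapping.single n k \<in> lat_pts Q"
      using x lat_pts_Q_iff[of "v + x"] by simp
    moreover have "v + y = (v + x) + Poly_Mapping.single n k" by (simp add: x add.assoc)
    ultimately show "v + y \<in> lat_pts Q" by (simp only:)
  qed (use g in auto)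
  then show ?thesis by auto
qed

text \<open>A nonzero \<open>x\<close> with \<open>h x \<ge> 0\<close> could be added to a point
  above the facet indefinitely, against boundedness.\<close>

lemma zero_or_col_form:
  assumes x: "x \<in> Zn n" "-1 \<le> h x" "\<And>z. z \<in> lat_pts P \<Longrightarrow> b < h z \<Longrightarrow> x + z \<in> lat_pts P"
  shows "x = 0 \<or> col_form n P x h b"
proof (cases "h x = -1")
  case True
  then show ?thesis using x h unfolding col_form_def by auto
next
  case False
  then have hx: "0 \<le> h x" using x by auto
  obtain z where z: "z \<in> lat_pts P" "b < h z" using col_form_ex_gt[OF P v0] by blast
  have "((+) x ^^ k) z \<in> lat_pts P \<and> b < h (((+) x ^^ k) z)" for k
    by (induction k) (use z x hx in \<open>auto simp: additive.add[OF h(1)]\<close>)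
  then show ?thesis using ray_leaves[OF P, of x z] by blast
qed

text \<open>The vector decreases neither the distance to the bottom nor that to the lid. So a point
  off one of them can be moved to the base facet while staying off it, and there a step by
  \<open>- \<delta>\<close> or \<open>\<delta>\<close> inside the polytope rules out both signs of
  \<open>g \<delta>\<close>.\<close>

lemma col_form_Q_third_kind:
  assumes w: "col_form (Suc n) Q (x + Poly_Mapping.single n k) g c" and x: "x \<in> Zn n"
    and k: "0 \<le> k" "k \<le> h x"
  shows "col_form n P x g c"
proof -
  let ?w = "x + Poly_Mapping.single n k"
  note g = col_formD[OF w]
  obtain z where z: "z \<in> lat_pts P" "h z = b + 1" using col_form_ex_height_1[OF P v0] by blast
  have zZ: "z \<in> Zn n" using z lat_pts_subset_Zn[OF P] by blast
  have gd: "g \<delta> = 0"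
  proof (rule ccontr)
    assume "g \<delta> \<noteq> 0"
    then consider "g \<delta> > 0" | "g \<delta> < 0" by linarith
    then show False
    proof cases
      case 1
      have zd: "z + \<delta> \<in> lat_pts Q" using z zZ by (simp add: lat_pts_Q_iff)
      \<comment> \<open>The start lies one above the bottom, hence \<open>y\<close> lies at least
        one above it, and subtracting \<open>\<delta>\<close> stays inside.\<close>
      define y where "y = ((+) ?w ^^ nat (g (z + \<delta>) - c)) (z + \<delta>)"
      have y: "y \<in> lat_pts Q" "g y = c" unfolding y_def using col_form_project[OF w zd] by auto
      have "Poly_Mapping.lookup y n = int (nat (g (z + \<delta>) - c)) * k + 1"
        unfolding y_def lookup_iterate_add using x zZ by (simp add: lookup_add)
      then have yn: "1 \<le> Poly_Mapping.lookup y n" using k by simp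
      obtain x' k' where x': "y = x' + Poly_Mapping.single n k'" "x' \<in> lat_pts P" "0 \<le> k'" "k' \<le> h x' - b"
        using y(1) unfolding lat_pts_Q by blast
      have x'Z: "x' \<in> Zn n" using x' lat_pts_subset_Zn[OF P] by blast
      then have "1 \<le> k'" using yn x' by (simp add: lookup_add)
      then have "x' + Poly_Mapping.single n (k' - 1) \<in> lat_pts Q" using x' lat_pts_Q_iff[OF x'Z] by simp
      moreover have "y - \<delta> = x' + Poly_Mapping.single n (k' - 1)" by (simp add: x' single_diff)
      ultimately have "y - \<delta> \<in> lat_pts Q" by (simp only:)
      from g(6)[OF this] show False using 1 y by (simp add: additive.diff[OF g(1)])
    next
      case 2
      have zQ: "z \<in> lat_pts Q" using z lat_pts_P_Q by blast
      \<comment> \<open>The start lies one below the lid, so \<open>y\<close> leaves room for adding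
        \<open>\<delta>\<close>.\<close>
      define y where "y = ((+) ?w ^^ nat (g z - c)) z"
      have y: "y \<in> lat_pts Q" "g y = c" unfolding y_def using col_form_project[OF w zQ] by auto
      have "h y - Poly_Mapping.lookup y n = int (nat (g z - c)) * (h x - k) + (b + 1)"
        unfolding y_def lookup_iterate_add additive_mult_nat[OF h(1)]
        using x zZ z by (simp add: lookup_add algebra_simps)
      then have yn: "b + 1 \<le> h y - Poly_Mapping.lookup y n" using k by simp
      obtain x' k' where x': "y = x' + Poly_Mapping.single n k'" "x' \<in> lat_pts P" "0 \<le> k'" "k' \<le> h x' - b"
        using y(1) unfolding lat_pts_Q by blast
      have x'Z: "x' \<in> Zn n" using x' lat_pts_subset_Zn[OF P] by blast
      then have "k' + 1 \<le> h x' - b" using yn x' by (simp add: lookup_add)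
      then have "x' + Poly_Mapping.single n (k' + 1) \<in> lat_pts Q" using x' lat_pts_Q_iff[OF x'Z] by simp
      then have "y + \<delta> \<in> lat_pts Q" by (simp add: x' single_add add.assoc)
      from g(6)[OF this] show False using 2 y by (simp add: additive.add[OF g(1)])
    qed
  qed
  have gs: "g (z + Poly_Mapping.single n k) = g z" for z k
    by (rule additive_single_0[OF g(1) gd])
  show ?thesis unfolding col_form_def
  proof (intro conjI ballI impI allI)
    show "g x = -1" using g(4) by (simp add: gs)
    show "g (Poly_Mapping.single i 1) = 0" if "n \<le> i" for i
      using gd g(2)[of i] that by (cases "i = n") auto
    fix z assume z: "z \<in> lat_pts P"
    then have zQ: "z \<in> lat_pts Q" using lat_pts_P_Q by blast
    then show "c \<le> g z" by (rule g(6))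
    assume "c < g z"
    then have "?w + z \<in> lat_pts Q" using g(7)[OF zQ] by simp
    then have "(x + z) + Poly_Mapping.single n k \<in> lat_pts Q" by (simp add: add_ac)
    then show "x + z \<in> lat_pts P"
      using lat_pts_Q_iff Zn_add[OF x] z lat_pts_subset_Zn[OF P] by blast
  qed (use g(1) x in auto)
qed

text \<open>Columns of a doubling are classified by the signs of their components towards bottom and
  lid. The numbers \<open>k\<close> and \<open>h x - k\<close> are the values of the two new facet
  forms at \<open>w\<close>; balancedness of the doubling rests on their bounds.\<close>

lemma col_form_Q_cases:
  assumes w: "col_form (Suc n) Q w g c"
    and bal: "\<And>u v f g a c. col_form n P u f a \<Longrightarrow> col_form n P v g c \<Longrightarrow> f v \<le> 1"
  obtains x k where "w = x + Poly_Mapping.single n k" "x \<in> Zn n" "x = 0 \<or> (\<exists>f a. col_form n P x f a)"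
    "k \<le> 1" "h x - k \<le> 1"
    "g = (\<lambda>y. Poly_Mapping.lookup y n) \<or> g = (\<lambda>y. h y - Poly_Mapping.lookup y n) \<or> (\<exists>u a. col_form n P u g a)"
proof -
  note g = col_formD[OF w]
  obtain x k where xk: "w = x + Poly_Mapping.single n k" "x \<in> Zn n" using g(3) by (rule Zn_Suc_cases)
  have wn: "Poly_Mapping.lookup w n = k" using xk by (simp add: lookup_add)
  have hw: "h w = h x" using xk by simp
  have h0: "h 0 = 0" using h(1) by (rule additive.zero)
  obtain z0 where z0: "z0 \<in> lat_pts P" "b < h z0" using col_form_ex_gt[OF P v0] by blast
  have add: "w + (z + Poly_Mapping.single n l) = (x + z) + Poly_Mapping.single n (k + l)" for z l
    by (simp add: xk single_add add_ac)
  consider "k < 0" | "h x - k < 0" | "0 \<le> k" "k \<le> h x" by linarith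
  then show thesis
  proof cases
    case 1
    then have gc: "g = (\<lambda>y. Poly_Mapping.lookup y n)" "c = 0"
      using col_form_eq[OF lattice_polytope_Q col_form_minus_delta w] wn by auto
    then have k: "k = -1" using g(4) wn by simp
    have *: "x + z \<in> lat_pts P \<and> -1 \<le> h x" if z: "z \<in> lat_pts P" "b < h z" for z
    proof -
      have zZ: "z \<in> Zn n" using z lat_pts_subset_Zn[OF P] by blast
      \<comment> \<open>The highest point over \<open>z\<close> tells most: one step down must still
        fit under the lid over \<open>x + z\<close>, whence \<open>h x \<ge> -1\<close>.\<close>
      have "z + Poly_Mapping.single n (h z - b) \<in> lat_pts Q" using z by (simp add: lat_pts_Q_iff[OF zZ])
      from g(7)[OF this] have "w + (z + Poly_Mapping.single n (h z - b)) \<in> lat_pts Q"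
        using z zZ by (simp add: gc lookup_add)
      then show ?thesis unfolding add using lat_pts_Q_iff[OF Zn_add[OF xk(2) zZ]] k
        by (auto simp: additive.add[OF h(1)])
    qed
    then have "x = 0 \<or> col_form n P x h b" using zero_or_col_form[OF xk(2)] z0 by blast
    then show thesis using k gc xk h0 col_formD(4)[of n P x h b] by (intro that[of x k]) auto
  next
    case 2
    then have gc: "g = (\<lambda>y. h y - Poly_Mapping.lookup y n)" "c = b"
      using col_form_eq[OF lattice_polytope_Q col_form_slant[of \<delta>] w] wn hw by auto
    then have k: "h x - k = -1" using g(4) wn hw by simp
    have *: "x + z \<in> lat_pts P \<and> 0 \<le> k" if z: "z \<in> lat_pts P" "b < h z" for z
    proof -
      have zZ: "z \<in> Zn n" using z lat_pts_subset_Zn[OF P] by blast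
      \<comment> \<open>Here the lowest point over \<open>z\<close> is used: after the shift its
        last coordinate is \<open>k\<close>, which must be nonnegative.\<close>
      have "z \<in> lat_pts Q" using z lat_pts_P_Q by blast
      from g(7)[OF this] have "w + (z + Poly_Mapping.single n 0) \<in> lat_pts Q"
        using z zZ by (simp add: gc)
      then show ?thesis unfolding add using lat_pts_Q_iff[OF Zn_add[OF xk(2) zZ]] by simp
    qed
    then have "-1 \<le> h x" using z0 k by fastforce
    then have "x = 0 \<or> col_form n P x h b" using zero_or_col_form[OF xk(2)] * by blast
    then show thesis using k gc xk h0 col_formD(4)[of n P x h b] by (intro that[of x k]) auto
  next
    case 3
    then have "col_form n P x g c" using col_form_Q_third_kind w xk by simp
    moreover from this have "h x \<le> 1" using bal[OF v0] by blast
    ultimately show thesis using 3 xk by (intro that[of x k]) auto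
  qed
qed

end

lemma balanced_iff:
  assumes P: "lattice_polytope n P"
  shows "balanced n P \<longleftrightarrow> (\<forall>u v f g a c. col_form n P u f a \<longrightarrow> col_form n P v g c \<longrightarrow> f v \<le> 1)"
proof
  assume *: "balanced n P"
  show "\<forall>u v f g a c. col_form n P u f a \<longrightarrow> col_form n P v g c \<longrightarrow> f v \<le> 1"
  proof (intro allI impI)
    fix u v f g a c assume u: "col_form n P u f a" and v: "col_form n P v g c"
    then have "u \<in> Col n P" "v \<in> Col n P" using Col_iff[OF P] by blast+
    then show "f v \<le> 1" using * col_form_facet_form[OF P u] unfolding balanced_def by force
  qed
next
  assume *: "\<forall>u v f g a c. col_form n P u f a \<longrightarrow> col_form n P v g c \<longrightarrow> f v \<le> 1"
  show "balanced n P" unfolding balanced_def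
  proof (intro ballI)
    fix u v assume "u \<in> Col n P" "v \<in> Col n P"
    then obtain f a g c where u: "col_form n P u f a" and v: "col_form n P v g c"
      unfolding Col_iff[OF P] by blast
    then show "facet_form n P (base_facet P u) v \<le> 1" using *[rule_format, OF u v] col_form_facet_form[OF P u] by simp
  qed
qed

text \<open>At \<open>x + k \<delta>\<close> a form belonging to a column takes the value
  \<open>k\<close>, or \<open>h x - k\<close>, or the value at \<open>x\<close> of a form of
  \<open>P\<close>; all are at most 1.\<close>

lemma (in doubling_step) balanced_Q:
  assumes "balanced n P"
  shows "balanced (Suc n) Q"
proof -
  have bal: "f v \<le> 1" if "col_form n P u f a" "col_form n P v g c" for u v f g a c
    using assms that unfolding balanced_iff[OF P] by blast
  show ?thesis unfolding balanced_iff[OF lattice_polytope_Q]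
  proof (intro allI impI)
    fix u v f g a c assume u: "col_form (Suc n) Q u f a" and v: "col_form (Suc n) Q v g c"
    from u have f: "f = (\<lambda>y. Poly_Mapping.lookup y n) \<or> f = (\<lambda>y. h y - Poly_Mapping.lookup y n) \<or> (\<exists>u a. col_form n P u f a)"
      by (rule col_form_Q_cases) (use bal in blast)+
    from v obtain x k where x: "v = x + Poly_Mapping.single n k" "x \<in> Zn n" "x = 0 \<or> (\<exists>f a. col_form n P x f a)"
      "k \<le> 1" "h x - k \<le> 1" by (rule col_form_Q_cases) (use bal in blast)+
    from f show "f v \<le> 1"
    proof (elim disjE exE)
      fix u a assume u: "col_form n P u f a"
      note fD = col_formD[OF u]
      have "f v = f x" unfolding x(1) by (rule additive_single_0) (use fD in auto)
      then show ?thesis using x(3) bal[OF u] additive.zero[OF fD(1)] by auto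
    qed (use x in \<open>auto simp: lookup_add\<close>)
  qed
qed

section \<open>Products of column vectors and doubling spectra\<close>

lemma mem_base_facet:
  assumes P: "lattice_polytope n P" and v: "col_form n P v h b" and "x \<in> lat_pts P"
  shows "rv x \<in> base_facet P v \<longleftrightarrow> h x = b"
  using assms(3) by (simp add: col_form_base_facet[OF P v] lin_ext_rv[OF col_formD(1)[OF v]] lat_pts_def)

lemma col_form_balancedD:
  assumes "lattice_polytope n P" "balanced n P" "col_form n P u f a" "col_form n P v g c"
  shows "f v \<le> 1"
  using assms(2,3,4) unfolding balanced_iff[OF assms(1)] by blast

text \<open>Balancedness leaves heights at most 1. Negative height makes the base facets equal, and
  then a point of height 1 lands on the facet. Height 0 without such a landing would put the base
  facet of \<open>v\<close> inside that of \<open>u\<close>, making \<open>f\<close> a multiple of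
  \<open>g\<close> although \<open>f u = -1\<close> and \<open>g u = 0\<close>.\<close>

lemma prod_exists_iff:
  assumes P: "lattice_polytope n P" and bal: "balanced n P"
    and u: "col_form n P u f a" and v: "col_form n P v g c"
  shows "prod_exists n P u v \<longleftrightarrow> u + v \<noteq> 0 \<and> g u = 1"
proof -
  note f = col_formD[OF u] and g = col_formD[OF v]
  have Col: "u \<in> Col n P" "v \<in> Col n P" using u v Col_iff[OF P] by blast+
  have mem: "rv (x + u) \<in> base_facet P v \<longleftrightarrow> g (x + u) = c" if "x \<in> lat_pts P" "a < f x" for x
    using mem_base_facet[OF P v, of "x + u"] f(7)[OF that] by (simp add: add.commute)
  have "(\<forall>x\<in>lat_pts P. rv x \<notin> base_facet P u \<longrightarrow> rv (x + u) \<notin> base_facet P v)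
    \<longleftrightarrow> (\<forall>x\<in>lat_pts P. a < f x \<longrightarrow> g (x + u) \<noteq> c)"
    using mem mem_base_facet[OF P u] f(6) by (metis order_less_le)
  also have "\<dots> \<longleftrightarrow> g u = 1"
  proof
    assume "g u = 1"
    then show "\<forall>x\<in>lat_pts P. a < f x \<longrightarrow> g (x + u) \<noteq> c"
      using g(6) by (force simp: additive.add[OF g(1)])
  next
    assume *: "\<forall>x\<in>lat_pts P. a < f x \<longrightarrow> g (x + u) \<noteq> c"
    have "\<not> g u < 0"
    proof
      assume "g u < 0"
      then have "f = g" "a = c" using col_form_eq[OF P v u] by auto
      moreover obtain x where "x \<in> lat_pts P" "f x = a + 1" using col_form_ex_height_1[OF P u] by blast
      ultimately show False using * f(4) by (auto simp: additive.add[OF g(1)])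
    qed
    moreover have "g u \<noteq> 0"
    proof
      assume gu: "g u = 0"
      have "f y = a" if y: "y \<in> lat_pts P" "g y = c" for y
      proof (rule ccontr)
        assume "f y \<noteq> a"
        then have "a < f y" using f(6)[OF y(1)] by simp
        then show False using * y gu by (simp add: additive.add[OF g(1)])
      qed
      then obtain m where "\<And>x. x \<in> Zn n \<Longrightarrow> f x = m * g x"
        using col_form_proportional[OF P v f(1) _ f(6)] by blast
      then show False using f(3,4) gu by force
    qed
    moreover have "g u \<le> 1" using col_form_balancedD[OF P bal v u] .
    ultimately show "g u = 1" by linarith
  qed
  finally show ?thesis unfolding prod_exists_def using Col by blast
qed

text \<open>If \<open>f v = 1\<close>, then \<open>u + v\<close> would have height 0 over the base
  facet of \<open>u\<close> and could be added without end. A negative \<open>f v\<close> would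
  identify the base facets and give \<open>g u = -1\<close>. Only 0 remains.\<close>

lemma col_form_prod:
  assumes P: "lattice_polytope n P" and bal: "balanced n P"
    and u: "col_form n P u f a" and v: "col_form n P v g c"
    and uv: "u + v \<noteq> 0" "g u = 1"
  shows "f v = 0" "col_form n P (u + v) f a"
proof -
  note f = col_formD[OF u] and g = col_formD[OF v]
  have step: "(u + v) + x \<in> lat_pts P" if x: "x \<in> lat_pts P" "a < f x" for x
  proof -
    have ux: "u + x \<in> lat_pts P" using f(7) x by blast
    have "c < g (u + x)" using g(6)[OF x(1)] uv by (simp add: additive.add[OF g(1)])
    from g(7)[OF ux this] show ?thesis by (simp add: add_ac)
  qed
  have "\<not> f v < 0" using col_form_eq[OF P u v] uv f(4) by auto
  moreover have "f v \<noteq> 1"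
  proof
    assume "f v = 1"
    then have fuv: "f (u + v) = 0" using f(4) by (simp add: additive.add[OF f(1)])
    obtain z where z: "z \<in> lat_pts P" "a < f z" using col_form_ex_gt[OF P u] by blast
    have "((+) (u + v) ^^ k) z \<in> lat_pts P \<and> a < f (((+) (u + v) ^^ k) z)" for k
      by (induction k) (use z fuv step in \<open>auto simp: additive.add[OF f(1), of "u + v"]\<close>)
    then show False using ray_leaves[OF P uv(1), of z] by blast
  qed
  moreover have "f v \<le> 1" using col_form_balancedD[OF P bal u v] .
  ultimately show "f v = 0" by linarith
  then have "f (u + v) = -1" using f(4) by (simp add: additive.add[OF f(1)])
  then show "col_form n P (u + v) f a"
    using f g(3) step unfolding col_form_def by (auto intro: Zn_add)
qed

section \<open>Doubling spectra: heights and elementary maps independent of the stage\<close>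

locale spectrum =
  fixes n :: nat and \<PP> :: "nat \<Rightarrow> rvec set"
  assumes start: "lattice_polytope n (\<PP> 0)" "balanced n (\<PP> 0)"
    and spec: "doubling_spectrum n \<PP>"
begin

lemma doubling_step_ex:
  assumes "lattice_polytope (n + i) (\<PP> i)"
  shows "\<exists>v h b. doubling_step (n + i) (\<PP> i) v h b \<and> \<PP> (Suc i) = doubling (n + i) (\<PP> i) (base_facet (\<PP> i) v)"
proof -
  obtain v where v: "v \<in> Col (n + i) (\<PP> i)" "\<PP> (Suc i) = doubling (n + i) (\<PP> i) (base_facet (\<PP> i) v)"
    using spec unfolding doubling_spectrum_def by blast
  then obtain h b where "col_form (n + i) (\<PP> i) v h b" using Col_iff[OF assms] by blast
  then show ?thesis using assms v unfolding doubling_step_def by blast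
qed

lemma stage: "lattice_polytope (n + i) (\<PP> i) \<and> balanced (n + i) (\<PP> i)"
proof (induction i)
  case (Suc i)
  then obtain v h b where "doubling_step (n + i) (\<PP> i) v h b" "\<PP> (Suc i) = doubling (n + i) (\<PP> i) (base_facet (\<PP> i) v)"
    using doubling_step_ex by blast
  then show ?case using Suc doubling_step.lattice_polytope_Q doubling_step.balanced_Q by fastforce
qed (use start in auto)

lemmas lattice_polytope = stage[THEN conjunct1]
lemmas balanced = stage[THEN conjunct2]

abbreviation form where "form i \<equiv> col_form (n + i) (\<PP> i)"

lemma Col_form: "v \<in> Col (n + i) (\<PP> i) \<longleftrightarrow> (\<exists>h b. form i v h b)"
  by (rule Col_iff[OF lattice_polytope])

text \<open>Iterates \<open>col_form_lift\<close>: the forms extend each other and the minimum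
  \<open>c\<close> never changes.\<close>

lemma form_mono:
  assumes "form i v g c" "i \<le> k"
  shows "\<exists>g'. form k v g' c \<and> (\<forall>x\<in>Zn (n + i). g' x = g x)"
  using assms(2)
proof (induction k rule: dec_induct)
  case base
  then show ?case using assms by blast
next
  case (step k)
  then obtain g' where g': "form k v g' c" "\<forall>x\<in>Zn (n + i). g' x = g x" by blast
  obtain v0 h b where "doubling_step (n + k) (\<PP> k) v0 h b" "\<PP> (Suc k) = doubling (n + k) (\<PP> k) (base_facet (\<PP> k) v0)"
    using doubling_step_ex[OF lattice_polytope] by blast
  then obtain g'' where "form (Suc k) v g'' c" "\<forall>x\<in>Zn (n + k). g'' x = g' x"
    using doubling_step.col_form_lift[of "n + k" "\<PP> k" v0 h b v g' c] g' by auto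
  moreover have "Zn (n + i) \<subseteq> Zn (n + k)" using step by (intro Zn_mono) auto
  ultimately show ?case using g' by (intro exI[of _ g'']) auto
qed

lemma lat_pts_mono: "i \<le> k \<Longrightarrow> lat_pts (\<PP> i) \<subseteq> lat_pts (\<PP> k)"
proof (induction k rule: dec_induct)
  case (step k)
  obtain v0 h b where "doubling_step (n + k) (\<PP> k) v0 h b" "\<PP> (Suc k) = doubling (n + k) (\<PP> k) (base_facet (\<PP> k) v0)"
    using doubling_step_ex[OF lattice_polytope] by blast
  then show ?case using doubling_step.lat_pts_P_Q step by fastforce
qed simp

lemma S_poly_mono:
  assumes "i \<le> k" shows "S_poly (\<PP> i) \<subseteq> S_poly (\<PP> k)"
proof
  fix x assume "x \<in> S_poly (\<PP> i)"
  then show "x \<in> S_poly (\<PP> k)"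
    by induction (use lat_pts_mono[OF assms] in \<open>auto intro: S_poly.intros\<close>)
qed

lemma S_poly_Zn: "x \<in> S_poly (\<PP> i) \<Longrightarrow> fst x \<in> Zn (n + i)"
  by (induction rule: S_poly.induct) (use lat_pts_subset_Zn[OF lattice_polytope] in \<open>auto intro: Zn_add\<close>)

definition S where "S = (\<Union>i. S_poly (\<PP> i))"

lemma S_finite_stage:
  assumes "finite A" "A \<subseteq> S" shows "\<exists>i. \<forall>k\<ge>i. A \<subseteq> S_poly (\<PP> k)"
  using assms
proof (induction A rule: finite_induct)
  case (insert x A)
  then obtain i j where "\<forall>k\<ge>i. A \<subseteq> S_poly (\<PP> k)" "x \<in> S_poly (\<PP> j)" by (auto simp: S_def)
  show ?case
  proof (intro exI[of _ "max i j"] allI impI)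
    fix k assume "max i j \<le> k"
    then show "insert x A \<subseteq> S_poly (\<PP> k)"
      using \<open>\<forall>k\<ge>i. A \<subseteq> S_poly (\<PP> k)\<close> \<open>x \<in> S_poly (\<PP> j)\<close> S_poly_mono[of j k] by auto
  qed
qed auto

lemma R_spec_iff: "f \<in> R_spec \<PP> \<longleftrightarrow> Poly_Mapping.keys f \<subseteq> S"
proof
  assume "Poly_Mapping.keys f \<subseteq> S"
  then obtain i where "\<forall>k\<ge>i. Poly_Mapping.keys f \<subseteq> S_poly (\<PP> k)"
    using S_finite_stage[OF finite_keys] by blast
  then have "f \<in> R_poly (\<PP> i)" by (simp add: R_poly_def)
  then show "f \<in> R_spec \<PP>" by (auto simp: R_spec_def)
qed (auto simp: R_spec_def R_poly_def S_def)

text \<open>One height function for all stages. The stage must also be large enough for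
  \<open>x\<close>: a form is extended by zero, whereas its lift may be nonzero on later
  coordinates, as happens for the lid of a doubling.\<close>

definition HT :: "lvec \<Rightarrow> lvec \<times> int \<Rightarrow> int" where
  "HT v x = (let k = LEAST k. v \<in> Col (n + k) (\<PP> k) \<and> fst x \<in> Zn (n + k) in ht (n + k) (\<PP> k) v x)"

lemma ht_form: "form k v g c \<Longrightarrow> ht (n + k) (\<PP> k) v x = g (fst x) - snd x * c"
  by (simp add: ht_def col_form_facet_form[OF lattice_polytope] col_form_facet_min[OF lattice_polytope])

text \<open>Uniqueness of the form at stage \<open>k\<close> identifies it with the lift of the form
  at the least stage.\<close>

lemma HT_eq:
  assumes v: "form k v g c" and x: "fst x \<in> Zn (n + k)"
  shows "HT v x = g (fst x) - snd x * c"
proof -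
  let ?Q = "\<lambda>k. v \<in> Col (n + k) (\<PP> k) \<and> fst x \<in> Zn (n + k)"
  have Q: "?Q k" using assms Col_form by blast
  define l where "l = (LEAST k. ?Q k)"
  have l: "?Q l" "l \<le> k" unfolding l_def using LeastI[of ?Q, OF Q] Least_le[of ?Q, OF Q] by auto
  then obtain g' c' where g': "form l v g' c'" using Col_form by blast
  obtain g'' where g'': "form k v g'' c'" "\<forall>x\<in>Zn (n + l). g'' x = g' x"
    using form_mono[OF g' l(2)] by blast
  have "g'' = g" "c' = c" using col_form_unique[OF lattice_polytope v g''(1)] by auto
  then show ?thesis
    unfolding HT_def Let_def l_def[symmetric] using ht_form[OF g'] g'' l by simp
qed

lemma Zn_ex: "\<exists>m. x \<in> Zn m"
  by (intro exI[of _ "Suc (Max (insert 0 (Poly_Mapping.keys x)))"]) (auto simp: Zn_def less_Suc_eq_le)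

lemma Col_spec_stage:
  assumes "v \<in> Col_spec n \<PP>"
  shows "\<exists>i. \<forall>k\<ge>i. \<exists>g c. form k v g c"
proof -
  obtain i g c where "form i v g c" using assms Col_form unfolding Col_spec_def by blast
  then show ?thesis using form_mono by blast
qed

lemma Zn_stage: "\<exists>i. \<forall>k\<ge>i. x \<in> Zn (n + k)"
proof -
  obtain m where "x \<in> Zn m" using Zn_ex by blast
  then have "x \<in> Zn (n + k)" if "k \<ge> m" for k using Zn_mono[of m "n + k"] that by auto
  then show ?thesis by blast
qed

lemma HT_additive:
  assumes "v \<in> Col_spec n \<PP>"
  shows "additive (HT v)"
proof (rule additive.intro)
  fix x y :: "lvec \<times> int"
  obtain i1 i2 i3 where i: "\<forall>k\<ge>i1. \<exists>g c. form k v g c" "\<forall>k\<ge>i2. fst x \<in> Zn (n + k)" "\<forall>k\<ge>i3. fst y \<in> Zn (n + k)"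
    using Col_spec_stage[OF assms] Zn_stage by metis
  define k where "k = Max {i1, i2, i3}"
  have k: "i1 \<le> k" "i2 \<le> k" "i3 \<le> k" by (auto simp: k_def)
  with i obtain g c where g: "form k v g c" and xy: "fst x \<in> Zn (n + k)" "fst y \<in> Zn (n + k)" by blast
  show "HT v (x + y) = HT v x + HT v y"
    using HT_eq[OF g xy(1)] HT_eq[OF g xy(2)] HT_eq[OF g, of "x + y"] Zn_add[OF xy]
    by (simp add: additive.add[OF col_formD(1)[OF g]] algebra_simps)
qed

lemma HT_col:
  assumes "form j u f a" "form j v g c"
  shows "HT v (u, 0) = g u"
  using HT_eq[OF assms(2), of "(u, 0)"] col_formD(3)[OF assms(1)] by simp

lemma HT_self: "v \<in> Col_spec n \<PP> \<Longrightarrow> HT v (v, 0) = -1"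
proof -
  assume "v \<in> Col_spec n \<PP>"
  then obtain j g c where g: "form j v g c" using Col_form unfolding Col_spec_def by blast
  show ?thesis using HT_col[OF g g] col_formD(4)[OF g] by simp
qed

text \<open>Equality of base facets at one stage persists to all later ones, and each
  \<open>x\<close> is compared at a stage that contains it.\<close>

lemma HT_same_facet:
  assumes u: "form j u f a" and v: "form j v g c" and "g u < 0"
  shows "HT u = HT v"
proof
  fix x :: "lvec \<times> int"
  obtain i where i: "\<forall>k\<ge>i. fst x \<in> Zn (n + k)" using Zn_stage by blast
  define k where "k = max i j"
  have x: "fst x \<in> Zn (n + k)" and jk: "j \<le> k" using i by (auto simp: k_def)
  obtain f' where f': "form k u f' a" "\<forall>x\<in>Zn (n + j). f' x = f x" using form_mono[OF u jk] by blast
  obtain g' where g': "form k v g' c" "\<forall>x\<in>Zn (n + j). g' x = g x" using form_mono[OF v jk] by blast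
  have "g' u < 0" using g' assms(3) col_formD(3)[OF u] by simp
  then have "f' = g'" "a = c" using col_form_eq[OF lattice_polytope g'(1) f'(1)] by auto
  then show "HT u x = HT v x" using HT_eq[OF f'(1) x] HT_eq[OF g'(1) x] by simp
qed

text \<open>Heights add up over the generators of the semigroup. A positive total forces a generator
  of positive height, and \<open>v\<close> is added to that one.\<close>

lemma form_S_poly:
  assumes v: "form k v g c" and x: "x \<in> S_poly (\<PP> k)"
  shows "0 \<le> g (fst x) - snd x * c" "0 < g (fst x) - snd x * c \<longrightarrow> (v, 0) + x \<in> S_poly (\<PP> k)"
proof -
  note g = col_formD[OF v]
  have "0 \<le> g (fst x) - snd x * c \<and> (0 < g (fst x) - snd x * c \<longrightarrow> (v, 0) + x \<in> S_poly (\<PP> k))"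
    using x
  proof (induction rule: S_poly.induct)
    case zero
    then show ?case using additive.zero[OF g(1)] by simp
  next
    case (add z s)
    have eq: "g (fst ((z, 1) + s)) - snd ((z, 1) + s) * c = (g z - c) + (g (fst s) - snd s * c)"
      by (simp add: additive.add[OF g(1)] algebra_simps)
    have z: "0 \<le> g z - c" using g(6)[OF add(1)] by simp
    have "(v, 0) + ((z, 1) + s) \<in> S_poly (\<PP> k)" if pos: "0 < (g z - c) + (g (fst s) - snd s * c)"
    proof (cases "0 < g z - c")
      case True
      then have "v + z \<in> lat_pts (\<PP> k)" using g(7)[OF add(1)] by simp
      then have "(v + z, 1) + s \<in> S_poly (\<PP> k)" by (rule S_poly.add) (rule add(2))
      moreover have "(v, 0) + ((z, 1) + s) = (v + z, 1) + s" by (cases s) (simp add: add_ac)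
      ultimately show ?thesis by (simp only:)
    next
      case False
      then have "(v, 0) + s \<in> S_poly (\<PP> k)" using add.IH pos by simp
      then have "(z, 1) + ((v, 0) + s) \<in> S_poly (\<PP> k)" by (rule S_poly.add[OF add(1)])
      moreover have "(v, 0) + ((z, 1) + s) = (z, 1) + ((v, 0) + s)" by (simp add: add_ac)
      ultimately show ?thesis by (simp only:)
    qed
    then show ?case unfolding eq using z add.IH by auto
  qed
  then show "0 \<le> g (fst x) - snd x * c" "0 < g (fst x) - snd x * c \<longrightarrow> (v, 0) + x \<in> S_poly (\<PP> k)" by auto
qed

lemma HT_S:
  assumes v: "v \<in> Col_spec n \<PP>" and x: "x \<in> S"
  shows "0 \<le> HT v x" "0 < HT v x \<Longrightarrow> (v, 0) + x \<in> S"
proof -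
  obtain i1 i2 where i: "\<forall>k\<ge>i1. \<exists>g c. form k v g c" "\<forall>k\<ge>i2. {x} \<subseteq> S_poly (\<PP> k)"
    using Col_spec_stage[OF v] S_finite_stage[of "{x}"] x by auto
  define k where "k = max i1 i2"
  obtain g c where g: "form k v g c" using i(1) unfolding k_def by (meson max.cobounded1)
  have xk: "x \<in> S_poly (\<PP> k)" using i(2) unfolding k_def by auto
  have "HT v x = g (fst x) - snd x * c" by (rule HT_eq[OF g S_poly_Zn[OF xk]])
  then show "0 \<le> HT v x" "0 < HT v x \<Longrightarrow> (v, 0) + x \<in> S"
    using form_S_poly[OF g xk] by (auto simp: S_def)
qed

lemma HT_ex_1:
  assumes v: "v \<in> Col_spec n \<PP>"
  shows "\<exists>x\<in>S. HT v x = 1"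
proof -
  obtain k g c where g: "form k v g c" using Col_form v unfolding Col_spec_def by blast
  obtain z where z: "z \<in> lat_pts (\<PP> k)" "g z = c + 1" using col_form_ex_height_1[OF lattice_polytope g] by blast
  have S: "(z, 1) + 0 \<in> S_poly (\<PP> k)" using z S_poly.intros by blast
  then have "HT v (z, 1) = 1" using HT_eq[OF g S_poly_Zn[OF S]] z by simp
  then show ?thesis using S by (auto simp: S_def)
qed

text \<open>Replaces the stage-dependent heights by \<open>HT\<close>, so that the identities for
  \<open>elem_map\<close> apply on \<open>R_spec\<close>.\<close>

lemma elem_spec_eq:
  assumes v: "v \<in> Col_spec n \<PP>" and f: "f \<in> R_spec \<PP>"
  shows "elem_spec n \<PP> v c f = elem_map (HT v) (v, 0) c f"
proof -
  let ?Q = "\<lambda>i. v \<in> Col (n + i) (\<PP> i) \<and> f \<in> R_poly (\<PP> i)"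
  obtain i1 i2 where i: "\<forall>k\<ge>i1. \<exists>g c. form k v g c" "\<forall>k\<ge>i2. Poly_Mapping.keys f \<subseteq> S_poly (\<PP> k)"
    using Col_spec_stage[OF v] S_finite_stage[of "Poly_Mapping.keys f"] f R_spec_iff by auto
  have "?Q (max i1 i2)"
    using i(1)[rule_format, of "max i1 i2"] i(2)[rule_format, of "max i1 i2"] Col_form unfolding R_poly_def by auto
  define k where "k = (LEAST i. ?Q i)"
  have k: "?Q k" unfolding k_def by (rule LeastI[of ?Q, OF \<open>?Q (max i1 i2)\<close>])
  then obtain g a where g: "form k v g a" using Col_form by blast
  have "elem_spec n \<PP> v c f = elem_poly (n + k) (\<PP> k) v c f"
    using f by (simp add: elem_spec_def k_def Let_def)
  also have "\<dots> = elem_map (ht (n + k) (\<PP> k) v) (v, 0) c f"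
    by (simp add: elem_poly_def elem_map_def)
  also have "\<dots> = elem_map (HT v) (v, 0) c f"
  proof (rule elem_map_cong)
    fix x assume "x \<in> Poly_Mapping.keys f"
    then have "x \<in> S_poly (\<PP> k)" using k unfolding R_poly_def by blast
    then show "ht (n + k) (\<PP> k) v x = HT v x" using HT_eq[OF g S_poly_Zn] ht_form[OF g] by simp
  qed
  finally show ?thesis .
qed

lemma keys_elem_S:
  assumes "v \<in> Col_spec n \<PP>" "Poly_Mapping.keys f \<subseteq> S"
  shows "Poly_Mapping.keys (elem_map (HT v) (v, 0) c f) \<subseteq> S"
  using assms HT_S by (intro keys_elem_subset) (auto simp: HT_additive HT_self)

lemma elem_HT_add:
  assumes v: "v \<in> Col_spec n \<PP>" "Poly_Mapping.keys f \<subseteq> S"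
  shows "elem_map (HT v) (v, 0) c (elem_map (HT v) (v, 0) d f) = elem_map (HT v) (v, 0) (c + d) f"
  using v(2) HT_S[OF v(1)] by (intro elem_elem_add[OF HT_additive[OF v(1)] HT_self[OF v(1)]]) auto

abbreviation BG :: "('r::comm_ring_1 garing \<Rightarrow> 'r garing) monoid" where
  "BG \<equiv> BijGroup (R_spec \<PP>)"

lemma elem_spec_Bij:
  assumes v: "v \<in> Col_spec n \<PP>"
  shows "elem_spec n \<PP> v (c :: 'r::comm_ring_1) \<in> carrier BG"
proof -
  have inv: "elem_spec n \<PP> v c (elem_spec n \<PP> v d f) = f \<and> elem_spec n \<PP> v d f \<in> R_spec \<PP>"
    if f: "f \<in> R_spec \<PP>" and cd: "c + d = 0" for f and c d :: 'r
  proof -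
    have k: "Poly_Mapping.keys f \<subseteq> S" using f R_spec_iff by blast
    then have "elem_map (HT v) (v, 0) d f \<in> R_spec \<PP>" using keys_elem_S[OF v] R_spec_iff by blast
    then show ?thesis using f elem_HT_add[OF v k, of c d] cd by (simp add: elem_spec_eq[OF v])
  qed
  have "bij_betw (elem_spec n \<PP> v c) (R_spec \<PP>) (R_spec \<PP>)"
    by (rule bij_betw_byWitness[where f' = "elem_spec n \<PP> v (- c)"])
      (use inv[of _ c "- c"] inv[of _ "- c" c] in auto)
  moreover have "elem_spec n \<PP> v c \<in> extensional (R_spec \<PP>)" by (simp add: elem_spec_def)
  ultimately show ?thesis by (simp add: BijGroup_def Bij_def)
qed

end

section \<open>Rigid graphs\<close>

text \<open>A nonempty walk determines its end points, so paths can be handled through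
  \<open>hd\<close> and \<open>last\<close>.\<close>

lemma dipath_iff:
  "p \<in> dipaths G \<longleftrightarrow> p \<noteq> [] \<and> pre_digraph.awalk G (tail G (hd p)) p (head G (last p))"
proof
  assume "p \<in> dipaths G"
  then obtain u w where p: "p \<noteq> []" "pre_digraph.awalk G u p w" unfolding dipaths_def by blast
  have "\<And>u. pre_digraph.cas G u p w \<Longrightarrow> u = tail G (hd p) \<and> w = head G (last p)"
    using p(1)
  proof (induction p)
    case (Cons e p)
    then show ?case by (cases p) (auto simp: pre_digraph.cas.simps)
  qed simp
  then show "p \<noteq> [] \<and> pre_digraph.awalk G (tail G (hd p)) p (head G (last p))"
    using p unfolding pre_digraph.awalk_def by blast
qed (auto simp: dipaths_def)

locale rigid_digraph =
  fixes G :: "('a, 'b) pre_digraph"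
  assumes rigid: "rigid_graph G"
begin

sublocale digraph G
  using rigid by (simp add: rigid_graph_def)

lemma dipathD: "p \<in> dipaths G \<Longrightarrow> awalk (tail G (hd p)) p (head G (last p))"
  by (simp add: dipath_iff)

lemma dipath_append:
  assumes "p \<in> dipaths G" "q \<in> dipaths G"
  shows "p @ q \<in> dipaths G \<longleftrightarrow> head G (last p) = tail G (hd q)"
proof
  assume "p @ q \<in> dipaths G"
  then have "awalk (tail G (hd p)) (p @ q) (head G (last q))"
    using assms by (auto simp: dipath_iff)
  then have "awalk (tail G (hd p)) p (awlast (tail G (hd p)) p)" "awalk (awlast (tail G (hd p)) p) q (head G (last q))"
    by auto
  then show "head G (last p) = tail G (hd q)"
    using assms awalk_ends dipathD by (metis dipath_iff)
next
  assume "head G (last p) = tail G (hd q)"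
  then show "p @ q \<in> dipaths G"
    using awalk_appendI[of "tail G (hd p)" p "head G (last p)" q "head G (last q)"]
      dipathD[OF assms(1)] dipathD[OF assms(2)] assms by (auto simp: dipath_iff)
qed

lemma dipath_arc: "e \<in> arcs G \<Longrightarrow> [e] \<in> dipaths G"
  by (auto simp: dipath_iff intro: arc_implies_awalk)

lemma dipath_arcs: "p \<in> dipaths G \<Longrightarrow> set p \<subseteq> arcs G"
  by (auto simp: dipath_iff awalk_def)

lemma dipath_hd: "p \<in> dipaths G \<Longrightarrow> p \<noteq> []" "p \<in> dipaths G \<Longrightarrow> hd p \<in> arcs G"
  using dipath_arcs[of p] hd_in_set[of p] by (auto simp only: dipath_iff)

lemma dipath_appendD:
  assumes "p @ q \<in> dipaths G"
  shows "p \<noteq> [] \<Longrightarrow> p \<in> dipaths G" "q \<noteq> [] \<Longrightarrow> q \<in> dipaths G"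
  using assms unfolding dipaths_def mem_Collect_eq awalk_append_iff by blast+

text \<open>A closed walk through an arc \<open>e\<close> could be followed by \<open>e\<close> once more, giving a second
  walk between the ends of \<open>e\<close>.\<close>

lemma no_closed_dipath:
  assumes "p \<in> dipaths G"
  shows "head G (last p) \<noteq> tail G (hd p)"
proof
  assume closed: "head G (last p) = tail G (hd p)"
  let ?e = "hd p"
  have p: "p \<noteq> []" "?e \<in> arcs G" using dipath_hd[OF assms] by auto
  then have "p @ [?e] \<in> dipaths G" using closed dipath_append[OF assms dipath_arc] by simp
  then have "awalk (tail G ?e) (p @ [?e]) (head G ?e)" using p by (simp add: dipath_iff)
  then have "p @ [?e] = [?e]" using rigid p unfolding rigid_graph_def by blast
  then show False using p by simp
qed

lemma arc_le_strict:
  assumes "arc_le G f g" "f \<noteq> g"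
  shows "\<exists>p. f # p @ [g] \<in> dipaths G"
proof -
  obtain q where q: "q \<in> dipaths G" "hd q = f" "last q = g" using assms(1) unfolding arc_le_def by blast
  then obtain q' where q': "q = f # q'" by (cases q) (auto simp: dipath_iff)
  then have "q' \<noteq> []" using q assms(2) by auto
  then have "q = f # butlast q' @ [g]" using q q' by (metis append_butlast_last_id last_ConsR)
  then show ?thesis using q(1) by blast
qed

lemma arc_le_arcs:
  assumes "arc_le G f g" shows "f \<in> arcs G" "g \<in> arcs G"
proof -
  obtain q where q: "q \<in> dipaths G" "hd q = f" "last q = g" using assms unfolding arc_le_def by blast
  then have "q \<noteq> []" by (simp add: dipath_iff)
  then show "f \<in> arcs G" "g \<in> arcs G" using dipath_arcs[OF q(1)] q(2,3) by force+
qed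

lemma arc_le_trans:
  assumes "arc_le G e f" "arc_le G f g" shows "arc_le G e g"
proof (cases "f = g")
  case False
  obtain p where p: "p \<in> dipaths G" "hd p = e" "last p = f" using assms(1) unfolding arc_le_def by blast
  obtain q where q: "f # q @ [g] \<in> dipaths G" using arc_le_strict[OF assms(2) False] by blast
  then have q': "q @ [g] \<in> dipaths G" using dipath_appendD(2)[of "[f]" "q @ [g]"] by simp
  have "f \<in> arcs G" using arc_le_arcs assms by blast
  then have "head G f = tail G (hd (q @ [g]))" using dipath_append[OF dipath_arc q', of f] q by simp
  then have "p @ (q @ [g]) \<in> dipaths G" using p q' dipath_append by simp
  then show ?thesis using p unfolding arc_le_def
    by (intro bexI[of _ "p @ q @ [g]"]) (auto simp: dipath_iff)
qed (use assms in simp)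

text \<open>Two paths between distinct arcs in opposite directions join to a closed path.\<close>

lemma arc_le_antisym:
  assumes "arc_le G e f" "arc_le G f e" shows "e = f"
proof (rule ccontr)
  assume ne: "e \<noteq> f"
  obtain p where p: "e # p @ [f] \<in> dipaths G" using arc_le_strict[OF assms(1) ne] by blast
  obtain q where q: "f # q @ [e] \<in> dipaths G" using arc_le_strict[OF assms(2)] ne by blast
  have q': "q @ [e] \<in> dipaths G" using dipath_appendD(2)[of "[f]" "q @ [e]"] q by simp
  have "f \<in> arcs G" using arc_le_arcs assms by blast
  then have "head G f = tail G (hd (q @ [e]))" using dipath_append[OF dipath_arc q', of f] q by simp
  then have "(e # p @ [f]) @ (q @ [e]) \<in> dipaths G" using dipath_append[OF p q'] by simp
  \<comment> \<open>Dropping the repeated final arc leaves a path from the tail of \<open>e\<close>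
    back to itself.\<close>
  then have "e # (p @ [f] @ q) @ [e] \<in> dipaths G" by simp
  then have "e # (p @ [f] @ q) \<in> dipaths G" "[e] \<in> dipaths G"
      "(e # (p @ [f] @ q)) @ [e] \<in> dipaths G"
    using dipath_appendD[of "e # (p @ [f] @ q)" "[e]"] by auto
  then show False using dipath_append no_closed_dipath[of "e # (p @ [f] @ q)"] by force
qed

text \<open>A strict chain lists distinct arcs; the bound lets a longest chain exist.\<close>

lemma chain_length_le:
  assumes "arc_chain_to G f r"
  shows "r \<le> card (arcs G)"
proof -
  obtain fs where fs: "length fs = r" "set fs \<subseteq> arcs G" "sorted_wrt (\<lambda>g h. arc_le G g h \<and> g \<noteq> h) fs"
    using assms unfolding arc_chain_to_def by blast
  have "distinct fs" using fs(3) by (induction fs) auto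
  then show ?thesis using fs card_mono[OF finite_arcs fs(2)] distinct_card by metis
qed

lemma chain_shorten:
  assumes "arc_chain_to G f r" "1 \<le> s" "s \<le> r"
  shows "arc_chain_to G f s"
proof -
  obtain fs where fs: "length fs = r" "fs \<noteq> []" "last fs = f" "set fs \<subseteq> arcs G"
      "sorted_wrt (\<lambda>g h. arc_le G g h \<and> g \<noteq> h) fs"
    using assms unfolding arc_chain_to_def by blast
  show ?thesis unfolding arc_chain_to_def
    by (rule exI[of _ "drop (r - s) fs"])
      (use fs assms set_drop_subset[of "r - s" fs] in \<open>auto simp: sorted_wrt_drop\<close>)
qed

lemma has_degree_unique:
  assumes "has_degree G f r" "has_degree G f s" shows "r = s"
  using assms chain_shorten[of f r "s + 1"] chain_shorten[of f s "r + 1"]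
  unfolding has_degree_def by (cases r s rule: linorder_cases) auto

lemma has_degree_exists:
  assumes "f \<in> arcs G" shows "\<exists>r\<ge>1. has_degree G f r"
proof -
  have "arc_chain_to G f 1" unfolding arc_chain_to_def by (rule exI[of _ "[f]"]) (use assms in auto)
  then have ex: "\<exists>r. arc_chain_to G f r" by blast
  define r where "r = (GREATEST r. arc_chain_to G f r)"
  have r: "arc_chain_to G f r" unfolding r_def
    using ex chain_length_le by (metis GreatestI_ex_nat)
  have "\<not> arc_chain_to G f (r + 1)"
    using Greatest_le_nat[of "arc_chain_to G f" "r + 1" "card (arcs G)"] chain_length_le unfolding r_def by auto
  moreover have "1 \<le> r" using r unfolding arc_chain_to_def by (auto simp: Suc_le_eq)
  ultimately show ?thesis using r unfolding has_degree_def by blast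
qed

definition deg where "deg f = (THE r. has_degree G f r)"

lemma has_degree_iff: "f \<in> arcs G \<Longrightarrow> has_degree G f r \<longleftrightarrow> r = deg f"
  unfolding deg_def using has_degree_exists has_degree_unique the_equality[of "has_degree G f"] by metis

lemma deg_ge_1: "f \<in> arcs G \<Longrightarrow> 1 \<le> deg f"
  using has_degree_exists[of f] has_degree_iff[of f] by auto

lemma chain_deg: "f \<in> arcs G \<Longrightarrow> arc_chain_to G f (deg f)"
  using has_degree_iff unfolding has_degree_def by blast

lemma chain_le_deg:
  assumes "f \<in> arcs G" "arc_chain_to G f r" shows "r \<le> deg f"
proof (rule ccontr)
  assume "\<not> r \<le> deg f"
  then have "arc_chain_to G f (deg f + 1)" using chain_shorten[OF assms(2)] by simp
  then show False using has_degree_iff[OF assms(1)] unfolding has_degree_def by blast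
qed

lemma chain_replace_last:
  assumes "arc_chain_to G f r" "g \<in> arcs G" "\<And>e. arc_le G e f \<Longrightarrow> e \<noteq> f \<Longrightarrow> arc_le G e g \<and> e \<noteq> g"
  shows "arc_chain_to G g r"
proof -
  obtain fs where fs: "length fs = r" "fs \<noteq> []" "last fs = f" "set fs \<subseteq> arcs G"
      "sorted_wrt (\<lambda>g h. arc_le G g h \<and> g \<noteq> h) fs"
    using assms unfolding arc_chain_to_def by blast
  have eq: "fs = butlast fs @ [f]" using fs by (metis append_butlast_last_id)
  have *: "sorted_wrt (\<lambda>g h. arc_le G g h \<and> g \<noteq> h) (butlast fs @ [f])" using fs(5) eq by simp
  have "sorted_wrt (\<lambda>g h. arc_le G g h \<and> g \<noteq> h) (butlast fs @ [g])"
    using * assms(3) by (auto simp: sorted_wrt_append)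
  then show ?thesis unfolding arc_chain_to_def
    by (intro exI[of _ "butlast fs @ [g]"]) (use fs assms(2) in \<open>auto dest: in_set_butlastD\<close>)
qed

lemma deg_strict_mono:
  assumes "arc_le G f g" "f \<noteq> g" shows "deg f < deg g"
proof -
  have arcs: "f \<in> arcs G" "g \<in> arcs G" using arc_le_arcs assms by auto
  obtain fs where fs: "length fs = deg f" "fs \<noteq> []" "last fs = f" "set fs \<subseteq> arcs G"
      "sorted_wrt (\<lambda>g h. arc_le G g h \<and> g \<noteq> h) fs"
    using chain_deg[OF arcs(1)] unfolding arc_chain_to_def by blast
  have eq: "fs = butlast fs @ [f]" using fs by (metis append_butlast_last_id)
  have *: "sorted_wrt (\<lambda>g h. arc_le G g h \<and> g \<noteq> h) (butlast fs @ [f])" using fs(5) eq by simp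
  have "arc_le G e g \<and> e \<noteq> g" if "e \<in> set fs" for e
  proof (cases "e = f")
    case False
    then have "e \<in> set (butlast fs)" using that eq by (metis UnE empty_iff empty_set insert_iff list.simps(15) set_append)
    then have "arc_le G e f" "e \<noteq> f" using * by (auto simp: sorted_wrt_append)
    then show ?thesis using assms arc_le_trans arc_le_antisym by blast
  qed (use assms in auto)
  then have "sorted_wrt (\<lambda>g h. arc_le G g h \<and> g \<noteq> h) (fs @ [g])"
    using fs(5) by (auto simp: sorted_wrt_append)
  then have "arc_chain_to G g (deg f + 1)"
    unfolding arc_chain_to_def by (intro exI[of _ "fs @ [g]"]) (use fs arcs in auto)
  then show ?thesis using chain_le_deg[OF arcs(2)] by force
qed

text \<open>A strict predecessor of \<open>f\<close> starts a path arriving at the tail of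
  \<open>f\<close>, hence precedes every arc with that tail. A longest chain ending in
  \<open>f\<close> can therefore end in \<open>g\<close> instead. This makes the degree a function
  of path classes.\<close>

lemma deg_tail:
  assumes "f \<in> arcs G" "g \<in> arcs G" "tail G f = tail G g"
  shows "deg f = deg g"
proof -
  have "deg f \<le> deg g" if fg: "f \<in> arcs G" "g \<in> arcs G" "tail G f = tail G g" for f g
  proof (rule chain_le_deg[OF fg(2)], rule chain_replace_last[OF chain_deg[OF fg(1)] fg(2)])
    fix e assume e: "arc_le G e f" "e \<noteq> f"
    obtain p where p: "(e # p) @ [f] \<in> dipaths G" using arc_le_strict[OF e] by auto
    then have ep: "e # p \<in> dipaths G" using dipath_appendD(1)[of "e # p" "[f]"] by simp
    then have "(e # p) @ [g] \<in> dipaths G" using p fg dipath_append[OF ep dipath_arc] by simp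
    moreover have "e \<noteq> g"
    proof
      assume "e = g"
      then show False using no_closed_dipath[OF ep] p fg dipath_append[OF ep dipath_arc[OF fg(1)]] by simp
    qed
    ultimately show "arc_le G e g \<and> e \<noteq> g" unfolding arc_le_def by (metis last_snoc list.sel(1) append_Cons)
  qed
  then show ?thesis using assms by (metis antisym)
qed

text \<open>A degree above 1 comes from a strict predecessor; the connecting path has a last arc
  before \<open>hd p\<close>.\<close>

lemma deg_ge_2_arc_before:
  assumes "p \<in> dipaths G" "2 \<le> deg (hd p)"
  shows "\<exists>f. f \<in> arcs G \<and> head G f = tail G (hd p)"
proof -
  have p: "p \<noteq> []" "hd p \<in> arcs G" using dipath_hd[OF assms(1)] by auto
  obtain fs where fs: "length fs = deg (hd p)" "fs \<noteq> []" "last fs = hd p"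
      "sorted_wrt (\<lambda>g h. arc_le G g h \<and> g \<noteq> h) fs"
    using chain_deg[OF p(2)] unfolding arc_chain_to_def by blast
  have eq: "fs = butlast fs @ [hd p]" using fs by (metis append_butlast_last_id)
  have "length (butlast fs) \<noteq> 0" using fs(1) assms(2) by simp
  then obtain e where "e \<in> set (butlast fs)" by (metis length_0_conv list.set_intros(1) neq_Nil_conv)
  moreover have "sorted_wrt (\<lambda>g h. arc_le G g h \<and> g \<noteq> h) (butlast fs @ [hd p])" using fs(4) eq by simp
  ultimately have "arc_le G e (hd p)" "e \<noteq> hd p" by (auto simp: sorted_wrt_append)
  then obtain q where q: "(e # q) @ [hd p] \<in> dipaths G" using arc_le_strict by fastforce
  then have eq: "e # q \<in> dipaths G" using dipath_appendD(1)[of "e # q" "[hd p]"] by simp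
  then have "head G (last (e # q)) = tail G (hd p)" using q dipath_append[OF eq dipath_arc[OF p(2)]] by simp
  moreover have "last (e # q) \<in> arcs G" using dipath_arcs[OF eq] last_in_set[of "e # q"] by blast
  ultimately show ?thesis by blast
qed

end

section \<open>Iterated semidirect products\<close>

lemma ordered_prod_empty [simp]: "b < a \<Longrightarrow> ordered_prod H f a b = \<one>\<^bsub>H\<^esub>"
  by (simp add: ordered_prod_def)

lemma ordered_prod_Cons:
  "a \<le> b \<Longrightarrow> ordered_prod H f a b = f a \<otimes>\<^bsub>H\<^esub> ordered_prod H f (Suc a) b"
  by (simp add: ordered_prod_def upt_conv_Cons del: upt_Suc)

lemma ordered_prod_cong:
  assumes "\<And>i. i \<in> {a..b} \<Longrightarrow> f i = g i"
  shows "ordered_prod H f a b = ordered_prod H g a b"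
  unfolding ordered_prod_def using assms by (intro foldr_cong) auto

context group
begin

lemma ordered_prod_in_subgroup:
  assumes "subgroup K G" "\<And>i. i \<in> {a..b} \<Longrightarrow> f i \<in> K"
  shows "ordered_prod G f a b \<in> K"
proof (cases "a \<le> b")
  case True
  then show ?thesis using assms(2)
    by (induction rule: inc_induct) (auto simp: ordered_prod_Cons intro!: subgroup.m_closed[OF assms(1)] subgroup.one_closed[OF assms(1)])
qed (use assms in \<open>auto intro: subgroup.one_closed\<close>)

lemmas ordered_prod_closed = ordered_prod_in_subgroup[OF subgroup_self]

lemma commute_ordered_prod:
  assumes "x \<in> carrier G" "\<And>i. i \<in> {a..b} \<Longrightarrow> f i \<in> carrier G"
    "\<And>i. i \<in> {a..b} \<Longrightarrow> x \<otimes> f i = f i \<otimes> x"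
  shows "x \<otimes> ordered_prod G f a b = ordered_prod G f a b \<otimes> x"
proof (cases "a \<le> b")
  case True
  have "x \<otimes> ordered_prod G f c b = ordered_prod G f c b \<otimes> x" if "a \<le> c" "c \<le> Suc b" for c
    using that(2,1)
  proof (induction rule: inc_induct)
    case (step c)
    then have c: "c \<in> {a..b}" "f c \<in> carrier G" "ordered_prod G f (Suc c) b \<in> carrier G"
      using assms by (auto intro: ordered_prod_closed)
    have "x \<otimes> (f c \<otimes> ordered_prod G f (Suc c) b) = (x \<otimes> f c) \<otimes> ordered_prod G f (Suc c) b"
      using c assms(1) by (simp add: m_assoc)
    also have "\<dots> = f c \<otimes> (x \<otimes> ordered_prod G f (Suc c) b)"
      unfolding assms(3)[OF c(1)] using c assms(1) by (simp add: m_assoc)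
    also have "\<dots> = (f c \<otimes> ordered_prod G f (Suc c) b) \<otimes> x" using c assms step by (simp add: m_assoc)
    finally show ?case using step by (simp add: ordered_prod_Cons)
  qed (use assms in simp)
  from this[of a] True show ?thesis by simp
qed (use assms in simp)

lemma ordered_prod_mult:
  assumes f: "\<And>i. i \<in> {a..b} \<Longrightarrow> f i \<in> carrier G" and g: "\<And>i. i \<in> {a..b} \<Longrightarrow> g i \<in> carrier G"
    and comm: "\<And>i j. i \<in> {a..b} \<Longrightarrow> j \<in> {a..b} \<Longrightarrow> g i \<otimes> f j = f j \<otimes> g i"
  shows "ordered_prod G (\<lambda>i. f i \<otimes> g i) a b = ordered_prod G f a b \<otimes> ordered_prod G g a b"
proof (cases "a \<le> b")
  case True
  have "ordered_prod G (\<lambda>i. f i \<otimes> g i) c b = ordered_prod G f c b \<otimes> ordered_prod G g c b"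
    if "a \<le> c" "c \<le> Suc b" for c
    using that(2,1)
  proof (induction rule: inc_induct)
    case (step c)
    let ?F = "ordered_prod G f (Suc c) b" and ?G = "ordered_prod G g (Suc c) b"
    have c: "f c \<in> carrier G" "g c \<in> carrier G" "?F \<in> carrier G" "?G \<in> carrier G"
      using step f g by (auto intro: ordered_prod_closed)
    have "g c \<otimes> ?F = ?F \<otimes> g c"
      using step f g comm by (intro commute_ordered_prod) auto
    then have "(f c \<otimes> g c) \<otimes> (?F \<otimes> ?G) = (f c \<otimes> ?F) \<otimes> (g c \<otimes> ?G)"
      using c by (metis m_assoc m_closed)
    then show ?case using step by (simp add: ordered_prod_Cons)
  qed simp
  from this[of a] True show ?thesis by simp
qed simp

lemma ordered_prod_single:
  assumes "k \<in> {a..b}" "f k \<in> carrier G" "\<And>i. i \<in> {a..b} \<Longrightarrow> i \<noteq> k \<Longrightarrow> f i = \<one>"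
  shows "ordered_prod G f a b = f k"
proof -
  have "ordered_prod G f c b = (if c \<le> k then f k else \<one>)" if "a \<le> c" "c \<le> Suc b" for c
    using that(2,1)
  proof (induction rule: inc_induct)
    case (step c)
    then show ?case using assms by (cases "c = k") (auto simp: ordered_prod_Cons)
  qed (use assms in auto)
  from this[of a] assms(1) show ?thesis by simp
qed

text \<open>Each step splits off one factor. If \<open>a h = a' h'\<close> with \<open>a\<close>,
  \<open>a'\<close> in \<open>A s\<close> and \<open>h\<close>, \<open>h'\<close> in
  \<open>K (Suc s)\<close>, then \<open>inv a' a = h' inv h\<close> lies in the intersection and is
  trivial.\<close>

lemma unique_ordered_prod:
  assumes A: "\<And>s. s \<in> {r..t} \<Longrightarrow> subgroup (A s) G"
    and K: "\<And>s. s \<in> {r..Suc t} \<Longrightarrow> subgroup (K s) G" "K (Suc t) = {\<one>}"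
    and AK: "\<And>s. s \<in> {r..t} \<Longrightarrow> A s \<subseteq> K s" "\<And>s. s \<in> {r..t} \<Longrightarrow> K (Suc s) \<subseteq> K s"
    and dec: "\<And>s x. s \<in> {r..t} \<Longrightarrow> x \<in> K s \<Longrightarrow> \<exists>a\<in>A s. \<exists>h\<in>K (Suc s). x = a \<otimes> h"
    and int: "\<And>s. s \<in> {r..t} \<Longrightarrow> A s \<inter> K (Suc s) \<subseteq> {\<one>}"
    and r: "r \<le> Suc t"
  shows "\<forall>x\<in>K r. \<exists>!f. f \<in> (\<Pi>\<^sub>E s\<in>{r..t}. A s) \<and> x = ordered_prod G f r t"
proof -
  have "\<forall>x\<in>K s. \<exists>!f. f \<in> (\<Pi>\<^sub>E s\<in>{s..t}. A s) \<and> x = ordered_prod G f s t" if "r \<le> s" "s \<le> Suc t" for s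
    using that(2,1)
  proof (induction rule: inc_induct)
    case base
    then show ?case using K(2) by simp
  next
    case (step s)
    then have s: "s \<in> {r..t}" "s \<le> t" "Suc s \<in> {r..Suc t}" by auto
    note As = subgroup.mem_carrier[OF A[OF s(1)]] and Ks = subgroup.mem_carrier[OF K(1)[OF s(3)]]
    have sets: "{s..t} = insert s {Suc s..t}" using s by auto
    have IH: "\<forall>x\<in>K (Suc s). \<exists>!f. f \<in> (\<Pi>\<^sub>E s\<in>{Suc s..t}. A s) \<and> x = ordered_prod G f (Suc s) t"
      using step by auto
    show ?case
    proof
      fix x assume "x \<in> K s"
      then obtain a h where ah: "a \<in> A s" "h \<in> K (Suc s)" "x = a \<otimes> h" using dec[OF s(1)] by blast
      from bspec[OF IH ah(2)]
      obtain f where f: "f \<in> (\<Pi>\<^sub>E s\<in>{Suc s..t}. A s)" "h = ordered_prod G f (Suc s) t"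
        and f': "\<forall>g. g \<in> (\<Pi>\<^sub>E s\<in>{Suc s..t}. A s) \<and> h = ordered_prod G g (Suc s) t \<longrightarrow> g = f"
        by (elim ex1E conjE)
      have f_unique: "g = f" if "g \<in> (\<Pi>\<^sub>E s\<in>{Suc s..t}. A s)" "h = ordered_prod G g (Suc s) t" for g
        using f' that by simp
      show "\<exists>!f. f \<in> (\<Pi>\<^sub>E s\<in>{s..t}. A s) \<and> x = ordered_prod G f s t"
      proof (intro ex1I conjI)
        show "f(s := a) \<in> (\<Pi>\<^sub>E s\<in>{s..t}. A s)" unfolding sets using f(1) ah(1) by (rule PiE_fun_upd[rotated])
        have "ordered_prod G (f(s := a)) (Suc s) t = ordered_prod G f (Suc s) t" by (rule ordered_prod_cong) auto
        then show "x = ordered_prod G (f(s := a)) s t" using s(2) ah f by (simp add: ordered_prod_Cons)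
      next
        fix g assume g: "g \<in> (\<Pi>\<^sub>E s\<in>{s..t}. A s) \<and> x = ordered_prod G g s t"
        let ?g = "ordered_prod G g (Suc s) t"
        have gA: "g i \<in> A i" if "i \<in> {s..t}" for i using g that by auto
        have AKs: "A i \<subseteq> K (Suc s)" if "i \<in> {Suc s..t}" for i
        proof -
          have "K i \<subseteq> K (Suc s)" using that
          proof (induction i rule: nat_induct)
            case (Suc i)
            then show ?case using AK(2)[of i] s by (cases "i = s") fastforce+
          qed simp
          then show ?thesis using AK(1)[of i] that s by auto
        qed
        have gK: "?g \<in> K (Suc s)"
          using gA AKs by (intro ordered_prod_in_subgroup[OF K(1)[OF s(3)]]) (auto simp: subset_iff)
        have gs: "g s \<in> A s" using gA s by auto
        have eq: "a \<otimes> h = g s \<otimes> ?g" using g ah s by (simp add: ordered_prod_Cons)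
        have c: "a \<in> carrier G" "h \<in> carrier G" "g s \<in> carrier G" "?g \<in> carrier G"
          using As Ks ah gs gK by auto
        have "inv (g s) \<otimes> a = inv (g s) \<otimes> ((a \<otimes> h) \<otimes> inv h)" using c by (simp add: m_assoc)
        also have "\<dots> = ?g \<otimes> inv h" unfolding eq using c by (simp add: m_assoc[symmetric])
        finally have ie: "inv (g s) \<otimes> a = ?g \<otimes> inv h" .
        have "inv (g s) \<otimes> a \<in> A s"
          using gs ah A[OF s(1)] by (simp add: subgroup.m_closed subgroup.m_inv_closed)
        moreover have "?g \<otimes> inv h \<in> K (Suc s)"
          using gK ah K(1)[OF s(3)] by (simp add: subgroup.m_closed subgroup.m_inv_closed)
        ultimately have one: "inv (g s) \<otimes> a = \<one>" using int[OF s(1)] ie by auto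
        then have "a = g s" using c by (metis inv_closed inv_inv inv_equality inv_comm)
        have "h = ?g" using one ie c by (metis inv_closed inv_inv inv_equality)
        have "restrict g {Suc s..t} = f"
        proof (rule f_unique)
          show "restrict g {Suc s..t} \<in> (\<Pi>\<^sub>E s\<in>{Suc s..t}. A s)" using gA by auto
          have "ordered_prod G (restrict g {Suc s..t}) (Suc s) t = ?g" by (rule ordered_prod_cong) auto
          then show "h = ordered_prod G (restrict g {Suc s..t}) (Suc s) t" using \<open>h = ?g\<close> by simp
        qed
        note restr = this
        show "g = f(s := a)"
        proof
          fix y
          show "g y = (f(s := a)) y"
            using fun_cong[OF restr, of y] g \<open>a = g s\<close> sets
            by (cases "y \<in> {Suc s..t}") (auto simp: PiE_def extensional_def)
        qed
      qed
    qed
  qed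
  then show ?thesis using r by simp
qed

end

section \<open>Elementary automorphisms as group elements and their relations\<close>

context spectrum
begin

abbreviation EG :: "('r::comm_ring_1 garing \<Rightarrow> 'r garing) monoid" where
  "EG \<equiv> E_group n \<PP>"

abbreviation e where "e \<equiv> elem_spec n \<PP>"

lemma group_EG: "group EG"
  unfolding E_group_def by (rule group.group_subgroup_generated[OF group_BijGroup])

sublocale EG: group "EG :: ('r::comm_ring_1 garing \<Rightarrow> 'r garing) monoid"
  by (rule group_EG)

lemma carrier_EG_Bij: "g \<in> carrier EG \<Longrightarrow> g \<in> Bij (R_spec \<PP>)"
  using group.carrier_subgroup_generated_subset[OF group_BijGroup] unfolding E_group_def
  by (auto simp: BijGroup_def)

lemma EG_mult_apply: "g \<in> carrier EG \<Longrightarrow> h \<in> carrier EG \<Longrightarrow> f \<in> R_spec \<PP> \<Longrightarrow> (g \<otimes>\<^bsub>EG\<^esub> h) f = g (h f)"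
  using carrier_EG_Bij[of g] carrier_EG_Bij[of h]
  by (simp add: E_group_def) (simp add: BijGroup_def compose_def)

lemma EG_one_apply: "f \<in> R_spec \<PP> \<Longrightarrow> \<one>\<^bsub>EG\<^esub> f = f"
  by (simp add: E_group_def BijGroup_def)

lemma EG_apply_closed: "g \<in> carrier EG \<Longrightarrow> f \<in> R_spec \<PP> \<Longrightarrow> g f \<in> R_spec \<PP>"
  using carrier_EG_Bij Bij_imp_funcset by blast

lemma EG_eqI:
  assumes "g \<in> carrier EG" "h \<in> carrier EG" "\<And>f. f \<in> R_spec \<PP> \<Longrightarrow> g f = h f"
  shows "g = h"
  using assms carrier_EG_Bij Bij_imp_extensional by (blast intro: extensionalityI)

lemma e_carrier: "v \<in> Col_spec n \<PP> \<Longrightarrow> e v c \<in> carrier EG"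
  unfolding E_group_def carrier_subgroup_generated
  using elem_spec_Bij by (intro generate.incl) auto

lemma e_add:
  assumes v: "v \<in> Col_spec n \<PP>"
  shows "e v (c :: 'r::comm_ring_1) \<otimes>\<^bsub>EG\<^esub> e v d = e v (c + d)"
proof (rule EG_eqI)
  fix f :: "'r garing" assume f: "f \<in> R_spec \<PP>"
  then show "(e v c \<otimes>\<^bsub>EG\<^esub> e v d) f = e v (c + d) f"
    using EG_apply_closed[OF e_carrier[OF v] f, of d] elem_HT_add[OF v, of f c d]
    by (simp add: EG_mult_apply e_carrier v elem_spec_eq R_spec_iff)
qed (simp_all add: e_carrier v)

lemma e_0: "v \<in> Col_spec n \<PP> \<Longrightarrow> e v 0 = \<one>\<^bsub>EG\<^esub>"
  by (rule EG_eqI) (simp_all add: e_carrier elem_spec_eq EG_one_apply)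

lemma e_inv:
  assumes v: "v \<in> Col_spec n \<PP>"
  shows "inv\<^bsub>EG\<^esub> (e v c) = e v (- c)"
  using e_add[OF v, of "- c" c] e_0[OF v] e_carrier[OF v] by (intro EG.inv_equality) auto

lemma e_commute_height_0:
  assumes u: "u \<in> Col_spec n \<PP>" and v: "v \<in> Col_spec n \<PP>"
    and 0: "HT u (v, 0) = 0" "HT v (u, 0) = 0"
  shows "e u (c :: 'r::comm_ring_1) \<otimes>\<^bsub>EG\<^esub> e v d = e v d \<otimes>\<^bsub>EG\<^esub> e u c"
proof (rule EG_eqI)
  fix f :: "'r garing" assume f: "f \<in> R_spec \<PP>"
  then show "(e u c \<otimes>\<^bsub>EG\<^esub> e v d) f = (e v d \<otimes>\<^bsub>EG\<^esub> e u c) f"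
    using EG_apply_closed[OF e_carrier[OF u] f, of c] EG_apply_closed[OF e_carrier[OF v] f, of d]
      elem_commute_height_0[OF HT_additive[OF u] HT_additive[OF v] 0, of c d f]
    by (simp add: EG_mult_apply e_carrier u v elem_spec_eq)
qed (simp_all add: e_carrier u v)

lemma e_commute_same_facet:
  assumes u: "u \<in> Col_spec n \<PP>" and v: "v \<in> Col_spec n \<PP>" and eq: "HT u = HT v"
  shows "e u (c :: 'r::comm_ring_1) \<otimes>\<^bsub>EG\<^esub> e v d = e v d \<otimes>\<^bsub>EG\<^esub> e u c"
proof (rule EG_eqI)
  fix f :: "'r garing" assume f: "f \<in> R_spec \<PP>"
  then have "Poly_Mapping.keys f \<subseteq> {x. 0 \<le> HT v x}" using HT_S(1)[OF v] by (auto simp: R_spec_iff)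
  moreover have "HT v (u, 0) = -1" using HT_self[OF u] eq by simp
  ultimately show "(e u c \<otimes>\<^bsub>EG\<^esub> e v d) f = (e v d \<otimes>\<^bsub>EG\<^esub> e u c) f"
    using f EG_apply_closed[OF e_carrier[OF u] f, of c] EG_apply_closed[OF e_carrier[OF v] f, of d]
      elem_commute_same_height[OF HT_additive[OF v] HT_self[OF v], of "(u, 0)" f c d]
    by (simp add: EG_mult_apply e_carrier u v elem_spec_eq eq)
qed (simp_all add: e_carrier u v)

lemma e_commutator:
  assumes u: "u \<in> Col_spec n \<PP>" and v: "v \<in> Col_spec n \<PP>" and uv: "u + v \<in> Col_spec n \<PP>"
    and HT: "HT (u + v) = HT u" "HT u (v, 0) = 0" "HT v (u, 0) = 1"
  shows "e v (c :: 'r::comm_ring_1) \<otimes>\<^bsub>EG\<^esub> e u l = e u l \<otimes>\<^bsub>EG\<^esub> e (u + v) (l * c) \<otimes>\<^bsub>EG\<^esub> e v c"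
proof (rule EG_eqI)
  note C = e_carrier[OF u] e_carrier[OF v] e_carrier[OF uv]
  fix f :: "'r garing" assume f: "f \<in> R_spec \<PP>"
  then have "Poly_Mapping.keys f \<subseteq> {x. 0 \<le> HT u x \<and> 0 \<le> HT v x}"
    using HT_S(1)[OF v] HT_S(1)[OF u] by (auto simp: R_spec_iff)
  from elem_commutator[OF HT_additive[OF u] HT_additive[OF v] HT_self[OF u] HT(2) HT_self[OF v] HT(3) this, of c l]
  show "(e v c \<otimes>\<^bsub>EG\<^esub> e u l) f = (e u l \<otimes>\<^bsub>EG\<^esub> e (u + v) (l * c) \<otimes>\<^bsub>EG\<^esub> e v c) f"
    using f EG_apply_closed[OF C(1) f, of l] EG_apply_closed[OF C(2) f, of c]
      EG_apply_closed[OF C(3) EG_apply_closed[OF C(2) f, of c], of "l * c"]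
    by (simp add: EG_mult_apply EG.m_closed C u v uv elem_spec_eq HT)
qed (simp_all add: e_carrier u v uv EG.m_closed)

end

text \<open>Isolates what the group theory needs from rigidity: a degree determined by the base
  facet, and a case distinction in which the column of smaller degree is the left factor of any
  product and passes its degree on.\<close>

locale triangular_system = spectrum +
  fixes W :: "lvec set" and d :: "lvec \<Rightarrow> nat"
  assumes W_Col: "W \<subseteq> Col_spec n \<PP>"
    and same_facet_degree: "\<And>u v. u \<in> W \<Longrightarrow> v \<in> W \<Longrightarrow> HT u = HT v \<Longrightarrow> d u = d v"
    and relation: "\<And>u v. u \<in> W \<Longrightarrow> v \<in> W \<Longrightarrow> d u \<le> d v \<Longrightarrow>
      HT u (v, 0) = 0 \<and> HT v (u, 0) = 0 \<or> HT u = HT v \<or>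
      u + v \<in> W \<and> HT (u + v) = HT u \<and> HT u (v, 0) = 0 \<and> HT v (u, 0) = 1 \<and> d u < d v \<and> d (u + v) = d u"
begin

definition gens :: "lvec set \<Rightarrow> ('r::comm_ring_1 garing \<Rightarrow> 'r garing) set" where
  "gens X = {e v c | v c. v \<in> X}"

abbreviation span_group :: "lvec set \<Rightarrow> ('r::comm_ring_1 garing \<Rightarrow> 'r garing) set" where
  "span_group X \<equiv> generate EG (gens X)"

abbreviation deg_eq where "deg_eq r \<equiv> {v \<in> W. d v = r}"
abbreviation deg_ge where "deg_ge r \<equiv> {v \<in> W. r \<le> d v}"

lemma W_ColD: "v \<in> W \<Longrightarrow> v \<in> Col_spec n \<PP>"
  using W_Col by blast

lemma gens_carrier: "X \<subseteq> W \<Longrightarrow> gens X \<subseteq> carrier EG"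
  unfolding gens_def using e_carrier W_ColD by blast

lemma subgroup_span: "X \<subseteq> W \<Longrightarrow> subgroup (span_group X) EG"
  by (rule EG.generate_is_subgroup[OF gens_carrier])

lemma span_carrier: "X \<subseteq> W \<Longrightarrow> g \<in> span_group X \<Longrightarrow> g \<in> carrier EG"
  using subgroup.mem_carrier[OF subgroup_span] .

lemma span_mono: "X \<subseteq> Y \<Longrightarrow> span_group X \<subseteq> span_group Y"
  by (rule EG.mono_generate) (auto simp: gens_def)

lemma e_span: "v \<in> X \<Longrightarrow> e v c \<in> span_group X"
  by (rule generate.incl) (auto simp: gens_def)

text \<open>Inverses of generators are generators, so inverses need no separate case.\<close>

lemma span_induct [consumes 2, case_names one gen mult]:
  assumes "g \<in> span_group X" "X \<subseteq> W"
    and "Q \<one>\<^bsub>EG\<^esub>" "\<And>v c. v \<in> X \<Longrightarrow> Q (e v c)"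
    and "\<And>g h. g \<in> span_group X \<Longrightarrow> h \<in> span_group X \<Longrightarrow> Q g \<Longrightarrow> Q h \<Longrightarrow> Q (g \<otimes>\<^bsub>EG\<^esub> h)"
  shows "Q g"
  using assms(1)
proof (induction rule: generate.induct)
  case (inv h)
  then obtain v c where v: "h = e v c" "v \<in> X" unfolding gens_def by blast
  then have "inv\<^bsub>EG\<^esub> h = e v (- c)" using assms(2) by (simp add: e_inv W_ColD subsetD)
  then show ?case using assms(4) v by simp
qed (use assms in \<open>auto simp: gens_def\<close>)

text \<open>In the noncommuting case the conjugate is \<open>e u l\<close> times an elementary map
  along \<open>u + w\<close>, which again has degree \<open>r\<close>.\<close>

lemma conj_gen:
  assumes u: "u \<in> deg_eq r" and w: "w \<in> deg_ge (Suc r)"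
  shows "e w c \<otimes>\<^bsub>EG\<^esub> e u l \<otimes>\<^bsub>EG\<^esub> inv\<^bsub>EG\<^esub> (e w c) \<in> span_group (deg_eq r)"
proof -
  have C: "e w c \<in> carrier EG" "e u l \<in> carrier EG" using u w by (auto intro: e_carrier W_ColD)
  have commute: ?thesis if "e w c \<otimes>\<^bsub>EG\<^esub> e u l = e u l \<otimes>\<^bsub>EG\<^esub> e w c"
    using C e_span[OF u] by (simp add: that EG.m_assoc)
  from relation[of u w] u w consider "HT u (w, 0) = 0 \<and> HT w (u, 0) = 0" | "HT u = HT w"
    | "u + w \<in> W \<and> HT (u + w) = HT u \<and> HT u (w, 0) = 0 \<and> HT w (u, 0) = 1 \<and> d (u + w) = d u"
    by fastforce
  then show ?thesis
  proof cases
    case 1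
    then show ?thesis using u w by (intro commute e_commute_height_0) (auto intro: W_ColD)
  next
    case 2
    then show ?thesis using u w by (intro commute e_commute_same_facet) (auto intro: W_ColD)
  next
    case 3
    have uw: "u + w \<in> deg_eq r" using 3 u by simp
    then have C': "e (u + w) (l * c) \<in> carrier EG" by (auto intro: e_carrier W_ColD)
    have "e w c \<otimes>\<^bsub>EG\<^esub> e u l = e u l \<otimes>\<^bsub>EG\<^esub> e (u + w) (l * c) \<otimes>\<^bsub>EG\<^esub> e w c"
      using 3 u w by (intro e_commutator) (auto intro: W_ColD)
    then have "e w c \<otimes>\<^bsub>EG\<^esub> e u l \<otimes>\<^bsub>EG\<^esub> inv\<^bsub>EG\<^esub> (e w c) = e u l \<otimes>\<^bsub>EG\<^esub> e (u + w) (l * c)"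
      using C C' by (simp add: EG.m_assoc)
    then show ?thesis using generate.eng[OF e_span[OF u] e_span[OF uw]] by simp
  qed
qed

lemma conj_mult:
  assumes "x \<in> carrier EG" "g \<in> carrier EG" "h \<in> carrier EG"
  shows "x \<otimes>\<^bsub>EG\<^esub> (g \<otimes>\<^bsub>EG\<^esub> h) \<otimes>\<^bsub>EG\<^esub> inv\<^bsub>EG\<^esub> x
    = (x \<otimes>\<^bsub>EG\<^esub> g \<otimes>\<^bsub>EG\<^esub> inv\<^bsub>EG\<^esub> x) \<otimes>\<^bsub>EG\<^esub> (x \<otimes>\<^bsub>EG\<^esub> h \<otimes>\<^bsub>EG\<^esub> inv\<^bsub>EG\<^esub> x)"
proof -
  have "inv\<^bsub>EG\<^esub> x \<otimes>\<^bsub>EG\<^esub> (x \<otimes>\<^bsub>EG\<^esub> y) = y" if "y \<in> carrier EG" for y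
    using that assms by (simp add: EG.m_assoc[symmetric])
  then show ?thesis using assms by (simp add: EG.m_assoc)
qed

lemma conj_span:
  assumes "h \<in> span_group (deg_ge (Suc r))" "g \<in> span_group (deg_eq r)"
  shows "h \<otimes>\<^bsub>EG\<^esub> g \<otimes>\<^bsub>EG\<^esub> inv\<^bsub>EG\<^esub> h \<in> span_group (deg_eq r)"
proof -
  have sub: "deg_ge (Suc r) \<subseteq> W" "deg_eq r \<subseteq> W" by auto
  show ?thesis using assms(1) sub(1) assms(2)
  proof (induction h arbitrary: g rule: span_induct)
    case one
    then show ?case using span_carrier[OF sub(2), of g] by simp
  next
    case (gen w c)
    then have C: "e w c \<in> carrier EG" by (auto intro: e_carrier W_ColD)
    show ?case using gen(2) sub(2)
    proof (induction g rule: span_induct)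
      case one
      then show ?case using C by (simp add: generate.one)
    next
      case (gen u l)
      then show ?case using conj_gen[OF gen \<open>w \<in> deg_ge (Suc r)\<close>] by simp
    next
      case (mult g h)
      show ?case
        unfolding conj_mult[OF C span_carrier[OF sub(2) mult(1)] span_carrier[OF sub(2) mult(2)]]
        by (rule generate.eng[OF mult(3,4)])
    qed
  next
    case (mult h k)
    have C: "h \<in> carrier EG" "k \<in> carrier EG" "g \<in> carrier EG"
      using mult span_carrier[OF sub(1)] span_carrier[OF sub(2)] by auto
    have "h \<otimes>\<^bsub>EG\<^esub> k \<otimes>\<^bsub>EG\<^esub> g \<otimes>\<^bsub>EG\<^esub> inv\<^bsub>EG\<^esub> (h \<otimes>\<^bsub>EG\<^esub> k)
        = h \<otimes>\<^bsub>EG\<^esub> (k \<otimes>\<^bsub>EG\<^esub> g \<otimes>\<^bsub>EG\<^esub> inv\<^bsub>EG\<^esub> k) \<otimes>\<^bsub>EG\<^esub> inv\<^bsub>EG\<^esub> h"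
      using C by (simp add: EG.inv_mult_group EG.m_assoc)
    then show ?case using mult by simp
  qed
qed

text \<open>Products are rearranged by \<open>(a h)(b k) = (a (h b h^-1)) (h k)\<close>, where
  \<open>conj_span\<close> keeps the conjugate in degree \<open>r\<close>.\<close>

lemma span_deg_ge_decompose:
  assumes "x \<in> span_group (deg_ge r)"
  shows "\<exists>a\<in>span_group (deg_eq r). \<exists>h\<in>span_group (deg_ge (Suc r)). x = a \<otimes>\<^bsub>EG\<^esub> h"
proof -
  have sub: "deg_ge (Suc r) \<subseteq> W" "deg_eq r \<subseteq> W" "deg_ge r \<subseteq> W" by auto
  show ?thesis using assms sub(3)
  proof (induction x rule: span_induct)
    case one
    show ?case by (intro bexI[of _ "\<one>\<^bsub>EG\<^esub>"]) (auto intro: generate.one)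
  next
    case (gen v c)
    then have C: "e v c \<in> carrier EG" by (auto intro: e_carrier W_ColD)
    show ?case
    proof (cases "d v = r")
      case True
      then show ?thesis using gen C
        by (intro bexI[of _ "e v c"] bexI[of _ "\<one>\<^bsub>EG\<^esub>"]) (auto intro: generate.one e_span)
    next
      case False
      then show ?thesis using gen C
        by (intro bexI[of _ "\<one>\<^bsub>EG\<^esub>"] bexI[of _ "e v c"]) (auto intro: generate.one e_span)
    qed
  next
    case (mult x y)
    obtain a h b k where x: "a \<in> span_group (deg_eq r)" "h \<in> span_group (deg_ge (Suc r))" "x = a \<otimes>\<^bsub>EG\<^esub> h"
      and y: "b \<in> span_group (deg_eq r)" "k \<in> span_group (deg_ge (Suc r))" "y = b \<otimes>\<^bsub>EG\<^esub> k"
      using mult by blast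
    have C: "a \<in> carrier EG" "h \<in> carrier EG" "b \<in> carrier EG" "k \<in> carrier EG"
      using x y span_carrier[OF sub(1)] span_carrier[OF sub(2)] by auto
    have "inv\<^bsub>EG\<^esub> h \<otimes>\<^bsub>EG\<^esub> (h \<otimes>\<^bsub>EG\<^esub> k) = k" using C by (simp add: EG.m_assoc[symmetric])
    then have "x \<otimes>\<^bsub>EG\<^esub> y = (a \<otimes>\<^bsub>EG\<^esub> (h \<otimes>\<^bsub>EG\<^esub> b \<otimes>\<^bsub>EG\<^esub> inv\<^bsub>EG\<^esub> h)) \<otimes>\<^bsub>EG\<^esub> (h \<otimes>\<^bsub>EG\<^esub> k)"
      using C by (simp add: x y EG.m_assoc)
    moreover have "a \<otimes>\<^bsub>EG\<^esub> (h \<otimes>\<^bsub>EG\<^esub> b \<otimes>\<^bsub>EG\<^esub> inv\<^bsub>EG\<^esub> h) \<in> span_group (deg_eq r)"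
      using x y by (intro generate.eng conj_span)
    moreover have "h \<otimes>\<^bsub>EG\<^esub> k \<in> span_group (deg_ge (Suc r))" using x y by (intro generate.eng)
    ultimately show ?case by blast
  qed
qed

lemma e_commute_deg_eq:
  assumes "u \<in> W" "v \<in> W" "d u = d v"
  shows "e u c \<otimes>\<^bsub>EG\<^esub> e v l = e v l \<otimes>\<^bsub>EG\<^esub> e u c"
  using relation[OF assms(1,2)] assms(3) e_commute_height_0[OF W_ColD W_ColD, OF assms(1,2)]
    e_commute_same_facet[OF W_ColD W_ColD, OF assms(1,2)] by auto

lemma HT_deg_eq:
  assumes "u \<in> W" "v \<in> W" "d u = d v" "HT u \<noteq> HT v"
  shows "HT u (v, 0) = 0"
  using relation[OF assms(1,2)] assms(3,4) by auto

text \<open>The fact behind \<open>span_Int_trivial\<close>. Equal base facets, the one way to a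
  negative height, are excluded by \<open>same_facet_degree\<close>.\<close>

lemma HT_deg_less:
  assumes "u \<in> W" "v \<in> W" "d u < d v"
  shows "HT u (v, 0) = 0"
  using relation[OF assms(1,2)] assms(3) same_facet_degree[OF assms(1,2)] by auto

context
  fixes r N :: nat and v :: "nat \<Rightarrow> lvec"
  assumes v: "bij_betw v {1..N} (deg_eq r)"
begin

lemma v_mem: "i \<in> {1..N} \<Longrightarrow> v i \<in> W" "i \<in> {1..N} \<Longrightarrow> d (v i) = r"
  using v unfolding bij_betw_def by auto

lemma v_Col: "i \<in> {1..N} \<Longrightarrow> v i \<in> Col_spec n \<PP>"
  using v_mem W_ColD by blast

lemma tau_span: "tau n \<PP> N v c \<in> span_group (deg_eq r)"
  unfolding tau_def
  by (rule EG.ordered_prod_in_subgroup[OF subgroup_span]) (use v_mem in \<open>auto intro: e_span\<close>)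

text \<open>All factors of one degree commute, so the two products can be interleaved.\<close>

lemma tau_add: "tau n \<PP> N v (\<lambda>i\<in>{1..N}. c i + c' i) = tau n \<PP> N v c \<otimes>\<^bsub>EG\<^esub> tau n \<PP> N v c'"
proof -
  have "tau n \<PP> N v (\<lambda>i\<in>{1..N}. c i + c' i) = ordered_prod EG (\<lambda>i. e (v i) (c i) \<otimes>\<^bsub>EG\<^esub> e (v i) (c' i)) 1 N"
    unfolding tau_def by (rule ordered_prod_cong) (simp add: e_add v_Col)
  also have "\<dots> = tau n \<PP> N v c \<otimes>\<^bsub>EG\<^esub> tau n \<PP> N v c'"
    unfolding tau_def using v_mem v_Col
    by (intro EG.ordered_prod_mult) (auto intro: e_carrier e_commute_deg_eq)
  finally show ?thesis .
qed

lemma tau_single: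
  assumes "k \<in> {1..N}"
  shows "tau n \<PP> N v (\<lambda>i\<in>{1..N}. if i = k then c else 0) = e (v k) c"
  unfolding tau_def using assms
  by (subst EG.ordered_prod_single[of k]) (auto simp: e_0 v_Col intro: e_carrier)

lemma tau_zero: "tau n \<PP> N v (\<lambda>i\<in>{1..N}. 0) = \<one>\<^bsub>EG\<^esub>"
proof -
  have "tau n \<PP> N v (\<lambda>i\<in>{1..N}. 0) \<in> {\<one>\<^bsub>EG\<^esub>}"
    unfolding tau_def by (rule EG.ordered_prod_in_subgroup[OF EG.triv_subgroup]) (auto simp: e_0 v_Col)
  then show ?thesis by simp
qed

text \<open>The image of \<open>tau\<close> contains the generators and is closed under
  products.\<close>

lemma span_deg_eq: "span_group (deg_eq r) = tau n \<PP> N v ` ({1..N} \<rightarrow>\<^sub>E (UNIV :: 'r::comm_ring_1 set))"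
  (is "?L = ?R")
proof
  show "?R \<subseteq> ?L" using tau_span by blast
  show "?L \<subseteq> ?R"
  proof
    fix g :: "'r garing \<Rightarrow> 'r garing" assume "g \<in> span_group (deg_eq r)"
    moreover have "deg_eq r \<subseteq> W" by auto
    ultimately show "g \<in> tau n \<PP> N v ` ({1..N} \<rightarrow>\<^sub>E UNIV)"
    proof (induction g rule: span_induct)
      case one
      show ?case by (rule image_eqI, rule tau_zero[symmetric]) (simp add: PiE_iff extensional_def)
    next
      case (gen u c)
      then have "u \<in> v ` {1..N}" unfolding bij_betw_imp_surj_on[OF v] .
      then obtain k where k: "k \<in> {1..N}" "u = v k" by blast
      show ?case unfolding k(2)
        by (rule image_eqI, rule tau_single[OF k(1), symmetric]) (simp add: PiE_iff extensional_def)
    next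
      case (mult g h)
      then obtain c c' where gh: "g = tau n \<PP> N v c" "h = tau n \<PP> N v c'" by blast
      show ?case unfolding gh
        by (rule image_eqI, rule tau_add[symmetric]) (simp add: PiE_iff extensional_def)
    qed
  qed
qed

lemma foldr_apply:
  assumes "f \<in> R_spec \<PP>" "set is \<subseteq> {1..N}"
  shows "foldr (\<lambda>i g. e (v i) (c i) \<otimes>\<^bsub>EG\<^esub> g) is \<one>\<^bsub>EG\<^esub> \<in> carrier EG \<and>
    (foldr (\<lambda>i g. e (v i) (c i) \<otimes>\<^bsub>EG\<^esub> g) is \<one>\<^bsub>EG\<^esub>) f
     = foldr (\<lambda>i. elem_map (HT (v i)) (v i, 0) (c i)) is f"
  using assms(2)
proof (induction "is")
  case Nil
  then show ?case using assms(1) by (simp add: EG_one_apply)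
next
  case (Cons i "is")
  let ?g = "foldr (\<lambda>i g. e (v i) (c i) \<otimes>\<^bsub>EG\<^esub> g) is \<one>\<^bsub>EG\<^esub>"
  have i: "v i \<in> Col_spec n \<PP>" and g: "?g \<in> carrier EG" using Cons v_Col by auto
  then have "(e (v i) (c i) \<otimes>\<^bsub>EG\<^esub> ?g) f = elem_map (HT (v i)) (v i, 0) (c i) (?g f)"
    using assms(1) EG_apply_closed[OF g assms(1)] by (simp add: EG_mult_apply e_carrier elem_spec_eq)
  then show ?case using Cons i g by (simp add: e_carrier)
qed

text \<open>The total height over the distinct base facets drops by exactly one along each \<open>v\<^sub>i\<close>.\<close>

lemma lookup_tau:
  fixes c :: "nat \<Rightarrow> 'r::comm_ring_1"
  assumes k: "k \<in> {1..N}" and x: "x \<in> S" "HT (v k) x = 1"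
  shows "Poly_Mapping.lookup (tau n \<PP> N v c (Poly_Mapping.single x 1)) ((v k, 0) + x) = c k"
proof -
  \<comment> \<open>Summing over the image set counts a facet shared by several \<open>v i\<close>
    once; each \<open>v i\<close> has height -1 over its own facet and 0 over the others.\<close>
  define D where "D y = (\<Sum>h\<in>HT ` deg_eq r. h y)" for y
  have fin: "finite (deg_eq r)" using v bij_betw_finite by blast
  have "additive D"
  proof (rule additive.intro)
    fix y z
    have "h (y + z) = h y + h z" if "h \<in> HT ` deg_eq r" for h
      using that HT_additive[OF W_ColD] by (auto intro: additive.add)
    then have "D (y + z) = (\<Sum>h\<in>HT ` deg_eq r. h y + h z)" unfolding D_def by (intro sum.cong) auto
    then show "D (y + z) = D y + D z" by (simp add: D_def sum.distrib)
  qed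
  moreover have "D (v i, 0) = -1" if i: "i \<in> {1..N}" for i
  proof -
    have "D (v i, 0) = (\<Sum>h\<in>HT ` deg_eq r. if h = HT (v i) then -1 else 0)"
      unfolding D_def
    proof (rule sum.cong[OF refl])
      fix h assume "h \<in> HT ` deg_eq r"
      then obtain u where u: "h = HT u" "u \<in> W" "d u = r" by blast
      then show "h (v i, 0) = (if h = HT (v i) then -1 else 0)"
        using HT_self[OF v_Col[OF i]] HT_deg_eq[OF u(2) v_mem(1)[OF i]] v_mem(2)[OF i] by auto
    qed
    also have "\<dots> = -1" using fin v_mem[OF i] by (subst sum.delta) auto
    finally show ?thesis .
  qed
  moreover have "inj_on (\<lambda>i. (v i, 0 :: int)) {1..N}" 
    by (rule inj_onI, rule inj_onD[OF bij_betw_imp_inj_on[OF v]]) auto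
  moreover have f: "Poly_Mapping.single x (1 :: 'r) \<in> R_spec \<PP>" using x(1) by (simp add: R_spec_iff)
  moreover have "set [1..<Suc N] = {1..N}" by auto
  ultimately have lookup: "Poly_Mapping.lookup (foldr (\<lambda>i. elem_map (HT (v i)) (v i, 0) (c i)) [1..<Suc N] (Poly_Mapping.single x 1))
      ((v k, 0) + x) = of_nat (nat (HT (v k) x)) * c k"
    using k by (intro lookup_foldr_elem[of D "[1..<Suc N]" "\<lambda>i. (v i, 0)" k "\<lambda>i. HT (v i)"])
      (simp_all del: upt_Suc)
  have "tau n \<PP> N v c (Poly_Mapping.single x 1)
      = foldr (\<lambda>i. elem_map (HT (v i)) (v i, 0) (c i)) [1..<Suc N] (Poly_Mapping.single x 1)"
    unfolding tau_def ordered_prod_def by (rule foldr_apply[OF f, THEN conjunct2]) auto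
  then show ?thesis using lookup x(2) by simp
qed

lemma tau_inj: "inj_on (tau n \<PP> N v) ({1..N} \<rightarrow>\<^sub>E (UNIV :: 'r::comm_ring_1 set))"
proof (rule inj_onI)
  fix c c' :: "nat \<Rightarrow> 'r"
  assume c: "c \<in> {1..N} \<rightarrow>\<^sub>E UNIV" "c' \<in> {1..N} \<rightarrow>\<^sub>E UNIV" "tau n \<PP> N v c = tau n \<PP> N v c'"
  have "c k = c' k" if k: "k \<in> {1..N}" for k
  proof -
    obtain x where "x \<in> S" "HT (v k) x = 1" using HT_ex_1[OF v_Col[OF k]] by blast
    from lookup_tau[OF k this, of c] lookup_tau[OF k this, of c'] c(3) show ?thesis by simp
  qed
  then show "c = c'" using c(1,2) by (intro PiE_ext) auto
qed

text \<open>\<open>G\<^sub>r\<^sub>+\<^sub>1\<close> does not lower the height over the base facet of any \<open>v\<^sub>k\<close>, whereas \<open>v\<^sub>k\<close> does.\<close>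

lemma span_Int_trivial:
  "span_group (deg_eq r) \<inter> span_group (deg_ge (Suc r)) \<subseteq> {\<one>\<^bsub>EG :: ('r::comm_ring_1 garing \<Rightarrow> 'r garing) monoid\<^esub>}"
proof
  fix g :: "'r garing \<Rightarrow> 'r garing"
  assume g: "g \<in> span_group (deg_eq r) \<inter> span_group (deg_ge (Suc r))"
  then obtain c where c: "g = tau n \<PP> N v c" "c \<in> {1..N} \<rightarrow>\<^sub>E UNIV" unfolding span_deg_eq by blast
  have "c k = 0" if k: "k \<in> {1..N}" for k
  proof -
    obtain x where x: "x \<in> S" "HT (v k) x = 1" using HT_ex_1[OF v_Col[OF k]] by blast
    \<comment> \<open>The monomial \<open>x\<close> belongs to \<open>?T\<close>, its height being
      1, while its shift by \<open>v k\<close> has height 0. Invariance of \<open>?T\<close> under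
      \<open>g\<close> therefore kills the coefficient \<open>c k\<close>.\<close>
    let ?T = "{f \<in> R_spec \<PP>. Poly_Mapping.keys f \<subseteq> {y. 1 \<le> HT (v k) y}}"
    have sub: "deg_ge (Suc r) \<subseteq> W" by auto
    have "g \<in> span_group (deg_ge (Suc r))" using g by blast
    then have gT: "\<forall>f\<in>?T. g f \<in> ?T" using sub
    proof (induction g rule: span_induct)
      case one
      then show ?case by (simp add: EG_one_apply)
    next
      case (gen w a)
      have w: "w \<in> Col_spec n \<PP>" using gen W_ColD by blast
      have "HT (v k) (w, 0) = 0" using gen v_mem[OF k] by (intro HT_deg_less) auto
      then have "HT (v k) ((w, 0) + y) = HT (v k) y" for y
        by (simp add: additive.add[OF HT_additive[OF v_Col[OF k]]])
      then have "Poly_Mapping.keys (elem_map (HT w) (w, 0) a f) \<subseteq> {y. 1 \<le> HT (v k) y}"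
        if "Poly_Mapping.keys f \<subseteq> {y. 1 \<le> HT (v k) y}" for f using that by (intro keys_elem_closed) auto
      moreover have "elem_map (HT w) (w, 0) a f \<in> R_spec \<PP>" if "f \<in> R_spec \<PP>" for f
        by (rule R_spec_iff[THEN iffD2, OF keys_elem_S[OF w R_spec_iff[THEN iffD1, OF that]]])
      ultimately show ?case by (auto simp: elem_spec_eq[OF w])
    next
      case (mult g h)
      then have "g \<in> carrier EG" "h \<in> carrier EG" using span_carrier[OF sub] by auto
      then show ?case using mult by (auto simp: EG_mult_apply)
    qed
    have sT: "Poly_Mapping.single x 1 \<in> ?T" using x by (simp add: R_spec_iff)
    have "Poly_Mapping.keys (g (Poly_Mapping.single x 1)) \<subseteq> {y. 1 \<le> HT (v k) y}"
      using bspec[OF gT sT] by simp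
    moreover have "HT (v k) ((v k, 0) + x) = 0"
      by (simp add: additive.add[OF HT_additive[OF v_Col[OF k]]] HT_self[OF v_Col[OF k]] x)
    ultimately have "(v k, 0) + x \<notin> Poly_Mapping.keys (g (Poly_Mapping.single x 1))" by auto
    then show ?thesis using lookup_tau[OF k x, of c] by (simp add: c(1) in_keys_iff)
  qed
  then have "c = (\<lambda>i\<in>{1..N}. 0)" using c(2) by (intro PiE_ext) auto
  then show "g \<in> {\<one>\<^bsub>EG\<^esub>}" using tau_zero c(1) by simp
qed

end

end

section \<open>Rigid systems\<close>

lemma path_bar_class:
  assumes "C \<in> path_bar G" "p \<in> C"
  shows "p \<in> dipaths G" "C = same_ends G `` {p}"
  using assms unfolding path_bar_def quotient_def same_ends_def by auto

lemma path_bar_nonempty: "C \<in> path_bar G \<Longrightarrow> C \<noteq> {}"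
  unfolding path_bar_def quotient_def same_ends_def by auto

lemma path_bar_ends:
  assumes "C \<in> path_bar G" "p \<in> C" "q \<in> C"
  shows "tail G (hd p) = tail G (hd q)" "head G (last p) = head G (last q)"
  using assms path_bar_class[OF assms(1,2)] by (auto simp: same_ends_def)

locale rigid_system = spectrum +
  fixes j :: nat and V :: "lvec set" and F :: "('a, 'b) pre_digraph" and \<phi> :: "lvec \<Rightarrow> 'b list set"
  assumes V: "rigid (n + j) (\<PP> j) V" and F: "supports (n + j) (\<PP> j) V F \<phi>"
begin

sublocale F: rigid_digraph F
  using F by unfold_locales (simp add: supports_def)

abbreviation W where "W \<equiv> strong_products (n + j) (\<PP> j) V"
abbreviation prd where "prd \<equiv> prod_exists (n + j) (\<PP> j)"

lemma W_weak: "W = weak_products (n + j) (\<PP> j) V"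
  using V by (simp add: rigid_def)

lemma W_sum: "u \<in> W \<Longrightarrow> v \<in> W \<Longrightarrow> u + v \<noteq> 0"
  using V unfolding rigid_def by (metis add_eq_0_iff)

lemma W_prd: "u \<in> W \<Longrightarrow> v \<in> W \<Longrightarrow> prd u v \<Longrightarrow> u + v \<in> W"
  unfolding W_weak by (rule weak_products.mult)

text \<open>Identifying strong with weak products allows induction over products of two, where
  \<open>col_form_prod\<close> applies.\<close>

lemma W_form:
  assumes "v \<in> W" obtains g c where "form j v g c"
proof -
  have "\<exists>g c. form j v g c" using assms unfolding W_weak
  proof (induction rule: weak_products.induct)
    case (base v)
    then show ?case using V Col_form by (auto simp: rigid_def)
  next
    case (mult a b)
    then obtain f c g d where f: "form j a f c" and g: "form j b g d" by blast
    have "a + b \<noteq> 0 \<and> g a = 1" using prod_exists_iff[OF lattice_polytope balanced f g] mult by simp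
    then show ?case using col_form_prod[OF lattice_polytope balanced f g] by blast
  qed
  then show ?thesis using that by blast
qed

lemma W_Col: "W \<subseteq> Col_spec n \<PP>"
proof
  fix v assume "v \<in> W"
  then obtain g c where "form j v g c" by (rule W_form)
  then show "v \<in> Col_spec n \<PP>" unfolding Col_spec_def using Col_form by blast
qed

text \<open>Existence depends on the right factor only through its height function, that is, through
  its base facet.\<close>

lemma prd_iff: "u \<in> W \<Longrightarrow> v \<in> W \<Longrightarrow> prd u v \<longleftrightarrow> HT v (u, 0) = 1"
  by (metis HT_col W_form W_sum balanced lattice_polytope prod_exists_iff)

lemma HT_prd:
  assumes u: "u \<in> W" and v: "v \<in> W" and uv: "prd u v"
  shows "HT u (v, 0) = 0" "HT (u + v) = HT u"
proof -
  obtain f a where f: "form j u f a" using W_form[OF u] .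
  obtain g c where g: "form j v g c" using W_form[OF v] .
  have "g u = 1" using prod_exists_iff[OF lattice_polytope balanced f g] uv by simp
  note * = col_form_prod[OF lattice_polytope balanced f g W_sum[OF u v] this]
  show "HT u (v, 0) = 0" using HT_col[OF g f] *(1) by simp
  have "f (u + v) = -1" using col_formD(4)[OF *(2)] .
  then show "HT (u + v) = HT u" using HT_same_facet[OF *(2) f] by simp
qed

text \<open>By balancedness, without a product the height is 0 or negative, and a negative height
  means equal base facets.\<close>

lemma HT_not_prd:
  assumes u: "u \<in> W" and v: "v \<in> W" and "\<not> prd u v"
  shows "HT v (u, 0) = 0 \<or> HT u = HT v"
proof -
  obtain f a where f: "form j u f a" using W_form[OF u] .
  obtain g c where g: "form j v g c" using W_form[OF v] .
  have "g u \<le> 1" using col_form_balancedD[OF lattice_polytope balanced g f] .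
  moreover have "g u \<noteq> 1" using prod_exists_iff[OF lattice_polytope balanced f g] W_sum[OF u v] assms(3) by simp
  ultimately have "g u = 0 \<or> g u < 0" by linarith
  then show ?thesis using HT_same_facet[OF f g] HT_col[OF f g] by auto
qed

lemma \<phi>_path_bar: "v \<in> W \<Longrightarrow> \<phi> v \<in> path_bar F"
  using F unfolding supports_def bij_betw_def by blast

lemma \<phi>_surj: "C \<in> path_bar F \<Longrightarrow> \<exists>v\<in>W. \<phi> v = C"
  using F unfolding supports_def bij_betw_def by (metis imageE)

lemma \<phi>_prd: "u \<in> W \<Longrightarrow> v \<in> W \<Longrightarrow> w \<in> W \<Longrightarrow> prd u v \<and> w = u + v \<longleftrightarrow> bar_prod F (\<phi> u) (\<phi> v) (\<phi> w)"
  using F unfolding supports_def by blast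

definition d where "d v = F.deg (hd (SOME p. p \<in> \<phi> v))"

lemma d_eq:
  assumes v: "v \<in> W" and p: "p \<in> \<phi> v"
  shows "d v = F.deg (hd p)"
proof -
  let ?q = "SOME p. p \<in> \<phi> v"
  have q: "?q \<in> \<phi> v" using p by (rule someI)
  note C = \<phi>_path_bar[OF v]
  have "hd ?q \<in> arcs F" "hd p \<in> arcs F"
    using path_bar_class(1)[OF C q] path_bar_class(1)[OF C p] F.dipath_hd(2) by auto
  then show ?thesis unfolding d_def by (rule F.deg_tail) (rule path_bar_ends[OF C q p])
qed

lemma has_degree_\<phi>:
  assumes "v \<in> W" "p \<in> \<phi> v"
  shows "has_degree F (hd p) r \<longleftrightarrow> r = d v"
  using F.has_degree_iff[OF F.dipath_hd(2)[OF path_bar_class(1)[OF \<phi>_path_bar[OF assms(1)] assms(2)]]]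
    d_eq[OF assms] by simp

lemma \<phi>_nonempty: "v \<in> W \<Longrightarrow> \<exists>p. p \<in> \<phi> v"
  using path_bar_nonempty[OF \<phi>_path_bar] by blast

lemma deg_eq_part_eq: "deg_eq_part (n + j) (\<PP> j) V F \<phi> r = {v \<in> W. d v = r}"
  unfolding deg_eq_part_def
proof (intro Collect_cong conj_cong refl)
  fix v assume v: "v \<in> W"
  then show "(\<exists>p\<in>\<phi> v. has_degree F (hd p) r) \<longleftrightarrow> d v = r"
    using has_degree_\<phi>[OF v] \<phi>_nonempty[OF v] by auto
qed

lemma deg_ge_part_eq: "deg_ge_part (n + j) (\<PP> j) V F \<phi> r = {v \<in> W. r \<le> d v}"
  unfolding deg_ge_part_def
proof (intro Collect_cong conj_cong refl)
  fix v assume v: "v \<in> W"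
  then show "(\<exists>p\<in>\<phi> v. \<exists>k\<ge>r. has_degree F (hd p) k) \<longleftrightarrow> r \<le> d v"
    using has_degree_\<phi>[OF v] \<phi>_nonempty[OF v] by auto
qed

text \<open>The path of the product starts like that of \<open>u\<close>, and the path of
  \<open>v\<close> continues it, so the first arc for \<open>v\<close> is strictly later.\<close>

lemma d_prd:
  assumes u: "u \<in> W" and v: "v \<in> W" and uv: "prd u v"
  shows "d u < d v" "d (u + v) = d u"
proof -
  have "bar_prod F (\<phi> u) (\<phi> v) (\<phi> (u + v))" using \<phi>_prd[OF u v W_prd[OF u v uv]] uv by blast
  then obtain p q where pq: "p \<in> \<phi> u" "q \<in> \<phi> v" "p @ q \<in> dipaths F" "\<phi> (u + v) = same_ends F `` {p @ q}"
    unfolding bar_prod_def by blast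
  have p: "p \<in> dipaths F" and q: "q \<in> dipaths F"
    using path_bar_class(1)[OF \<phi>_path_bar] pq u v by auto
  have "p @ q \<in> \<phi> (u + v)" using pq by (auto simp: same_ends_def)
  then show "d (u + v) = d u"
    using d_eq[OF W_prd[OF u v uv]] d_eq[OF u pq(1)] F.dipath_hd(1)[OF p] by simp
  have ht: "head F (last p) = tail F (hd q)" using F.dipath_append[OF p q] pq(3) by simp
  then have "p @ [hd q] \<in> dipaths F"
    using F.dipath_append[OF p F.dipath_arc[OF F.dipath_hd(2)[OF q]]] by simp
  then have "arc_le F (hd p) (hd q)"
    unfolding arc_le_def using F.dipath_hd(1)[OF p] by (intro bexI[of _ "p @ [hd q]"]) auto
  moreover have "hd p \<noteq> hd q" using ht F.no_closed_dipath[OF p] by auto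
  ultimately show "d u < d v"
    using F.deg_strict_mono d_eq[OF u pq(1)] d_eq[OF v pq(2)] by simp
qed

text \<open>Whether \<open>au\<close> exists depends on the base facet of \<open>u\<close> only. So for equal base facets, the arcs
  ending where \<open>u\<close> starts end where \<open>v\<close> starts.\<close>

lemma d_same_facet:
  assumes "u \<in> W" "v \<in> W" "HT u = HT v"
  shows "d u = d v"
proof -
  have "d u \<le> d v" if u: "u \<in> W" and v: "v \<in> W" and eq: "HT u = HT v" for u v
  proof -
    obtain p where p: "p \<in> \<phi> u" using \<phi>_nonempty[OF u] by blast
    obtain q where q: "q \<in> \<phi> v" using \<phi>_nonempty[OF v] by blast
    have pD: "p \<in> dipaths F" and qD: "q \<in> dipaths F"
      using path_bar_class(1)[OF \<phi>_path_bar] p q u v by auto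
    have arcs: "hd p \<in> arcs F" "hd q \<in> arcs F" using F.dipath_hd(2) pD qD by auto
    show ?thesis
    proof (cases "2 \<le> d u")
      \<comment> \<open>Here \<open>d u \<le> 1\<close>, and every degree is at least 1.\<close>
      case False
      then show ?thesis using F.deg_ge_1[OF arcs(2)] d_eq[OF v q] by simp
    next
      case True
      then obtain f where f: "f \<in> arcs F" "head F f = tail F (hd p)"
        using F.deg_ge_2_arc_before[OF pD] d_eq[OF u p] by auto
      have cls: "same_ends F `` {x} \<in> path_bar F" if "x \<in> dipaths F" for x
        using that unfolding path_bar_def by (rule quotientI)
      have fp: "[f] @ p \<in> dipaths F" using F.dipath_append[OF F.dipath_arc[OF f(1)] pD] f by simp
      obtain a where a: "a \<in> W" "\<phi> a = same_ends F `` {[f]}"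
        using \<phi>_surj[OF cls[OF F.dipath_arc[OF f(1)]]] by blast
      obtain w where w: "w \<in> W" "\<phi> w = same_ends F `` {[f] @ p}"
        using \<phi>_surj[OF cls[OF fp]] by blast
      have fa: "[f] \<in> \<phi> a" using a F.dipath_arc[OF f(1)] by (simp add: same_ends_def)
      then have "bar_prod F (\<phi> a) (\<phi> u) (\<phi> w)" unfolding bar_prod_def using p fp w by blast
      then have "prd a u" using \<phi>_prd[OF a(1) u w(1)] by blast
      \<comment> \<open>The transfer from \<open>u\<close> to \<open>v\<close>:
        \<open>prd_iff\<close> sees only the common height function.\<close>
      then have av: "prd a v" using prd_iff[OF a(1) u] prd_iff[OF a(1) v] eq by simp
      then have "bar_prod F (\<phi> a) (\<phi> v) (\<phi> (a + v))" using \<phi>_prd[OF a(1) v W_prd[OF a(1) v av]] by blast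
      then obtain p' q' where pq: "p' \<in> \<phi> a" "q' \<in> \<phi> v" "p' @ q' \<in> dipaths F"
        unfolding bar_prod_def by blast
      have "p' \<in> dipaths F" "q' \<in> dipaths F" using path_bar_class(1)[OF \<phi>_path_bar] pq a(1) v by auto
      then have "head F (last p') = tail F (hd q')" using F.dipath_append pq(3) by blast
      moreover have "head F (last p') = head F f" using path_bar_ends(2)[OF \<phi>_path_bar[OF a(1)] pq(1) fa] by simp
      ultimately have "tail F (hd p) = tail F (hd q)"
        using f(2) path_bar_ends(1)[OF \<phi>_path_bar[OF v] pq(2) q] by simp
      then show ?thesis using F.deg_tail[OF arcs] d_eq[OF u p] d_eq[OF v q] by simp
    qed
  qed
  then show ?thesis using assms by (metis antisym)
qed

text \<open>For \<open>d u \<le> d v\<close> the product \<open>vu\<close> cannot exist, as it would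
  give \<open>d v < d u\<close>. The cases are then decided by whether \<open>uv\<close>
  exists.\<close>

sublocale triangular_system n \<PP> W d
proof
  show "W \<subseteq> Col_spec n \<PP>" by (rule W_Col)
  show "d u = d v" if "u \<in> W" "v \<in> W" "HT u = HT v" for u v using d_same_facet that .
  fix u v assume u: "u \<in> W" and v: "v \<in> W" and le: "d u \<le> d v"
  have "\<not> prd v u" using d_prd(1)[OF v u] le by auto
  then have vu: "HT u (v, 0) = 0 \<or> HT v = HT u" by (rule HT_not_prd[OF v u])
  show "HT u (v, 0) = 0 \<and> HT v (u, 0) = 0 \<or> HT u = HT v \<or>
      u + v \<in> W \<and> HT (u + v) = HT u \<and> HT u (v, 0) = 0 \<and> HT v (u, 0) = 1 \<and> d u < d v \<and> d (u + v) = d u"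
  proof (cases "prd u v")
    case True
    then show ?thesis using W_prd[OF u v] HT_prd[OF u v] d_prd[OF u v] prd_iff[OF u v] by blast
  next
    case False
    then show ?thesis using HT_not_prd[OF u v] vu by auto
  qed
qed

lemma d_le_max_degree:
  assumes "max_degree F t" "v \<in> W"
  shows "d v \<le> t"
proof -
  obtain p where p: "p \<in> \<phi> v" using \<phi>_nonempty[OF assms(2)] by blast
  have "hd p \<in> arcs F" using F.dipath_hd(2)[OF path_bar_class(1)[OF \<phi>_path_bar[OF assms(2)] p]] .
  then show ?thesis using assms(1) has_degree_\<phi>[OF assms(2) p] unfolding max_degree_def by blast
qed

lemma carrier_elem_subgroup: "carrier (elem_subgroup n \<PP> {v \<in> W. r \<le> d v}) = span_group {v \<in> W. r \<le> d v}"
  unfolding elem_subgroup_def carrier_subgroup_generated gens_def[symmetric]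
  by (subst Int_absorb1[OF gens_carrier]) auto

end

theorem theorem5p3:
  fixes P :: "rvec set" and \<PP> :: "nat \<Rightarrow> rvec set" and V :: "lvec set"
    and F :: "('a, 'b) pre_digraph" and \<phi> :: "lvec \<Rightarrow> 'b list set"
    and n j t :: nat and N :: "nat \<Rightarrow> nat" and v :: "nat \<Rightarrow> nat \<Rightarrow> lvec"
    and G :: "nat \<Rightarrow> ('r::comm_ring_1 garing \<Rightarrow> 'r garing) monoid"
    and \<tau> :: "nat \<Rightarrow> (nat \<Rightarrow> 'r) \<Rightarrow> ('r garing \<Rightarrow> 'r garing)"
    and A :: "nat \<Rightarrow> ('r garing \<Rightarrow> 'r garing) set"
  assumes "lattice_polytope n P" and "balanced n P" and "Col n P \<noteq> {}"
    and "doubling_spectrum n \<PP>" and "\<PP> 0 = P"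
    and "rigid (n + j) (\<PP> j) V"
    and "supports (n + j) (\<PP> j) V F \<phi>"
    and "max_degree F t"
    and "\<And>r. N r = card (deg_eq_part (n + j) (\<PP> j) V F \<phi> r)"
    and "\<And>r. r \<in> {1..t} \<Longrightarrow> bij_betw (v r) {1..N r} (deg_eq_part (n + j) (\<PP> j) V F \<phi> r)"
    and "\<And>r. G r = elem_subgroup n \<PP> (deg_ge_part (n + j) (\<PP> j) V F \<phi> r)"
    and "\<And>r. \<tau> r = tau n \<PP> (N r) (v r)"
    and "\<And>r. A r = \<tau> r ` carrier (additive_power (N r))"
  shows "(\<forall>r\<in>{1..t}. \<tau> r \<in> hom (additive_power (N r)) (G r) \<and>
                     inj_on (\<tau> r) (carrier (additive_power (N r)))) \<and>
         (\<forall>r\<in>{1..t}. \<forall>\<epsilon>\<in>carrier (G r).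
            \<exists>!f. f \<in> (\<Pi>\<^sub>E s\<in>{r..t}. A s) \<and> \<epsilon> = ordered_prod (E_group n \<PP>) f r t)"
proof -
  interpret rigid_system n \<PP> j V F \<phi>
    using assms by unfold_locales auto
  let ?K = "\<lambda>r. span_group (deg_ge r) :: ('r garing \<Rightarrow> 'r garing) set"
  have bij: "bij_betw (v r) {1..N r} (deg_eq r)" if "r \<in> {1..t}" for r
    using assms(10)[OF that] by (simp add: deg_eq_part_eq)
  have G: "carrier (G r) = ?K r" "mult (G r) = mult EG" for r
    unfolding assms(11) deg_ge_part_eq carrier_elem_subgroup by (simp_all add: elem_subgroup_def)
  have pow: "carrier (additive_power M) = {1..M} \<rightarrow>\<^sub>E UNIV"
      "x \<otimes>\<^bsub>additive_power M\<^esub> y = (\<lambda>i\<in>{1..M}. x i + y i)" for M and x y :: "nat \<Rightarrow> 'r"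
    by (simp_all add: additive_power_def)
  have A: "A r = span_group (deg_eq r)" if "r \<in> {1..t}" for r
    unfolding assms(13) assms(12) pow(1) by (rule span_deg_eq[OF bij[OF that], symmetric])
  have sub: "span_group (deg_eq r) \<subseteq> ?K r" "?K (Suc r) \<subseteq> ?K r" for r
    by (intro span_mono; auto)+
  show ?thesis
  proof (intro conjI ballI)
    fix r assume r: "r \<in> {1..t}"
    show "\<tau> r \<in> hom (additive_power (N r)) (G r)"
      unfolding assms(12) hom_def pow(2) G
      using tau_span[OF bij[OF r]] sub(1)[of r] tau_add[OF bij[OF r]] by auto
    show "inj_on (\<tau> r) (carrier (additive_power (N r)))"
      unfolding assms(12) pow(1) by (rule tau_inj[OF bij[OF r]])
  next
    fix r \<epsilon> assume r: "r \<in> {1..t}" and \<epsilon>: "\<epsilon> \<in> carrier (G r)"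
    have At: "A s = span_group (deg_eq s)" if "s \<in> {r..t}" for s using A that r by auto
    have "\<forall>x\<in>?K r. \<exists>!f. f \<in> (\<Pi>\<^sub>E s\<in>{r..t}. A s) \<and> x = ordered_prod EG f r t"
    proof (rule EG.unique_ordered_prod)
      \<comment> \<open>No column has degree above \<open>t\<close>, so the descending sequence of
        groups ends in the trivial one.\<close>
      have empty: "deg_ge (Suc t) = {}" using d_le_max_degree[OF assms(8)] by force
      show "?K (Suc t) = {\<one>\<^bsub>EG\<^esub>}" unfolding empty by (simp add: gens_def EG.generate_empty)
      show "subgroup (?K s) EG" for s by (rule subgroup_span) auto
      show "r \<le> Suc t" using r by simp
      fix s assume s: "s \<in> {r..t}"
      show "subgroup (A s) EG" unfolding At[OF s] by (rule subgroup_span) auto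
      show "A s \<subseteq> ?K s" "?K (Suc s) \<subseteq> ?K s" unfolding At[OF s] by (rule sub)+
      show "A s \<inter> ?K (Suc s) \<subseteq> {\<one>\<^bsub>EG\<^esub>}"
        unfolding At[OF s] by (rule span_Int_trivial[OF bij]) (use s r in auto)
      show "\<exists>a\<in>A s. \<exists>h\<in>?K (Suc s). x = a \<otimes>\<^bsub>EG\<^esub> h" if "x \<in> ?K s" for x
        unfolding At[OF s] by (rule span_deg_ge_decompose[OF that])
    qed
    then show "\<exists>!f. f \<in> (\<Pi>\<^sub>E s\<in>{r..t}. A s) \<and> \<epsilon> = ordered_prod EG f r t"
      using \<epsilon> unfolding G by blast
  qed
qed

end
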